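(* Let $E=(d_0,d_1)$ with $-\infty\le d_0<d_1\le\infty$, equipped with Lebesgue measure, and $L^1=L^1(E)$. Let $g\colon E\to\mathbb{R}$ be continuous and strictly positive and let $\varphi\ge0$ be Borel measurable and integrable on compact subsets of $E$. Define $G,Q,\pi_t$ and the semigroups $\{P_0(t)\}_{t\ge0}$, $\{S(t)\}_{t\ge 0}$ as in the context, and assume $G(d_1)=+\infty$. Let $A_0u=-\frac{d}{dx}(gu)$ with domain \[ \mathcal{D}(A_0)=\{u\in L^1:\ gu\in AC,\ A_0u\in L^1,\ \lim_{x\downarrow d_0}g(x)u(x)=0\}, \] and let $Au=A_0u-\varphi u$ with domain $\mathcal{D}(A)=\mathcal{D}(A_0)\cap L^1_\varphi$, where $L^1_\varphi=\{u\in L^1:\varphi u\in L^1\}$. Then $(A_0,\mathcal{D}(A_0))$ is the generator of $\{P_0(t)\}_{t\ge0}$ and $(A,\mathcal{D}(A))$ is the generator of $\{S(t)\}_{t\ge0}$.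
   Context: $AC$ denotes the space of absolutely continuous functions on $E$. $G(x)=\int_{x_0}^x\frac{dz}{g(z)}$ and $Q(x)=\int_{x_1}^x\frac{\varphi(z)}{g(z)}dz$, where $x_0=d_0$ (resp. $x_1=d_0$) if the corresponding integral is finite for all $x\in E$, and otherwise $x_0$ (resp. $x_1$) is a fixed point of $E$; $G(d_i)$ denotes the (possibly infinite) one-sided limit. $G^{-1}$ is defined on $G(E)$ and extended continuously to $\mathbb{R}$ with value $d_0$ below $G(E)$ and $d_1$ above $G(E)$; $\pi_tx=G^{-1}(G(x)+t)$. For $t\ge0$, $u\in L^1$, $x\in E$: $P_0(t)u(x)=\mathbf{1}_E(\pi_{-t}x)u(\pi_{-t}x)\frac{g(\pi_{-t}x)}{g(x)}$ and $S(t)u(x)=e^{Q(\pi_{-t}x)-Q(x)}P_0(t)u(x)$ (interpreted as $0$ when $\pi_{-t}x\notin E$). *)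

theory Defs
  imports "HOL-Analysis.Analysis"
begin

definition Eint :: "ereal \<Rightarrow> ereal \<Rightarrow> real set" where
  "Eint d0 d1 = {x. d0 < ereal x \<and> ereal x < d1}"

definition abs_cont_on_interval :: "(real \<Rightarrow> real) \<Rightarrow> real \<Rightarrow> real \<Rightarrow> bool" where
  "abs_cont_on_interval f a b \<longleftrightarrow>
     (\<forall>\<epsilon>>0. \<exists>\<delta>>0. \<forall>(n::nat) (l::nat \<Rightarrow> real) (r::nat \<Rightarrow> real).
        (\<forall>k<n. a \<le> l k \<and> l k \<le> r k \<and> r k \<le> b) \<and>
        (\<forall>i<n. \<forall>j<n. i \<noteq> j \<longrightarrow> r i \<le> l j \<or> r j \<le> l i) \<and>
        (\<Sum>k<n. r k - l k) < \<delta>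
        \<longrightarrow> (\<Sum>k<n. \<bar>f (r k) - f (l k)\<bar>) < \<epsilon>)"

definition AC_on :: "real set \<Rightarrow> (real \<Rightarrow> real) \<Rightarrow> bool" where
  "AC_on E f \<longleftrightarrow> (\<forall>a b. a \<le> b \<and> {a..b} \<subseteq> E \<longrightarrow> abs_cont_on_interval f a b)"

definition L1 :: "real set \<Rightarrow> (real \<Rightarrow> real) \<Rightarrow> bool" where
  "L1 E u \<longleftrightarrow> set_integrable lborel E u"

definition base_pt :: "ereal \<Rightarrow> ereal \<Rightarrow> real \<Rightarrow> (real \<Rightarrow> real) \<Rightarrow> ereal" where
  "base_pt d0 d1 c h =
     (if \<forall>x\<in>Eint d0 d1. set_integrable lborel {z. d0 < ereal z \<and> z \<le> x} h then d0 else ereal c)"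

definition prim :: "ereal \<Rightarrow> ereal \<Rightarrow> real \<Rightarrow> (real \<Rightarrow> real) \<Rightarrow> real \<Rightarrow> real" where
  "prim d0 d1 c h x = interval_lebesgue_integral lborel (base_pt d0 d1 c h) (ereal x) h"

definition Gfun :: "ereal \<Rightarrow> ereal \<Rightarrow> real \<Rightarrow> (real \<Rightarrow> real) \<Rightarrow> real \<Rightarrow> real" where
  "Gfun d0 d1 c g = prim d0 d1 c (\<lambda>z. 1 / g z)"

definition Qfun :: "ereal \<Rightarrow> ereal \<Rightarrow> real \<Rightarrow> (real \<Rightarrow> real) \<Rightarrow> (real \<Rightarrow> real) \<Rightarrow> real \<Rightarrow> real" where
  "Qfun d0 d1 c g \<phi> = prim d0 d1 c (\<lambda>z. \<phi> z / g z)"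

definition Ginv :: "ereal \<Rightarrow> ereal \<Rightarrow> (real \<Rightarrow> real) \<Rightarrow> real \<Rightarrow> ereal" where
  "Ginv d0 d1 G s =
     (if s \<in> G ` Eint d0 d1 then ereal (THE y. y \<in> Eint d0 d1 \<and> G y = s)
      else if (\<forall>y\<in>Eint d0 d1. s < G y) then d0 else d1)"

definition flow :: "ereal \<Rightarrow> ereal \<Rightarrow> real \<Rightarrow> (real \<Rightarrow> real) \<Rightarrow> real \<Rightarrow> real \<Rightarrow> ereal" where
  "flow d0 d1 c g t x = Ginv d0 d1 (Gfun d0 d1 c g) (Gfun d0 d1 c g x + t)"

definition P0 :: "ereal \<Rightarrow> ereal \<Rightarrow> real \<Rightarrow> (real \<Rightarrow> real) \<Rightarrow> real \<Rightarrow> (real \<Rightarrow> real) \<Rightarrow> real \<Rightarrow> real" where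
  "P0 d0 d1 c g t u x =
     (if x \<in> Eint d0 d1 \<and> flow d0 d1 c g (-t) x \<in> ereal ` Eint d0 d1 then
        (let y = real_of_ereal (flow d0 d1 c g (-t) x) in u y * g y / g x)
      else 0)"

definition Ssg :: "ereal \<Rightarrow> ereal \<Rightarrow> real \<Rightarrow> (real \<Rightarrow> real) \<Rightarrow> (real \<Rightarrow> real) \<Rightarrow> real \<Rightarrow> (real \<Rightarrow> real) \<Rightarrow> real \<Rightarrow> real" where
  "Ssg d0 d1 c g \<phi> t u x =
     (if x \<in> Eint d0 d1 \<and> flow d0 d1 c g (-t) x \<in> ereal ` Eint d0 d1 then
        exp (Qfun d0 d1 c g \<phi> (real_of_ereal (flow d0 d1 c g (-t) x)) - Qfun d0 d1 c g \<phi> x)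
          * P0 d0 d1 c g t u x
      else 0)"

text \<open>Generator of a semigroup T on L^1(E), as a graph (relation) on L^1:
  generator T u v iff u, v in L^1 and (T(t)u - u)/t converges to v in L^1 as t goes to 0+.
  The domain of the generator is {u. exists v. generator T u v}.\<close>
definition generator :: "real set \<Rightarrow> (real \<Rightarrow> (real \<Rightarrow> real) \<Rightarrow> real \<Rightarrow> real) \<Rightarrow> (real \<Rightarrow> real) \<Rightarrow> (real \<Rightarrow> real) \<Rightarrow> bool" where
  "generator E T u v \<longleftrightarrow> L1 E u \<and> L1 E v \<and>
     (\<forall>\<^sub>F t in at_right 0. L1 E (T t u)) \<and>
     ((\<lambda>t. set_lebesgue_integral lborel E (\<lambda>x. \<bar>(T t u x - u x) / t - v x\<bar>)) \<longlongrightarrow> 0) (at_right 0)"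

text \<open>Graph of A_0: u in D(A_0) and A_0 u = v (up to a.e. equality):
  some representative w of g u is AC on E, v = -(g u)' a.e., v in L^1 and g u tends to 0 at d_0.\<close>
definition A0_graph :: "ereal \<Rightarrow> ereal \<Rightarrow> (real \<Rightarrow> real) \<Rightarrow> (real \<Rightarrow> real) \<Rightarrow> (real \<Rightarrow> real) \<Rightarrow> bool" where
  "A0_graph d0 d1 g u v \<longleftrightarrow> L1 (Eint d0 d1) u \<and> L1 (Eint d0 d1) v \<and>
     (\<exists>w. AC_on (Eint d0 d1) w \<and>
          (AE x in lborel. x \<in> Eint d0 d1 \<longrightarrow> w x = g x * u x) \<and>
          (AE x in lborel. x \<in> Eint d0 d1 \<longrightarrow> (w has_real_derivative - v x) (at x)) \<and>
          (\<forall>\<epsilon>>0. \<exists>y\<in>Eint d0 d1. \<forall>x\<in>Eint d0 d1. x \<le> y \<longrightarrow> \<bar>w x\<bar> < \<epsilon>))"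

definition A_graph :: "ereal \<Rightarrow> ereal \<Rightarrow> (real \<Rightarrow> real) \<Rightarrow> (real \<Rightarrow> real) \<Rightarrow> (real \<Rightarrow> real) \<Rightarrow> (real \<Rightarrow> real) \<Rightarrow> bool" where
  "A_graph d0 d1 g \<phi> u v \<longleftrightarrow> L1 (Eint d0 d1) (\<lambda>x. \<phi> x * u x) \<and> L1 (Eint d0 d1) v \<and>
     (\<exists>v0. A0_graph d0 d1 g u v0 \<and>
        (AE x in lborel. x \<in> Eint d0 d1 \<longrightarrow> v x = v0 x - \<phi> x * u x))"

end

theory Submission
  imports Defs
begin

text \<open>
  The substitution \<open>s = G x\<close> identifies \<open>L\<^sup>1(E)\<close> with \<open>L\<^sup>1(J)\<close>, where \<open>J = G ` E\<close> is an upward closed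
  open half-line because \<open>G\<close> is unbounded above, and turns \<open>S(t)\<close> into the right translation
  \<open>T t f s = exp (q (s - t) - q s) * f (s - t)\<close> with killing rate \<open>\<psi> = q'\<close>. On both sides the
  claim becomes the integral equation \<open>f s = - \<integral> {r \<in> J. r \<le> s} (v + \<psi> f)\<close>.

  If the equation holds, then \<open>(T t f - f) / t\<close> is an average of \<open>v\<close> along the flow, which converges to
  \<open>v\<close> by Lebesgue differentiation and Scheffe's lemma. Conversely, for \<open>f\<close> in the domain of the
  generator, Fatou's lemma yields \<open>\<psi> f \<in> L\<^sup>1\<close>, and Lebesgue differentiation of the
  primitive of \<open>exp q * f\<close> identifies the increments of \<open>exp q * f\<close> as integrals of \<open>- exp q * v\<close>; the
  constant of integration vanishes since \<open>T t f\<close> is zero near a finite left end of \<open>J\<close>, and since \<open>f\<close>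
  is integrable if \<open>J\<close> is the whole line. The case \<open>\<phi> = 0\<close> is the statement about \<open>P\<^sub>0(t)\<close>.
\<close>

section \<open>Lebesgue differentiation of indefinite integrals\<close>

text \<open>The integral equation is the common ground because its right side singles out, among
  functions known only up to null sets, the locally absolutely continuous representative, and
  because the limit condition at \<open>d0\<close> has become the absence of a constant of
  integration. The rate \<psi> is only locally integrable, so \<open>q\<close> need not be
  differentiable everywhere; this forces a calculus of absolutely continuous functions with
  derivatives a.e. in place of the classical product and chain rules. The recurring device is the
  integrating factor \<open>exp q\<close>: where \<open>s\<close> and \<open>s - t\<close> lie in
  \<open>J\<close>, it turns killed translation into pure translation,
  \<open>exp (q s) * T t f s = exp (q (s - t)) * f (s - t)\<close>, and it removes \<psi> from the
  equation. Integrability of \<psi> f is demanded by the domain of A but has no counterpart in the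
  definition of the generator, so it must be extracted from the limit. This works because
  \<open>J\<close> has no upper end: translation carries no mass out of \<open>J\<close>, and
  whatever mass is lost is lost to killing.\<close>

text \<open>Every bad point has arbitrarily short adjacent intervals on which the indefinite integral
  deviates by more than \<open>e\<close> times the length. A disjoint Vitali subfamily of such intervals is a fine
  tagged partial division, so Henstock's lemma makes its total length arbitrarily small.\<close>

lemma derivative_indefinite_integral_aux:
  fixes f :: "real \<Rightarrow> real"
  assumes f: "f integrable_on {a..b}" and e: "e > 0"
  shows "negligible {x \<in> {a<..<b}. \<forall>d>0. \<exists>y\<in>{a..b}. y \<noteq> x \<and> \<bar>y - x\<bar> < d \<and>
           e * \<bar>y - x\<bar> < \<bar>integral {a..y} f - integral {a..x} f - (y - x) * f x\<bar>}"
    (is "negligible ?B")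
  unfolding negligible_outer_le
proof (intro allI impI)
  fix \<epsilon> :: real assume "\<epsilon> > 0"
  \<comment> \<open>Henstock's lemma will give \<open>e\<close> times the total length
    \<open>2 * r\<close> below \<open>e'\<close>, and the Vitali enlargement by 5 turns the length
    \<open>2 * r\<close> into \<open>10 * r\<close>; the denominator 5 makes the enlarged total at
    most \<epsilon>.\<close>
  define e' where "e' = e * \<epsilon> / 5"
  have "e' > 0" using e \<open>\<epsilon> > 0\<close> by (simp add: e'_def)
  have "f integrable_on cbox a b" using f by simp
  then obtain \<gamma> where \<gamma>: "gauge \<gamma>" and H: "\<And>p. \<lbrakk>p tagged_partial_division_of (cbox a b); \<gamma> fine p\<rbrakk> \<Longrightarrow>
             (\<Sum>(x,k)\<in>p. norm(measure lborel k *\<^sub>R f x - integral k f)) < e'"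
    using \<open>e' > 0\<close> by (rule Henstock_lemma) (rule that)
  \<comment> \<open>The inclusion in \<open>\<gamma> x\<close> makes the interval between
    \<open>x\<close> and \<open>y\<close>, tagged by its endpoint \<open>x\<close>, fine. The bound
    1 on the length keeps the radii bounded, as the covering lemma demands.\<close>
  have "\<forall>x\<in>?B. \<exists>y. y \<in> {a..b} \<and> y \<noteq> x \<and> \<bar>y - x\<bar> < 1 \<and> {min x y..max x y} \<subseteq> \<gamma> x \<and>
           e * \<bar>y - x\<bar> < \<bar>integral {a..y} f - integral {a..x} f - (y - x) * f x\<bar>"
  proof
    fix x assume "x \<in> ?B"
    have "open (\<gamma> x)" "x \<in> \<gamma> x" using \<gamma> by (auto simp: gauge_def)
    then obtain d where d: "d > 0" "ball x d \<subseteq> \<gamma> x" using open_contains_ball by blast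
    then obtain y where y: "y\<in>{a..b}" "y \<noteq> x" "\<bar>y - x\<bar> < min d 1"
           "e * \<bar>y - x\<bar> < \<bar>integral {a..y} f - integral {a..x} f - (y - x) * f x\<bar>"
      using \<open>x \<in> ?B\<close>[simplified mem_Collect_eq, THEN conjunct2, rule_format, of "min d 1"] by auto
    have "{min x y..max x y} \<subseteq> ball x d"
      using y(3) by (auto simp: dist_real_def min_def max_def split: if_splits)
    with y d show "\<exists>y. y \<in> {a..b} \<and> y \<noteq> x \<and> \<bar>y - x\<bar> < 1 \<and> {min x y..max x y} \<subseteq> \<gamma> x \<and>
           e * \<bar>y - x\<bar> < \<bar>integral {a..y} f - integral {a..x} f - (y - x) * f x\<bar>"
      by (intro exI[of _ y]) auto
  qed
  from bchoice[OF this] obtain y where y: "\<And>x. x \<in> ?B \<Longrightarrow> y x \<in> {a..b}" "\<And>x. x \<in> ?B \<Longrightarrow> y x \<noteq> x"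
    "\<And>x. x \<in> ?B \<Longrightarrow> \<bar>y x - x\<bar> < 1" "\<And>x. x \<in> ?B \<Longrightarrow> {min x (y x)..max x (y x)} \<subseteq> \<gamma> x"
    "\<And>x. x \<in> ?B \<Longrightarrow> e * \<bar>y x - x\<bar> < \<bar>integral {a..y x} f - integral {a..x} f - (y x - x) * f x\<bar>"
    by blast
  define c where "c x = (x + y x) / 2" for x
  define r where "r x = \<bar>y x - x\<bar> / 2" for x
  have cb: "cball (c x) (r x) = {min x (y x)..max x (y x)}" for x
    by (auto simp: cball_eq_atLeastAtMost c_def r_def min_def max_def field_simps abs_if)
  obtain C where C: "countable C" "C \<subseteq> ?B"
     "pairwise (\<lambda>i j. disjnt (cball (c i) (r i)) (cball (c j) (r j))) C"
     "?B \<subseteq> (\<Union>i\<in>C. cball (c i) (5 * r i))"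
  proof (rule Vitali_covering_lemma_cballs[where S="?B" and K="?B" and a=c and r=r and B=1])
    show "?B \<subseteq> (\<Union>i\<in>?B. cball (c i) (r i))"
      unfolding cb by (rule subsetI, rule UN_I) auto
    show "0 < r i \<and> r i \<le> 1" if "i \<in> ?B" for i
      using y(2,3)[OF that] by (auto simp: r_def)
  qed blast
  have fin: "(\<Sum>i\<in>D. 10 * r i) \<le> \<epsilon>" if D: "finite D" "D \<subseteq> C" for D
  proof -
    define p where "p = (\<lambda>x. (x, cball (c x) (r x))) ` D"
    have inj: "inj_on (\<lambda>x. (x, cball (c x) (r x))) D" by (auto simp: inj_on_def)
    have DB: "\<And>x. x \<in> D \<Longrightarrow> x \<in> ?B" using D C by blast
    have p1: "p tagged_partial_division_of (cbox a b)"
      unfolding tagged_partial_division_of_def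
    proof (intro conjI allI impI)
      show "finite p" using D by (simp add: p_def)
    next
      fix x K assume "(x, K) \<in> p"
      then have x: "x \<in> D" "K = cball (c x) (r x)" by (auto simp: p_def)
      then show "x \<in> K" by (simp add: cb)
      show "K \<subseteq> cbox a b" using y(1)[OF DB[OF x(1)]] DB[OF x(1)] by (auto simp: x cb)
      show "\<exists>a b. K = cbox a b" unfolding x cb by (metis box_real(2))
    next
      fix x1 K1 x2 K2 assume *: "(x1, K1) \<in> p \<and> (x2, K2) \<in> p \<and> (x1, K1) \<noteq> (x2, K2)"
      then have "x1 \<in> D" "x2 \<in> D" "x1 \<noteq> x2" "K1 = cball (c x1) (r x1)" "K2 = cball (c x2) (r x2)"
        by (auto simp: p_def)
      then have "K1 \<inter> K2 = {}"
        using C(3) D unfolding pairwise_def disjnt_def by blast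
      then show "interior K1 \<inter> interior K2 = {}"
        using interior_subset by fastforce
    qed
    have p2: "\<gamma> fine p"
      unfolding fine_def p_def using DB y(4) by (auto simp: cb)
    have "(\<Sum>x\<in>D. e * (2 * r x)) \<le> (\<Sum>x\<in>D. norm (measure lborel (cball (c x) (r x)) *\<^sub>R f x - integral (cball (c x) (r x)) f))"
    proof (rule sum_mono)
      fix x assume "x \<in> D"
      note B = DB[OF this]
      have ab: "a < x" "x < b" using B by auto
      have int: "integral {x..z} f = integral {a..z} f - integral {a..x} f" if "x \<le> z" "z \<le> b" for z
        using Henstock_Kurzweil_Integration.integral_combine[of a x z f] that ab
          integrable_on_subinterval[OF f, of a z] by auto
      have int2: "integral {z..x} f = integral {a..x} f - integral {a..z} f" if "z \<le> x" "a \<le> z" for z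
        using Henstock_Kurzweil_Integration.integral_combine[of a z x f] that ab
          integrable_on_subinterval[OF f, of a x] by auto
      have "\<bar>integral {a..y x} f - integral {a..x} f - (y x - x) * f x\<bar> =
         norm (measure lborel (cball (c x) (r x)) *\<^sub>R f x - integral (cball (c x) (r x)) f)"
        unfolding cb using y(1)[OF B] int[of "y x"] int2[of "y x"]
        by (cases "x \<le> y x") (auto simp: min_def max_def algebra_simps)
      with y(5)[OF B] show "e * (2 * r x) \<le> norm (measure lborel (cball (c x) (r x)) *\<^sub>R f x - integral (cball (c x) (r x)) f)"
        by (simp add: r_def)
    qed
    also have "\<dots> = (\<Sum>(x,k)\<in>p. norm(measure lborel k *\<^sub>R f x - integral k f))"
      unfolding p_def by (subst sum.reindex[OF inj]) simp
    also have "\<dots> < e'" using H[OF p1 p2] .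
    finally have "(2 * e) * (\<Sum>x\<in>D. r x) < e'"
      using sum_distrib_left[of "2 * e" r D] by (simp add: mult_ac)
    then show ?thesis using e sum_distrib_left[of 10 r D] by (simp add: e'_def field_simps)
  qed
  have ms: "measure lebesgue (cball (c i) (5 * r i)) = 10 * r i" if "i \<in> C" for i
    using y(2)[of i] C(2) that by (subst cball_eq_atLeastAtMost) (auto simp: r_def)
  let ?T = "\<Union>i\<in>C. cball (c i) (5 * r i)"
  \<comment> \<open>Henstock's lemma controls finite subfamilies only. Exhausting the countable
    \<open>C\<close> by finite sets carries the bound over to the whole union.\<close>
  have "?T \<in> lmeasurable \<and> measure lebesgue ?T \<le> \<epsilon>"
  proof (cases "C = {}")
    case True then show ?thesis using \<open>\<epsilon> > 0\<close> by simp
  next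
    case False
    define S where "S n = (\<Union>i\<in>from_nat_into C ` {..n}. cball (c i) (5 * r i))" for n :: nat
    have sub: "from_nat_into C ` {..n} \<subseteq> C" for n
      using from_nat_into[OF False] by auto
    have S1: "S n \<in> lmeasurable" for n unfolding S_def by auto
    have S2: "measure lebesgue (S n) \<le> \<epsilon>" for n
    proof -
      have "measure lebesgue (S n) \<le> (\<Sum>i\<in>from_nat_into C ` {..n}. measure lebesgue (cball (c i) (5 * r i)))"
        unfolding S_def by (rule measure_UNION_le) auto
      also have "\<dots> = (\<Sum>i\<in>from_nat_into C ` {..n}. 10 * r i)"
        by (rule sum.cong) (use sub ms in auto)
      also have "\<dots> \<le> \<epsilon>" by (rule fin) (use sub in auto)
      finally show ?thesis .
    qed
    have S3: "S n \<subseteq> S (Suc n)" for n unfolding S_def by (rule UN_mono) auto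
    have "(\<Union>n. S n) = (\<Union>i\<in>(\<Union>n. from_nat_into C ` {..n}). cball (c i) (5 * r i))"
      unfolding S_def by blast
    also have "(\<Union>n. from_nat_into C ` {..n}) = range (from_nat_into C)" by auto
    also have "\<dots> = C" using C(1) False by (rule range_from_nat_into[rotated])
    finally have S4: "(\<Union>n. S n) = ?T" .
    show ?thesis
      using measurable_nested_Union[of S, OF S1 S2 S3] measure_nested_Union[of S, OF S1 S2 S3] S2
      unfolding S4 by (auto intro: LIMSEQ_le_const2)
  qed
  then show "\<exists>T. ?B \<subseteq> T \<and> T \<in> lmeasurable \<and> measure lebesgue T \<le> \<epsilon>" using C(4) by blast
qed

text \<open>If the derivative fails at \<open>x\<close>, the deviation exceeds some fixed slope
  \<open>1 / (n + 1)\<close> at points arbitrarily close to \<open>x\<close>, so the exceptional set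
  is covered by countably many negligible ones. Gauge integrability of \<open>f\<close> is
  enough.\<close>

theorem derivative_indefinite_integral:
  fixes f :: "real \<Rightarrow> real"
  assumes f: "f integrable_on {a..b}"
  shows "negligible {x \<in> {a<..<b}. \<not> ((\<lambda>y. integral {a..y} f) has_real_derivative f x) (at x)}"
proof -
  let ?F = "\<lambda>y. integral {a..y} f"
  let ?B = "\<lambda>e. {x \<in> {a<..<b}. \<forall>d>0. \<exists>y\<in>{a..b}. y \<noteq> x \<and> \<bar>y - x\<bar> < d \<and>
           e * \<bar>y - x\<bar> < \<bar>?F y - ?F x - (y - x) * f x\<bar>}"
  have "negligible (\<Union>n. ?B (1 / real (Suc n)))"
    by (rule negligible_Union_nat) (rule derivative_indefinite_integral_aux[OF f], simp)
  moreover have "{x \<in> {a<..<b}. \<not> (?F has_real_derivative f x) (at x)} \<subseteq> (\<Union>n. ?B (1 / real (Suc n)))"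
  proof (rule subsetI, rule ccontr)
    fix x assume x: "x \<in> {x \<in> {a<..<b}. \<not> (?F has_real_derivative f x) (at x)}"
      and nx: "x \<notin> (\<Union>n. ?B (1 / real (Suc n)))"
    have "(?F has_real_derivative f x) (at x)"
      unfolding has_field_derivative_iff Lim_at
    proof (intro allI impI)
      fix e :: real assume "e > 0"
      then obtain n where n: "1 / real (Suc n) < e"
        using nat_approx_posE by blast
      define R where "R y \<longleftrightarrow> 1 / real (Suc n) * \<bar>y - x\<bar> < \<bar>?F y - ?F x - (y - x) * f x\<bar>" for y
      have "x \<notin> ?B (1 / real (Suc n))" using nx by (rule contrapos_nn) (rule UN_I, rule UNIV_I)
      then have "\<not> (\<forall>d>0. \<exists>y\<in>{a..b}. y \<noteq> x \<and> \<bar>y - x\<bar> < d \<and> R y)"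
        using x unfolding R_def by (simp only: mem_Collect_eq simp_thms)
      then obtain d where d: "d > 0" "\<And>y. y\<in>{a..b} \<Longrightarrow> y \<noteq> x \<Longrightarrow> \<bar>y - x\<bar> < d \<Longrightarrow> \<not> R y"
        by blast
      show "\<exists>d>0. \<forall>y. 0 < dist y x \<and> dist y x < d \<longrightarrow> dist ((?F y - ?F x) / (y - x)) (f x) < e"
      proof (intro exI[of _ "min d (min (x - a) (b - x))"] conjI allI impI)
        show "0 < min d (min (x - a) (b - x))" using d x by auto
        fix y assume y: "0 < dist y x \<and> dist y x < min d (min (x - a) (b - x))"
        then have y': "y \<noteq> x" "y \<in> {a..b}" "\<bar>y - x\<bar> < d" by (auto simp: dist_real_def)
        have "\<bar>(?F y - ?F x) / (y - x) - f x\<bar> = \<bar>?F y - ?F x - (y - x) * f x\<bar> / \<bar>y - x\<bar>"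
          using y' by (simp add: abs_divide[symmetric] diff_divide_distrib)
        also have "\<dots> \<le> 1 / real (Suc n)"
          using d(2)[OF y'(2,1,3)] y' unfolding R_def by (simp add: pos_divide_le_eq not_less del: of_nat_Suc)
        finally show "dist ((?F y - ?F x) / (y - x)) (f x) < e" using n by (simp add: dist_real_def)
      qed
    qed
    with x show False by blast
  qed
  ultimately show ?thesis by (rule negligible_subset)
qed

section \<open>Absolutely continuous functions and their primitives\<close>

lemma disjoint_open_intervals_cases:
  fixes u v u' v' :: real
  assumes "{u<..<v} \<inter> {u'<..<v'} = {}" "u < v" "u' < v'"
  shows "v \<le> u' \<or> v' \<le> u"
proof (rule ccontr)
  assume "\<not> ?thesis"
  then have "(max u u' + min v v') / 2 \<in> {u<..<v} \<inter> {u'<..<v'}"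
    using assms(2,3) by (auto simp: max_def min_def field_simps)
  with assms(1) show False by auto
qed

lemma abs_cont_on_intervalE:
  assumes "abs_cont_on_interval f a b" "e > 0"
  obtains d where "d > 0" "\<And>(n::nat) l r. (\<forall>k<n. a \<le> l k \<and> l k \<le> r k \<and> r k \<le> b) \<Longrightarrow>
        (\<forall>i<n. \<forall>j<n. i \<noteq> j \<longrightarrow> r i \<le> l j \<or> r j \<le> l i) \<Longrightarrow> (\<Sum>k<n. r k - l k) < d
        \<Longrightarrow> (\<Sum>k<n. \<bar>f (r k) - f (l k)\<bar>) < e"
proof -
  from assms(1)[unfolded abs_cont_on_interval_def, rule_format, OF assms(2)]
  obtain d where "d > 0" and d: "\<forall>(n::nat) l r. (\<forall>k<n. a \<le> l k \<and> l k \<le> r k \<and> r k \<le> b) \<and>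
        (\<forall>i<n. \<forall>j<n. i \<noteq> j \<longrightarrow> r i \<le> l j \<or> r j \<le> l i) \<and> (\<Sum>k<n. r k - l k) < d
        \<longrightarrow> (\<Sum>k<n. \<bar>f (r k) - f (l k)\<bar>) < e"
    by (elim exE conjE)
  from \<open>d > 0\<close> show thesis
    by (rule that) (rule d[rule_format], intro conjI)
qed

text \<open>A gauge argument with two kinds of tags. At a tag outside \<open>N\<close>,
  differentiability makes the error of an interval at most a small multiple of its length. At tags
  in \<open>N\<close> the integrand is set to 0 and the gauge is an open superset of
  \<open>N\<close> of small measure, so absolute continuity bounds the sum of the increments of
  \<open>f\<close>.\<close>

theorem fundamental_theorem_of_calculus_abs_cont:
  assumes ac: "abs_cont_on_interval f a b" and ab: "a \<le> b" and N: "negligible N"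
    and der: "\<And>x. x \<in> {a..b} - N \<Longrightarrow> (f has_real_derivative f' x) (at x)"
  shows "(f' has_integral (f b - f a)) {a..b}"
proof -
  define h where "h x = (if x \<in> N then 0 else f' x)" for x
  have "(h has_integral (f b - f a)) {a..b}"
    unfolding has_integral_real
  proof (intro allI impI)
    fix e :: real assume e: "e > 0"
    obtain \<delta> where \<delta>: "\<delta> > 0" "\<And>(n::nat) l r. (\<forall>k<n. a \<le> l k \<and> l k \<le> r k \<and> r k \<le> b) \<Longrightarrow>
        (\<forall>i<n. \<forall>j<n. i \<noteq> j \<longrightarrow> r i \<le> l j \<or> r j \<le> l i) \<Longrightarrow> (\<Sum>k<n. r k - l k) < \<delta>
        \<Longrightarrow> (\<Sum>k<n. \<bar>f (r k) - f (l k)\<bar>) < e / 2"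
      using half_gt_zero[OF e] by (rule abs_cont_on_intervalE[OF ac]) (rule that)
    obtain T where T: "open T" "N \<subseteq> T" "T - N \<in> lmeasurable" "measure lebesgue (T - N) < \<delta>"
      using sets_lebesgue_outer_open[OF negligible_imp_sets[OF N] \<delta>(1)]
      by (metis emeasure_eq_measure2 ennreal_leI linorder_not_le)
    have "T = (T - N) \<union> N" using T(2) by auto
    then have Tl: "T \<in> lmeasurable"
      using T(3) negligible_imp_measurable[OF N] by (metis fmeasurable.Un)
    have mT: "measure lebesgue T < \<delta>"
      using T(1,4) N by (simp add: measure_Diff_null_set negligible_iff_null_sets)
    \<comment> \<open>The errors at tags outside \<open>N\<close> add up to at most
      \<open>e1 * (b - a)\<close>, hence to at most \<open>e / 4\<close>. The added 1 keeps
      \<open>m\<close> positive when \<open>a = b\<close>.\<close>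
    define m where "m = b - a + 1"
    have m: "m > 0" using ab by (simp add: m_def)
    define e1 where "e1 = e / 4 / m"
    have e1: "e1 > 0" using e m by (simp add: e1_def)
    have "\<exists>d>0. \<forall>y. \<bar>y - x\<bar> < d \<longrightarrow> \<bar>f y - f x - f' x * (y - x)\<bar> \<le> e1 * \<bar>y - x\<bar>"
      if "x \<in> {a..b} - N" for x
      using der[OF that] e1
      unfolding has_field_derivative_def has_derivative_at_alt by (auto simp: real_norm_def)
    then obtain d where d: "\<And>x. x \<in> {a..b} - N \<Longrightarrow> d x > 0"
      "\<And>x y. x \<in> {a..b} - N \<Longrightarrow> \<bar>y - x\<bar> < d x \<Longrightarrow> \<bar>f y - f x - f' x * (y - x)\<bar> \<le> e1 * \<bar>y - x\<bar>"
      by metis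
    define \<gamma> where "\<gamma> x = (if x \<in> N then T else if x \<in> {a..b} then ball x (d x) else UNIV)" for x
    have "gauge \<gamma>"
      unfolding gauge_def \<gamma>_def using T d(1) by auto
    moreover have "norm ((\<Sum>(x,K)\<in>p. measure lborel K *\<^sub>R h x) - (f b - f a)) < e"
      if p: "p tagged_division_of {a..b}" and fine: "\<gamma> fine p" for p
    proof -
      have fin: "finite p" using p by auto
      have pK: "x \<in> {a..b} \<and> (\<exists>u v. K = {u..v} \<and> u \<le> x \<and> x \<le> v \<and> a \<le> u \<and> v \<le> b)" if "(x, K) \<in> p" for x K
        using tagged_division_ofD(2-4)[OF p that] by fastforce
      let ?R = "\<lambda>(x,K). measure lborel K * h x - (f (Sup K) - f (Inf K))"
      let ?A = "{z\<in>p. fst z \<in> N}"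
      have "(\<Sum>(x,K)\<in>p. measure lborel K *\<^sub>R h x) - (f b - f a) = sum ?R p"
        unfolding additive_tagged_division_1[OF ab p, of f, symmetric]
        by (simp add: sum_subtractf[symmetric] split_def)
      also have "\<dots> = sum ?R ?A + sum ?R (p - ?A)"
        using sum.subset_diff[of ?A p ?R] fin by auto
      finally have 1: "(\<Sum>(x,K)\<in>p. measure lborel K *\<^sub>R h x) - (f b - f a) = sum ?R ?A + sum ?R (p - ?A)" .
      have "\<bar>sum ?R (p - ?A)\<bar> \<le> (\<Sum>z\<in>p - ?A. \<bar>?R z\<bar>)" by (rule sum_abs)
      also have "\<dots> \<le> (\<Sum>z\<in>p - ?A. e1 * (Sup (snd z) - Inf (snd z)))"
      proof (rule sum_mono)
        fix z assume z: "z \<in> p - ?A"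
        obtain x K where xK: "z = (x, K)" by force
        with z have xp: "(x, K) \<in> p" "x \<notin> N" by auto
        obtain u v where uv: "x \<in> {a..b}" "K = {u..v}" "u \<le> x" "x \<le> v" using pK[OF xp(1)] by blast
        have "K \<subseteq> ball x (d x)" using fine xp uv(1) unfolding fine_def \<gamma>_def by fastforce
        moreover have "u \<in> K" "v \<in> K" using uv by auto
        ultimately have "u \<in> ball x (d x)" "v \<in> ball x (d x)" by blast+
        then have "\<bar>u - x\<bar> < d x" "\<bar>v - x\<bar> < d x" by (auto simp: dist_real_def abs_minus_commute)
        then have "\<bar>f u - f x - f' x * (u - x)\<bar> \<le> e1 * (x - u)" "\<bar>f v - f x - f' x * (v - x)\<bar> \<le> e1 * (v - x)"
          using d(2)[of x u] d(2)[of x v] xp uv by auto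
        then have "\<bar>(v - u) * f' x - (f v - f u)\<bar> \<le> e1 * (v - u)"
          by (simp add: algebra_simps abs_le_iff)
        then show "\<bar>?R z\<bar> \<le> e1 * (Sup (snd z) - Inf (snd z))"
          using uv xp by (simp add: xK h_def)
      qed
      also have "\<dots> \<le> (\<Sum>z\<in>p. e1 * (Sup (snd z) - Inf (snd z)))"
      proof (rule sum_mono2[OF fin])
        fix z assume "z \<in> p - (p - ?A)"
        then have "z \<in> p" by simp
        then obtain x K where "z = (x, K)" "(x, K) \<in> p" by (cases z) auto
        with pK[of x K] e1 show "0 \<le> e1 * (Sup (snd z) - Inf (snd z))" by auto
      qed auto
      also have "\<dots> = e1 * (b - a)"
        using additive_tagged_division_1[OF ab p, of "\<lambda>x. x"] by (simp add: sum_distrib_left[symmetric] split_def)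
      also have "\<dots> \<le> e1 * m" using e1 by (intro mult_left_mono) (auto simp: m_def)
      also have "\<dots> = e / 4" using m by (simp add: e1_def)
      also have "\<dots> < e / 2" using e by simp
      finally have 2: "\<bar>sum ?R (p - ?A)\<bar> < e / 2" .
      \<comment> \<open>Degenerate intervals contribute 0. Without them all interiors are nonempty,
        so disjointness of interiors yields the ordering of endpoints that absolute continuity asks
        for.\<close>
      let ?B = "{z\<in>?A. measure lborel (snd z) \<noteq> 0}"
      obtain \<sigma> where \<sigma>: "bij_betw \<sigma> {..<card ?B} ?B"
        using ex_bij_betw_nat_finite[of ?B] fin by (auto simp: lessThan_atLeast0)
      define n where "n = card ?B"
      define l where "l k = Inf (snd (\<sigma> k))" for k
      define r where "r k = Sup (snd (\<sigma> k))" for k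
      have \<sigma>k: "a \<le> l k \<and> l k < r k \<and> r k \<le> b \<and> snd (\<sigma> k) = {l k..r k} \<and> {l k..r k} \<subseteq> T" if "k < n" for k
      proof -
        have "\<sigma> k \<in> ?B" using \<sigma> that by (auto simp: bij_betw_def n_def)
        then obtain x K where xK: "\<sigma> k = (x, K)" "(x, K) \<in> p" "x \<in> N" "measure lborel K \<noteq> 0" by force
        then have "K \<subseteq> T" using fine unfolding fine_def \<gamma>_def by fastforce
        with pK[OF xK(2)] xK show ?thesis by (auto simp: l_def r_def)
      qed
      have disj: "{l i<..<r i} \<inter> {l j<..<r j} = {}" if "i < n" "j < n" "i \<noteq> j" for i j
      proof -
        have "\<sigma> i \<noteq> \<sigma> j" using \<sigma> that by (auto simp: bij_betw_def n_def inj_on_def)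
        moreover have "\<sigma> i \<in> p" "\<sigma> j \<in> p" using \<sigma> that by (auto simp: bij_betw_def n_def)
        ultimately have "interior (snd (\<sigma> i)) \<inter> interior (snd (\<sigma> j)) = {}"
          using tagged_division_ofD(5)[OF p] by (metis prod.collapse)
        then show ?thesis using \<sigma>k[OF that(1)] \<sigma>k[OF that(2)] by simp
      qed
      have "(\<Sum>k<n. r k - l k) = (\<Sum>k<n. measure lebesgue {l k<..<r k})"
        by (rule sum.cong) (use \<sigma>k in \<open>auto simp: less_imp_le\<close>)
      also have "\<dots> = measure lebesgue (\<Union>k<n. {l k<..<r k})"
        by (rule measure_finite_Union[symmetric]) (use disj \<sigma>k in \<open>auto simp: disjoint_family_on_def less_imp_le\<close>)
      also have "\<dots> \<le> measure lebesgue T"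
        by (rule measure_mono_fmeasurable) (use Tl \<sigma>k in \<open>fastforce+\<close>)
      finally have sl: "(\<Sum>k<n. r k - l k) < \<delta>" using mT by simp
      have "sum ?R ?A = sum ?R ?B"
      proof (rule sum.mono_neutral_right)
        show "\<forall>i\<in>?A - ?B. ?R i = 0"
        proof
          fix i assume i: "i \<in> ?A - ?B"
          obtain x K where xK: "i = (x, K)" by force
          with i have "(x, K) \<in> p" "measure lborel K = 0" by auto
          with pK[of x K] xK show "?R i = 0" by auto
        qed
      qed (use fin in auto)
      also have "\<bar>\<dots>\<bar> \<le> (\<Sum>z\<in>?B. \<bar>?R z\<bar>)" by (rule sum_abs)
      also have "\<dots> = (\<Sum>z\<in>?B. \<bar>f (Sup (snd z)) - f (Inf (snd z))\<bar>)"
        by (rule sum.cong) (auto simp: h_def)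
      also have "\<dots> = (\<Sum>k<n. \<bar>f (r k) - f (l k)\<bar>)"
        using sum.reindex_bij_betw[OF \<sigma>, of "\<lambda>z. \<bar>f (Sup (snd z)) - f (Inf (snd z))\<bar>"]
        by (simp add: n_def l_def r_def)
      also have "\<dots> < e / 2"
      proof (rule \<delta>(2)[OF _ _ sl])
        show "\<forall>k<n. a \<le> l k \<and> l k \<le> r k \<and> r k \<le> b" using \<sigma>k by (auto simp: less_imp_le)
        show "\<forall>i<n. \<forall>j<n. i \<noteq> j \<longrightarrow> r i \<le> l j \<or> r j \<le> l i"
          using disjoint_open_intervals_cases[OF disj] \<sigma>k by blast
      qed
      finally show ?thesis using 1 2 by simp
    qed
    ultimately show "\<exists>\<gamma>. gauge \<gamma> \<and> (\<forall>\<D>. \<D> tagged_division_of {a..b} \<and> \<gamma> fine \<D> \<longrightarrow>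
        norm ((\<Sum>(x,K)\<in>\<D>. measure lborel K *\<^sub>R h x) - (f b - f a)) < e)" by (intro exI[of _ \<gamma>] conjI allI impI) auto
  qed
  then show ?thesis
    by (rule has_integral_spike[OF N, rotated]) (auto simp: h_def)
qed

section \<open>Primitives of locally integrable functions\<close>

text \<open>The working form of "\<open>w\<close> is locally absolutely continuous with derivative
  \<open>h\<close> a.e. and \<open>h\<close> is locally integrable". For open \<open>E\<close>,
  \<open>AC_on_primitive\<close>, \<open>AE_derivative_primitive\<close> and
  \<open>primitive_on_AC\<close> show that this is the same thing.\<close>

definition primitive_on :: "real set \<Rightarrow> (real \<Rightarrow> real) \<Rightarrow> (real \<Rightarrow> real) \<Rightarrow> bool" where
  "primitive_on E w h \<longleftrightarrow> (\<forall>x y. x \<le> y \<and> {x..y} \<subseteq> E \<longrightarrow>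
     set_integrable lborel {x..y} h \<and> w y - w x = (LINT z:{x..y}|lborel. h z))"

lemma primitive_onD:
  assumes "primitive_on E w h" "x \<le> y" "{x..y} \<subseteq> E"
  shows "set_integrable lborel {x..y} h" "w y - w x = (LINT z:{x..y}|lborel. h z)"
  using assms by (auto simp: primitive_on_def)

text \<open>Truncation: \<open>\<bar>h\<bar>\<close> is at most a constant \<open>n\<close> plus the
  excess \<open>k n\<close> over it. The excess has integral below \<epsilon> / 2 for large
  \<open>n\<close>, and the constant contributes at most \<open>n\<close> times the total
  length.\<close>

lemma primitive_abs_cont:
  assumes h: "set_integrable lborel {a..b} h"
    and w: "\<And>x y. a \<le> x \<Longrightarrow> x \<le> y \<Longrightarrow> y \<le> b \<Longrightarrow> w y - w x = (LINT z:{x..y}|lborel. h z)"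
  shows "abs_cont_on_interval w a b"
  unfolding abs_cont_on_interval_def
proof (intro allI impI)
  fix \<epsilon> :: real assume \<epsilon>: "\<epsilon> > 0"
  define h' where "h' z = indicator {a..b} z * h z" for z
  have h': "integrable lborel h'" using h by (simp add: set_integrable_def h'_def[abs_def])
  have [measurable]: "h' \<in> borel_measurable borel" using borel_measurable_integrable[OF h'] by simp
  define k where "k n z = max 0 (\<bar>h' z\<bar> - real n)" for n z
  have k_int: "integrable lborel (k n)" for n
    by (rule Bochner_Integration.integrable_bound[OF h']) (auto simp: k_def[abs_def])
  have "(\<lambda>n. LINT z|lborel. k n z) \<longlonglongrightarrow> (LINT z|(lborel :: real measure). 0::real)"
  proof (rule integral_dominated_convergence[where w="\<lambda>z. \<bar>h' z\<bar>"])
    show "integrable lborel (\<lambda>z. \<bar>h' z\<bar>)" using h' by simp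
    show "AE z in lborel. (\<lambda>n. k n z) \<longlonglongrightarrow> 0"
    proof (rule AE_I2, rule tendsto_eventually)
      fix z
      obtain N where "\<bar>h' z\<bar> \<le> real N" using real_arch_simple by blast
      then show "\<forall>\<^sub>F n in sequentially. k n z = 0"
        unfolding k_def by (intro eventually_sequentiallyI[of N]) auto
    qed
    show "AE z in lborel. norm (k n z) \<le> \<bar>h' z\<bar>" for n by (auto simp: k_def)
  qed (auto simp: k_def[abs_def])
  then have "(\<lambda>n. LINT z|lborel. k n z) \<longlonglongrightarrow> 0" by simp
  from order_tendstoD(2)[OF this, of "\<epsilon> / 2"] \<epsilon>
  obtain n where n: "(LINT z|lborel. k n z) < \<epsilon> / 2" by (auto simp: eventually_sequentially)
  have main: "(\<Sum>i<m. \<bar>w (r i) - w (l i)\<bar>) < \<epsilon>"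
    if lr: "\<And>i. i < m \<Longrightarrow> a \<le> l i \<and> l i \<le> r i \<and> r i \<le> b"
      and disj: "\<forall>i<m. \<forall>j<m. i \<noteq> j \<longrightarrow> r i \<le> l j \<or> r j \<le> l i"
      \<comment> \<open>The 1 in the denominator covers the case \<open>n = 0\<close>.\<close>
      and len: "(\<Sum>i<m. r i - l i) < \<epsilon> / (2 * (real n + 1))" for m :: nat and l r
  proof -
    \<comment> \<open>Half-open intervals stay disjoint when they share an endpoint, so their
      indicators add up to at most 1 and the excess is counted only once.\<close>
    have each: "\<bar>w (r i) - w (l i)\<bar> \<le> real n * (r i - l i) + (LINT z|lborel. indicator {l i<..r i} z * k n z)"
      if "i < m" for i
    proof -
      have 1: "w (r i) - w (l i) = (LINT z|lborel. indicator {l i<..r i} z * h' z)"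
        unfolding w[OF conjunct1[OF lr[OF that]] conjunct1[OF conjunct2[OF lr[OF that]]] conjunct2[OF conjunct2[OF lr[OF that]]]]
          set_lebesgue_integral_def
      proof (rule integral_cong_AE)
        have "(\<lambda>z. indicator {l i..r i} z * h z) = (\<lambda>z. indicator {l i..r i} z * h' z)"
          using lr[OF that] by (auto simp: h'_def indicator_def)
        then show "(\<lambda>x. indicat_real {l i..r i} x *\<^sub>R h x) \<in> borel_measurable lborel" by simp
        show "AE x in lborel. indicat_real {l i..r i} x *\<^sub>R h x = indicat_real {l i<..r i} x * h' x"
          using AE_lborel_singleton[of "l i"]
          by eventually_elim (use lr[OF that] in \<open>auto simp: h'_def indicator_def\<close>)
      qed simp
      have int1: "integrable lborel (\<lambda>z. real n * indicator {l i<..r i} z)"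
        by (intro integrable_mult_right integrable_real_indicator) (use lr[OF that] in auto)
      have int2: "integrable lborel (\<lambda>z. indicator {l i<..r i} z * k n z)"
        by (rule Bochner_Integration.integrable_bound[OF k_int[of n]]) (auto simp: k_def[abs_def] indicator_def)
      have "\<bar>w (r i) - w (l i)\<bar> \<le> (LINT z|lborel. \<bar>indicator {l i<..r i} z * h' z\<bar>)"
        unfolding 1 by (rule integral_abs_bound)
      also have "\<dots> \<le> (LINT z|lborel. real n * indicator {l i<..r i} z + indicator {l i<..r i} z * k n z)"
      proof (rule integral_mono)
        show "integrable lborel (\<lambda>z. real n * indicator {l i<..r i} z + indicator {l i<..r i} z * k n z)"
          by (rule Bochner_Integration.integrable_add[OF int1 int2])
        show "integrable lborel (\<lambda>z. \<bar>indicator {l i<..r i} z * h' z\<bar>)"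
          by (rule Bochner_Integration.integrable_bound[OF h']) (auto simp: indicator_def)
      qed (auto simp: k_def indicator_def)
      also have "\<dots> = real n * (r i - l i) + (LINT z|lborel. indicator {l i<..r i} z * k n z)"
        using lr[OF that] Bochner_Integration.integral_add[OF int1 int2] by simp
      finally show ?thesis .
    qed
    have "(\<Sum>i<m. LINT z|lborel. indicator {l i<..r i} z * k n z) = (LINT z|lborel. (\<Sum>i<m. indicator {l i<..r i} z * k n z))"
      by (rule Bochner_Integration.integral_sum[symmetric], rule Bochner_Integration.integrable_bound[OF k_int[of n]])
        (auto simp: k_def[abs_def] indicator_def)
    also have "\<dots> \<le> (LINT z|lborel. k n z)"
    proof (rule integral_mono')
      fix z
      have "(\<Sum>i<m. indicator {l i<..r i} z * k n z) = indicator (\<Union>i<m. {l i<..r i}) z * k n z"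
        using disj by (subst indicator_UN_disjoint) (auto simp: disjoint_family_on_def sum_distrib_right, force)
      then show "(\<Sum>i<m. indicator {l i<..r i} z * k n z) \<le> k n z" by (auto simp: indicator_def k_def)
    qed (rule k_int, simp add: k_def)
    finally have 3: "(\<Sum>i<m. LINT z|lborel. indicator {l i<..r i} z * k n z) < \<epsilon> / 2" using n by simp
    have "(\<Sum>i<m. \<bar>w (r i) - w (l i)\<bar>) \<le> (\<Sum>i<m. real n * (r i - l i) + (LINT z|lborel. indicator {l i<..r i} z * k n z))"
      using each by (intro sum_mono) auto
    also have "\<dots> < real n * (\<Sum>i<m. r i - l i) + \<epsilon> / 2"
      using 3 by (simp add: sum.distrib sum_distrib_left)
    also have "real n * (\<Sum>i<m. r i - l i) \<le> (real n + 1) * (\<Sum>i<m. r i - l i)"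
      by (intro mult_right_mono sum_nonneg) (use lr in auto)
    also have "\<dots> \<le> \<epsilon> / 2" using len by (simp add: field_simps)
    finally show ?thesis by simp
  qed
  show "\<exists>\<delta>>0. \<forall>(m::nat) l r. (\<forall>k<m. a \<le> l k \<and> l k \<le> r k \<and> r k \<le> b) \<and>
          (\<forall>i<m. \<forall>j<m. i \<noteq> j \<longrightarrow> r i \<le> l j \<or> r j \<le> l i) \<and> (\<Sum>k<m. r k - l k) < \<delta> \<longrightarrow>
          (\<Sum>k<m. \<bar>w (r k) - w (l k)\<bar>) < \<epsilon>"
    using \<epsilon> main by (intro exI[of _ "\<epsilon> / (2 * (real n + 1))"]) auto
qed

lemma AC_on_primitive: "primitive_on E w h \<Longrightarrow> AC_on E w"
  unfolding AC_on_def
proof (intro allI impI, elim conjE)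
  fix a b assume *: "primitive_on E w h" "a \<le> b" "{a..b} \<subseteq> E"
  show "abs_cont_on_interval w a b"
  proof (rule primitive_abs_cont)
    show "set_integrable lborel {a..b} h" using * primitive_onD by blast
    fix x y assume "a \<le> x" "x \<le> y" "y \<le> b"
    then show "w y - w x = (LINT z:{x..y}|lborel. h z)" using * by (intro primitive_onD(2)[OF *(1)]) auto
  qed
qed

text \<open>This lemma and the next translate between negligible sets, which need not be Borel, and
  \<open>AE\<close> over \<open>lborel\<close>. The passage goes through the completion, which has
  the same notion of almost everywhere.\<close>

lemma negligible_imp_AE_lborel: "negligible N \<Longrightarrow> AE x in lborel. x \<notin> N"
  by (metis AE_completion_iff AE_not_in negligible_iff_null_sets)

lemma AE_lborel_imp_negligible:
  assumes "AE x in lborel. P x" shows "negligible {x. \<not> P x}"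
proof -
  obtain N where N: "N \<in> null_sets lebesgue" "\<And>x. x \<notin> N \<Longrightarrow> P x"
    using AE_E3[OF AE_completion[OF assms]] by auto
  then have "negligible N" by (simp add: negligible_iff_null_sets)
  then show ?thesis by (rule negligible_subset) (use N in auto)
qed

text \<open>Each closed interval with rational endpoints inside \<open>E\<close> contributes one
  null set of bad points. There are countably many such intervals, and every point of the open set
  \<open>E\<close> is interior to one of them.\<close>

lemma AE_derivative_primitive:
  assumes E: "open E" and w: "primitive_on E w h"
  shows "AE x in lborel. x \<in> E \<longrightarrow> (w has_real_derivative h x) (at x)"
proof -
  define B where "B p = {x \<in> {fst p<..<snd p}. \<not> ((\<lambda>y. integral {fst p..y} h) has_real_derivative h x) (at x)}" for p
  define I where "I = {p \<in> \<rat> \<times> \<rat>. fst p \<le> snd p \<and> {fst p..snd p} \<subseteq> E}"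
  have cI: "countable I"
    unfolding I_def by (rule countable_subset[of _ "\<rat> \<times> \<rat>"]) (auto intro: countable_rat)
  have B: "negligible (B p)" if "p \<in> I" for p
    unfolding B_def
    by (rule derivative_indefinite_integral, rule set_borel_integral_eq_integral(1), rule primitive_onD(1)[OF w])
      (use that in \<open>auto simp: I_def\<close>)
  have "negligible (\<Union>(B ` I))"
    by (rule negligible_countable_Union) (use cI B in auto)
  then have "AE x in lborel. x \<notin> \<Union>(B ` I)" by (rule negligible_imp_AE_lborel)
  then show ?thesis
  proof eventually_elim
    case (elim x)
    show ?case
    proof
      assume "x \<in> E"
      then obtain d where d: "d > 0" "ball x d \<subseteq> E" using E open_contains_ball by blast
      obtain p where p: "p \<in> \<rat>" "x - d < p" "p < x" using Rats_dense_in_real[of "x - d" x] d by auto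
      obtain q where q: "q \<in> \<rat>" "x < q" "q < x + d" using Rats_dense_in_real[of x "x + d"] d by auto
      have sub: "{p..q} \<subseteq> E"
        by (rule order_trans[OF _ d(2)]) (use p q in \<open>auto simp: dist_real_def\<close>)
      then have "(p, q) \<in> I" using p q by (auto simp: I_def)
      with elim have "x \<notin> B (p, q)" by blast
      then have "((\<lambda>y. integral {p..y} h) has_real_derivative h x) (at x)"
        using p q by (auto simp: B_def)
      then have "((\<lambda>y. w p + integral {p..y} h) has_real_derivative h x) (at x)"
        by (auto intro!: derivative_eq_intros)
      then show "(w has_real_derivative h x) (at x)"
      proof (rule has_field_derivative_transform_within_open[where S="{p<..<q}"])
        fix y assume y: "y \<in> {p<..<q}"
        then have "p \<le> y" "{p..y} \<subseteq> E" using sub by auto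
        from primitive_onD[OF w this] show "w p + integral {p..y} h = w y"
          by (simp add: set_borel_integral_eq_integral(2))
      qed (use p q in auto)
    qed
  qed
qed

text \<open>The way in which new primitives are obtained below: check absolute continuity,
  differentiate a.e. by the classical rules, and let the fundamental theorem do the rest.\<close>

lemma primitive_on_AC:
  assumes w: "AC_on E w" and d: "AE x in lborel. x \<in> E \<longrightarrow> (w has_real_derivative h x) (at x)"
    and h: "\<And>a b. a \<le> b \<Longrightarrow> {a..b} \<subseteq> E \<Longrightarrow> set_integrable lborel {a..b} h"
  shows "primitive_on E w h"
  unfolding primitive_on_def
proof (intro allI impI, elim conjE, intro conjI)
  fix x y assume xy: "x \<le> y" "{x..y} \<subseteq> E"
  show 1: "set_integrable lborel {x..y} h" using h xy by blast
  have "(h has_integral (w y - w x)) {x..y}"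
  proof (rule fundamental_theorem_of_calculus_abs_cont[OF _ xy(1) AE_lborel_imp_negligible[OF d]])
    show "abs_cont_on_interval w x y" using w xy by (auto simp: AC_on_def)
  qed (use xy in auto)
  then show "w y - w x = (LINT z:{x..y}|lborel. h z)"
    using set_borel_integral_eq_integral(2)[OF 1] by (simp add: integral_unique)
qed

section \<open>Products and exponentials of absolutely continuous functions\<close>

lemma continuous_on_Icc_abs_bounded:
  fixes w :: "real \<Rightarrow> real"
  assumes "continuous_on {a..b} w"
  obtains B where "B > 0" "\<And>x. x \<in> {a..b} \<Longrightarrow> \<bar>w x\<bar> \<le> B"
  using compact_imp_bounded[OF compact_continuous_image[OF assms compact_Icc]] that
  unfolding bounded_pos by (metis imageI real_norm_def)

lemma abs_cont_continuous_on:
  assumes "abs_cont_on_interval w a b" shows "continuous_on {a..b} w"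
  unfolding continuous_on_iff
proof (intro ballI allI impI)
  fix x e :: real assume x: "x \<in> {a..b}" and "e > 0"
  obtain d where d: "d > 0" "\<And>(n::nat) l r. (\<forall>k<n. a \<le> l k \<and> l k \<le> r k \<and> r k \<le> b) \<Longrightarrow>
        (\<forall>i<n. \<forall>j<n. i \<noteq> j \<longrightarrow> r i \<le> l j \<or> r j \<le> l i) \<Longrightarrow> (\<Sum>k<n. r k - l k) < d
        \<Longrightarrow> (\<Sum>k<n. \<bar>w (r k) - w (l k)\<bar>) < e"
    by (rule abs_cont_on_intervalE[OF assms \<open>e > 0\<close>]) (rule that)
  have *: "\<bar>w v - w u\<bar> < e" if "a \<le> u" "u \<le> v" "v \<le> b" "v - u < d" for u v
    using d(2)[of 1 "\<lambda>_. u" "\<lambda>_. v"] that by simp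
  have "dist (w y) (w x) < e" if "y \<in> {a..b}" "dist y x < d" for y
    using *[of x y] *[of y x] that x by (cases "x \<le> y") (auto simp: dist_real_def abs_minus_commute)
  then show "\<exists>d>0. \<forall>x'\<in>{a..b}. dist x' x < d \<longrightarrow> dist (w x') (w x) < e" using d(1) by blast
qed

lemma AC_on_continuous_on:
  assumes "open E" "AC_on E w" shows "continuous_on E w"
proof (rule continuous_at_imp_continuous_on, rule ballI)
  fix x assume "x \<in> E"
  then obtain e where e: "e > 0" "cball x e \<subseteq> E" using assms(1) open_contains_cball by blast
  then have "{x - e..x + e} \<subseteq> E" by (simp add: cball_eq_atLeastAtMost)
  then have "abs_cont_on_interval w (x - e) (x + e)" using assms(2) e by (auto simp: AC_on_def)
  from abs_cont_continuous_on[OF this] show "isCont w x"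
    by (rule continuous_on_interior) (use e in auto)
qed

lemmas primitive_on_continuous = AC_on_continuous_on[OF _ AC_on_primitive]

lemma abs_cont_mult:
  assumes f: "abs_cont_on_interval f a b" and g: "abs_cont_on_interval g a b"
  shows "abs_cont_on_interval (\<lambda>x. f x * g x) a b"
  unfolding abs_cont_on_interval_def
proof (intro allI impI)
  fix \<epsilon> :: real assume "\<epsilon> > 0"
  obtain B C where BC: "B > 0" "\<And>x. x \<in> {a..b} \<Longrightarrow> \<bar>f x\<bar> \<le> B" "C > 0" "\<And>x. x \<in> {a..b} \<Longrightarrow> \<bar>g x\<bar> \<le> C"
    using continuous_on_Icc_abs_bounded[OF abs_cont_continuous_on[OF f]]
      continuous_on_Icc_abs_bounded[OF abs_cont_continuous_on[OF g]] by metis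
  \<comment> \<open>Chosen so that \<open>B * e1 + C * e2 = \<epsilon>\<close>, where
    \<open>B\<close> bounds the values of \<open>f\<close>, which multiply the increments of
    \<open>g\<close>, and \<open>C\<close> bounds those of \<open>g\<close>.\<close>
  define e1 where "e1 = \<epsilon> / (2 * B)"
  define e2 where "e2 = \<epsilon> / (2 * C)"
  have e12: "e1 > 0" "e2 > 0" using BC \<open>\<epsilon> > 0\<close> by (auto simp: e1_def e2_def)
  obtain d1 where d1: "d1 > 0" "\<And>(n::nat) l r. (\<forall>k<n. a \<le> l k \<and> l k \<le> r k \<and> r k \<le> b) \<Longrightarrow>
        (\<forall>i<n. \<forall>j<n. i \<noteq> j \<longrightarrow> r i \<le> l j \<or> r j \<le> l i) \<Longrightarrow> (\<Sum>k<n. r k - l k) < d1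
        \<Longrightarrow> (\<Sum>k<n. \<bar>g (r k) - g (l k)\<bar>) < e1"
    by (rule abs_cont_on_intervalE[OF g e12(1)]) (rule that)
  obtain d2 where d2: "d2 > 0" "\<And>(n::nat) l r. (\<forall>k<n. a \<le> l k \<and> l k \<le> r k \<and> r k \<le> b) \<Longrightarrow>
        (\<forall>i<n. \<forall>j<n. i \<noteq> j \<longrightarrow> r i \<le> l j \<or> r j \<le> l i) \<Longrightarrow> (\<Sum>k<n. r k - l k) < d2
        \<Longrightarrow> (\<Sum>k<n. \<bar>f (r k) - f (l k)\<bar>) < e2"
    by (rule abs_cont_on_intervalE[OF f e12(2)]) (rule that)
  show "\<exists>\<delta>>0. \<forall>(n::nat) l r. (\<forall>k<n. a \<le> l k \<and> l k \<le> r k \<and> r k \<le> b) \<and>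
        (\<forall>i<n. \<forall>j<n. i \<noteq> j \<longrightarrow> r i \<le> l j \<or> r j \<le> l i) \<and> (\<Sum>k<n. r k - l k) < \<delta>
        \<longrightarrow> (\<Sum>k<n. \<bar>f (r k) * g (r k) - f (l k) * g (l k)\<bar>) < \<epsilon>"
  proof (intro exI[of _ "min d1 d2"] conjI allI impI, goal_cases)
    case 1 then show ?case using d1 d2 by simp
  next
    case (2 n l r)
    then have lr: "\<forall>k<n. a \<le> l k \<and> l k \<le> r k \<and> r k \<le> b"
      "\<forall>i<n. \<forall>j<n. i \<noteq> j \<longrightarrow> r i \<le> l j \<or> r j \<le> l i" "(\<Sum>k<n. r k - l k) < d1" "(\<Sum>k<n. r k - l k) < d2"
      by auto
    have "(\<Sum>k<n. \<bar>f (r k) * g (r k) - f (l k) * g (l k)\<bar>) \<le>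
      (\<Sum>k<n. B * \<bar>g (r k) - g (l k)\<bar> + C * \<bar>f (r k) - f (l k)\<bar>)"
    proof (rule sum_mono)
      fix k assume "k \<in> {..<n}"
      then have "r k \<in> {a..b}" "l k \<in> {a..b}" using lr(1) by fastforce+
      have "f (r k) * g (r k) - f (l k) * g (l k) = f (r k) * (g (r k) - g (l k)) + g (l k) * (f (r k) - f (l k))"
        by (simp add: algebra_simps)
      also have "\<bar>\<dots>\<bar> \<le> \<bar>f (r k)\<bar> * \<bar>g (r k) - g (l k)\<bar> + \<bar>g (l k)\<bar> * \<bar>f (r k) - f (l k)\<bar>"
        unfolding abs_mult[symmetric] by (rule abs_triangle_ineq)
      also have "\<dots> \<le> B * \<bar>g (r k) - g (l k)\<bar> + C * \<bar>f (r k) - f (l k)\<bar>"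
        by (intro add_mono mult_right_mono BC) (fact | simp)+
      finally show "\<bar>f (r k) * g (r k) - f (l k) * g (l k)\<bar> \<le> B * \<bar>g (r k) - g (l k)\<bar> + C * \<bar>f (r k) - f (l k)\<bar>" .
    qed
    also have "\<dots> = B * (\<Sum>k<n. \<bar>g (r k) - g (l k)\<bar>) + C * (\<Sum>k<n. \<bar>f (r k) - f (l k)\<bar>)"
      by (simp add: sum.distrib sum_distrib_left)
    also have "\<dots> < B * e1 + C * e2"
      by (intro add_strict_mono mult_strict_left_mono d1 d2 lr BC)
    also have "\<dots> = \<epsilon>" using BC by (simp add: e1_def e2_def)
    finally show ?case .
  qed
qed

text \<open>The Lipschitz bound is required on the values of \<open>f\<close> only, so that the
  exponential, which is Lipschitz only on sets bounded above, qualifies.\<close>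

lemma abs_cont_lipschitz_compose:
  assumes f: "abs_cont_on_interval f a b" and L: "L > 0"
    and g: "\<And>x y. x \<in> {a..b} \<Longrightarrow> y \<in> {a..b} \<Longrightarrow> \<bar>g (f x) - g (f y)\<bar> \<le> L * \<bar>f x - f y\<bar>"
  shows "abs_cont_on_interval (\<lambda>x. g (f x)) a b"
  unfolding abs_cont_on_interval_def
proof (intro allI impI)
  fix \<epsilon> :: real assume "\<epsilon> > 0"
  then have "\<epsilon> / L > 0" using L by simp
  obtain d where d: "d > 0" "\<And>(n::nat) l r. (\<forall>k<n. a \<le> l k \<and> l k \<le> r k \<and> r k \<le> b) \<Longrightarrow>
        (\<forall>i<n. \<forall>j<n. i \<noteq> j \<longrightarrow> r i \<le> l j \<or> r j \<le> l i) \<Longrightarrow> (\<Sum>k<n. r k - l k) < d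
        \<Longrightarrow> (\<Sum>k<n. \<bar>f (r k) - f (l k)\<bar>) < \<epsilon> / L"
    by (rule abs_cont_on_intervalE[OF f \<open>\<epsilon> / L > 0\<close>]) (rule that)
  show "\<exists>\<delta>>0. \<forall>(n::nat) l r. (\<forall>k<n. a \<le> l k \<and> l k \<le> r k \<and> r k \<le> b) \<and>
        (\<forall>i<n. \<forall>j<n. i \<noteq> j \<longrightarrow> r i \<le> l j \<or> r j \<le> l i) \<and> (\<Sum>k<n. r k - l k) < \<delta>
        \<longrightarrow> (\<Sum>k<n. \<bar>g (f (r k)) - g (f (l k))\<bar>) < \<epsilon>"
  proof (intro exI[of _ d] conjI allI impI, goal_cases)
    case 1 then show ?case using d by simp
  next
    case (2 n l r)
    then have lr: "\<And>k. k < n \<Longrightarrow> a \<le> l k \<and> l k \<le> r k \<and> r k \<le> b" by blast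
    have "(\<Sum>k<n. \<bar>g (f (r k)) - g (f (l k))\<bar>) \<le> (\<Sum>k<n. L * \<bar>f (r k) - f (l k)\<bar>)"
      by (intro sum_mono g) (use lr in fastforce)+
    also have "\<dots> < L * (\<epsilon> / L)"
      unfolding sum_distrib_left[symmetric] using L d(2)[of n l r] 2 by (intro mult_strict_left_mono) auto
    finally show ?case using L by simp
  qed
qed

lemma set_integrable_mult_continuous:
  fixes h w :: "real \<Rightarrow> real"
  assumes h: "set_integrable lborel {a..b} h" and w: "continuous_on {a..b} w"
  shows "set_integrable lborel {a..b} (\<lambda>x. w x * h x)"
proof -
  obtain B where B: "\<And>x. x \<in> {a..b} \<Longrightarrow> \<bar>w x\<bar> \<le> B"
    using continuous_on_Icc_abs_bounded[OF w] by blast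
  have "(\<lambda>x. indicator {a..b} x *\<^sub>R w x) \<in> borel_measurable borel"
    using w by (intro borel_measurable_continuous_on_indicator) auto
  moreover have "(\<lambda>x. indicator {a..b} x *\<^sub>R h x) \<in> borel_measurable lborel"
    using h by (simp add: set_integrable_def borel_measurable_integrable)
  ultimately have "(\<lambda>x. (indicator {a..b} x *\<^sub>R w x) * (indicator {a..b} x *\<^sub>R h x)) \<in> borel_measurable lborel"
    by simp
  also have "(\<lambda>x. (indicator {a..b} x *\<^sub>R w x) * (indicator {a..b} x *\<^sub>R h x)) = (\<lambda>x. indicator {a..b} x *\<^sub>R (w x * h x))"
    by (auto simp: indicator_def)
  finally have m: "(\<lambda>x. indicator {a..b} x *\<^sub>R (w x * h x)) \<in> borel_measurable lborel" .
  show ?thesis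
    unfolding set_integrable_def
  proof (rule Bochner_Integration.integrable_bound[OF _ m])
    show "integrable lborel (\<lambda>x. B * (indicator {a..b} x *\<^sub>R h x))"
      using h by (simp add: set_integrable_def)
    show "AE x in lborel. norm (indicator {a..b} x *\<^sub>R (w x * h x)) \<le> norm (B * (indicator {a..b} x *\<^sub>R h x))"
      using B by (auto simp: indicator_def abs_mult intro!: AE_I2 mult_right_mono intro: order_trans[OF _ abs_ge_self])
  qed
qed

text \<open>Integration by parts, obtained from the product rule at the points where both factors
  are differentiable.\<close>

lemma primitive_on_mult:
  assumes E: "open E" and w: "primitive_on E w h" and w': "primitive_on E w' h'"
  shows "primitive_on E (\<lambda>x. w x * w' x) (\<lambda>x. w x * h' x + w' x * h x)"
proof (rule primitive_on_AC)
  show "AC_on E (\<lambda>x. w x * w' x)"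
    using AC_on_primitive[OF w] AC_on_primitive[OF w'] by (auto simp: AC_on_def intro: abs_cont_mult)
  show "AE x in lborel. x \<in> E \<longrightarrow> ((\<lambda>x. w x * w' x) has_real_derivative w x * h' x + w' x * h x) (at x)"
    using AE_derivative_primitive[OF E w] AE_derivative_primitive[OF E w']
    by eventually_elim (auto intro!: derivative_eq_intros)
  fix a b :: real assume ab: "a \<le> b" "{a..b} \<subseteq> E"
  have "continuous_on {a..b} w" "continuous_on {a..b} w'"
    using primitive_on_continuous[OF E w] primitive_on_continuous[OF E w'] ab continuous_on_subset by blast+
  then show "set_integrable lborel {a..b} (\<lambda>x. w x * h' x + w' x * h x)"
    using primitive_onD(1)[OF w ab] primitive_onD(1)[OF w' ab]
    by (intro set_integral_add set_integrable_mult_continuous)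
qed

lemma abs_exp_diff_le:
  fixes x y B :: real
  assumes "x \<le> B" "y \<le> B" shows "\<bar>exp x - exp y\<bar> \<le> exp B * \<bar>x - y\<bar>"
proof -
  have *: "exp x - exp y \<le> exp B * (x - y)" if "y \<le> x" "x \<le> B" for x y :: real
  proof -
    have "exp x - exp y = exp x * (1 - exp (y - x))" by (simp add: algebra_simps exp_diff)
    also have "\<dots> \<le> exp x * (x - y)" using exp_ge_add_one_self[of "y - x"] by (intro mult_left_mono) (linarith, simp)
    also have "\<dots> \<le> exp B * (x - y)" using that by (intro mult_right_mono) auto
    finally show ?thesis .
  qed
  show ?thesis using *[of x y] *[of y x] assms by (cases "x \<le> y") (auto simp: abs_if)
qed

text \<open>Supplies the integrating factor. On a compact interval \<open>q\<close> is continuous,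
  hence bounded above by some \<open>B\<close>, and there \<open>exp\<close> has Lipschitz constant
  \<open>exp B\<close>.\<close>

lemma primitive_on_exp:
  assumes E: "open E" and q: "primitive_on E q \<psi>"
  shows "primitive_on E (\<lambda>x. exp (q x)) (\<lambda>x. exp (q x) * \<psi> x)"
proof (rule primitive_on_AC)
  note cont = primitive_on_continuous[OF E q]
  show "AC_on E (\<lambda>x. exp (q x))"
    unfolding AC_on_def
  proof (intro allI impI, elim conjE)
    fix a b :: real assume ab: "a \<le> b" "{a..b} \<subseteq> E"
    have "continuous_on {a..b} q" using cont ab continuous_on_subset by blast
    then obtain B where "\<And>x. x \<in> {a..b} \<Longrightarrow> \<bar>q x\<bar> \<le> B"
      using continuous_on_Icc_abs_bounded by blast
    then have B: "q x \<le> B" if "x \<in> {a..b}" for x using that by fastforce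
    show "abs_cont_on_interval (\<lambda>x. exp (q x)) a b"
      by (rule abs_cont_lipschitz_compose[where L="exp B"])
        (use AC_on_primitive[OF q] ab B in \<open>auto simp: AC_on_def intro!: abs_exp_diff_le\<close>)
  qed
  show "AE x in lborel. x \<in> E \<longrightarrow> ((\<lambda>x. exp (q x)) has_real_derivative exp (q x) * \<psi> x) (at x)"
    using AE_derivative_primitive[OF E q]
    by eventually_elim (auto intro!: derivative_eq_intros)
  fix a b :: real assume ab: "a \<le> b" "{a..b} \<subseteq> E"
  then show "set_integrable lborel {a..b} (\<lambda>x. exp (q x) * \<psi> x)"
    using cont by (intro set_integrable_mult_continuous primitive_onD(1)[OF q])
      (auto intro!: continuous_intros intro: continuous_on_subset)
qed

section \<open>The domain of A as an integral equation\<close>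

text \<open>Since \<open>lborel\<close> is not complete, equality a.e. does not pass on
  measurability; integrability of \<open>h'\<close> on compact intervals is therefore a separate
  premise.\<close>

lemma primitive_on_cong_AE:
  assumes w: "primitive_on E w h" and eq: "AE x in lborel. x \<in> E \<longrightarrow> h x = h' x"
    and h': "\<And>a b. a \<le> b \<Longrightarrow> {a..b} \<subseteq> E \<Longrightarrow> set_integrable lborel {a..b} h'"
  shows "primitive_on E w h'"
  unfolding primitive_on_def
proof (intro allI impI, elim conjE, intro conjI)
  fix x y assume xy: "x \<le> y" "{x..y} \<subseteq> E"
  show 1: "set_integrable lborel {x..y} h'" using h' xy by blast
  have 2: "set_integrable lborel {x..y} h" using primitive_onD(1)[OF w xy] .
  have "(LINT z:{x..y}|lborel. h z) = (LINT z:{x..y}|lborel. h' z)"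
    unfolding set_lebesgue_integral_def
  proof (rule integral_cong_AE)
    show "AE z in lborel. indicat_real {x..y} z *\<^sub>R h z = indicat_real {x..y} z *\<^sub>R h' z"
      using eq by eventually_elim (use xy in \<open>auto simp: indicator_def\<close>)
  qed (use 1 2 in \<open>auto simp: set_integrable_def dest: borel_measurable_integrable\<close>)
  with primitive_onD(2)[OF w xy] show "w y - w x = (LINT z:{x..y}|lborel. h' z)" by simp
qed

lemma set_integrable_uminus:
  fixes h :: "'a \<Rightarrow> real"
  shows "set_integrable M A h \<Longrightarrow> set_integrable M A (\<lambda>x. - h x)"
  by (simp add: set_integrable_def)

lemma primitive_on_uminus: "primitive_on E w h \<Longrightarrow> primitive_on E (\<lambda>x. - w x) (\<lambda>x. - h x)"
  unfolding primitive_on_def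
proof (intro allI impI, elim conjE, intro conjI)
  fix x y assume *: "\<forall>x y. x \<le> y \<and> {x..y} \<subseteq> E \<longrightarrow>
     set_integrable lborel {x..y} h \<and> w y - w x = (LINT z:{x..y}|lborel. h z)" "x \<le> y" "{x..y} \<subseteq> E"
  then show "set_integrable lborel {x..y} (\<lambda>x. - h x)" by (intro set_integrable_uminus) blast
  have "w y - w x = (LINT z:{x..y}|lborel. h z)" using * by blast
  then show "- w y - - w x = (LINT z:{x..y}|lborel. - h z)" by (simp add: set_lebesgue_integral_def)
qed

lemma primitive_on_add_const: "primitive_on E w h \<Longrightarrow> primitive_on E (\<lambda>x. c + w x) h"
  by (auto simp: primitive_on_def)

lemma primitive_on_diff_const:
  assumes w: "primitive_on E w h" and w': "primitive_on E w' h"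
    and cv: "\<And>x y. x \<in> E \<Longrightarrow> y \<in> E \<Longrightarrow> {x..y} \<subseteq> E" and x: "x \<in> E" and y: "y \<in> E"
  shows "w x - w' x = w y - w' y"
proof -
  have *: "w x - w' x = w y - w' y" if "x \<in> E" "y \<in> E" "x \<le> y" for x y
    using primitive_onD(2)[OF w that(3) cv[OF that(1,2)]] primitive_onD(2)[OF w' that(3) cv[OF that(1,2)]] by simp
  show ?thesis using *[OF x y] *[OF y x] by linarith
qed

text \<open>The primitive is anchored at the left end of \<open>E\<close> instead of at an interior
  point; this choice later absorbs the boundary condition.\<close>

lemma set_integral_lower_primitive:
  assumes E: "E \<in> sets borel" and k: "set_integrable lborel E k"
  shows "primitive_on E (\<lambda>x. LINT z:(E \<inter> {..x})|lborel. k z) k"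
  unfolding primitive_on_def
proof (intro allI impI, elim conjE, intro conjI)
  fix x y assume xy: "x \<le> y" "{x..y} \<subseteq> E"
  show "set_integrable lborel {x..y} k" by (rule set_integrable_subset[OF k]) (use xy in auto)
  have i: "set_integrable lborel (E \<inter> A) k" if "A \<in> sets borel" for A
    by (rule set_integrable_subset[OF k]) (use that E in auto)
  have "E \<inter> {..y} = (E \<inter> {..x}) \<union> {x<..y}" "E \<inter> {..x} \<inter> {x<..y} = {}" using xy by auto
  then have "(LINT z:(E \<inter> {..y})|lborel. k z) = (LINT z:(E \<inter> {..x})|lborel. k z) + (LINT z:{x<..y}|lborel. k z)"
    using set_integral_Un[of "E \<inter> {..x}" "{x<..y}" lborel k] i[of "{..x}"] i[of "{x<..y}"] xy
    by (auto simp: Int_absorb1 subset_iff)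
  also have "(LINT z:{x<..y}|lborel. k z) = (LINT z:{x..y}|lborel. k z)"
    unfolding set_lebesgue_integral_def
  proof (rule integral_cong_AE)
    show "AE z in lborel. indicat_real {x<..y} z *\<^sub>R k z = indicat_real {x..y} z *\<^sub>R k z"
      using AE_lborel_singleton[of x] by eventually_elim (auto simp: indicator_def)
    have "set_integrable lborel {x<..y} k" "set_integrable lborel {x..y} k"
      by (rule set_integrable_subset[OF k]; use xy in auto)+
    then show "(\<lambda>z. indicat_real {x<..y} z *\<^sub>R k z) \<in> borel_measurable lborel"
      "(\<lambda>z. indicat_real {x..y} z *\<^sub>R k z) \<in> borel_measurable lborel"
      by (auto simp: set_integrable_def dest: borel_measurable_integrable)
  qed
  finally show "(LINT z:(E \<inter> {..y})|lborel. k z) - (LINT z:(E \<inter> {..x})|lborel. k z) = (LINT z:{x..y}|lborel. k z)"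
    by simp
qed

text \<open>Replaces a limit at the left end of \<open>E\<close>, finite or infinite, by a limit
  along a sequence, to which dominated convergence applies. The running minima of an enumeration of
  the rationals in \<open>E\<close> fall below every point of \<open>E\<close>.\<close>

lemma open_coinitial_sequence:
  fixes E :: "real set"
  assumes "open E" "E \<noteq> {}"
  obtains y where "\<And>n::nat. y n \<in> E" "\<And>z. z \<in> E \<Longrightarrow> \<forall>\<^sub>F n in sequentially. y n < z"
proof -
  let ?D = "E \<inter> \<rat>"
  have lower: "\<exists>r\<in>?D. r < z" if z: "z \<in> E" for z
  proof -
    obtain d where d: "d > 0" "ball z d \<subseteq> E" using assms z open_contains_ball by blast
    obtain r where r: "r \<in> \<rat>" "z - d < r" "r < z" using Rats_dense_in_real[of "z - d" z] d by auto
    have "r \<in> ball z d" using r by (auto simp: dist_real_def)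
    then show ?thesis using d r by blast
  qed
  then have ne: "?D \<noteq> {}" using assms by blast
  have cD: "countable ?D" by (simp add: countable_rat)
  define y where "y n = Min (from_nat_into ?D ` {..n})" for n :: nat
  have "y n \<in> from_nat_into ?D ` {..n}" for n unfolding y_def by (intro Min_in) auto
  then have "y n \<in> E" for n using from_nat_into[OF ne] by (metis IntD1 imageE)
  moreover have "\<forall>\<^sub>F n in sequentially. y n < z" if z: "z \<in> E" for z
  proof -
    obtain r where r: "r \<in> ?D" "r < z" using lower[OF z] by blast
    then obtain m where m: "r = from_nat_into ?D m" using from_nat_into_surj[OF cD] by metis
    have "y n \<le> r" if "n \<ge> m" for n unfolding y_def m using that by (intro Min_le) auto
    then show ?thesis using r by (intro eventually_sequentiallyI[of m]) (auto intro: le_less_trans)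
  qed
  ultimately show thesis by (rule that)
qed

text \<open>Dominated convergence makes the integral of \<open>\<bar>k\<bar>\<close> below some
  \<open>y n\<close> small; as this integral is monotone in the upper limit, the bound holds for
  every \<open>x \<le> y n\<close>. The conclusion has the shape of the boundary condition in
  \<open>A0_graph\<close>.\<close>

lemma set_integral_lower_tendsto_0:
  fixes k :: "real \<Rightarrow> real"
  assumes E: "open E" "E \<noteq> {}" and k: "set_integrable lborel E k" and e: "e > 0"
  shows "\<exists>y\<in>E. \<forall>x\<in>E. x \<le> y \<longrightarrow> \<bar>LINT z:(E \<inter> {..x})|lborel. k z\<bar> < e"
proof -
  obtain y where y: "\<And>n::nat. y n \<in> E" "\<And>z. z \<in> E \<Longrightarrow> \<forall>\<^sub>F n in sequentially. y n < z"
    using open_coinitial_sequence[OF E] by metis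
  have [measurable]: "E \<in> sets borel" using E by simp
  define k' where "k' z = \<bar>indicator E z * k z\<bar>" for z
  have k': "integrable lborel k'" using k by (simp add: set_integrable_def k'_def[abs_def] integrable_abs)
  have [measurable]: "k' \<in> borel_measurable borel" using borel_measurable_integrable[OF k'] by simp
  have "(\<lambda>n. LINT z|lborel. indicator {..y n} z * k' z) \<longlonglongrightarrow> (LINT z|(lborel::real measure). 0::real)"
  proof (rule integral_dominated_convergence[where w=k'])
    show "AE z in lborel. (\<lambda>n. indicator {..y n} z * k' z) \<longlonglongrightarrow> 0"
    proof (rule AE_I2, rule tendsto_eventually)
      fix z show "\<forall>\<^sub>F n in sequentially. indicator {..y n} z * k' z = 0"
      proof (cases "z \<in> E")
        case True
        show ?thesis using y(2)[OF True] by eventually_elim (auto simp: indicator_def)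
      qed (auto simp: k'_def)
    qed
    show "AE z in lborel. norm (indicator {..y n} z * k' z) \<le> k' z" for n by (auto simp: k'_def indicator_def)
  qed (use k' in auto)
  then have "(\<lambda>n. LINT z|lborel. indicator {..y n} z * k' z) \<longlonglongrightarrow> 0" by simp
  from order_tendstoD(2)[OF this e]
  obtain n where n: "(LINT z|lborel. indicator {..y n} z * k' z) < e" by (auto simp: eventually_sequentially)
  have "\<bar>LINT z:(E \<inter> {..x})|lborel. k z\<bar> < e" if "x \<le> y n" for x
  proof -
    have "\<bar>LINT z:(E \<inter> {..x})|lborel. k z\<bar> \<le> (LINT z|lborel. \<bar>indicator (E \<inter> {..x}) z * k z\<bar>)"
      unfolding set_lebesgue_integral_def using integral_abs_bound by auto
    also have "\<dots> \<le> (LINT z|lborel. indicator {..y n} z * k' z)"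
    proof (rule integral_mono')
      show "integrable lborel (\<lambda>z. indicator {..y n} z * k' z)"
        by (rule Bochner_Integration.integrable_bound[OF k']) (auto simp: indicator_def)
    qed (use that in \<open>auto simp: k'_def indicator_def\<close>)
    finally show ?thesis using n by simp
  qed
  then show ?thesis using y(1)[of n] by blast
qed

lemma open_Eint [simp]: "open (Eint d0 d1)"
proof -
  have "Eint d0 d1 = ereal -` {d0<..<d1}" by (auto simp: Eint_def)
  then show ?thesis by (simp add: open_vimage continuous_on_ereal)
qed

lemma Eint_convex: "x \<in> Eint d0 d1 \<Longrightarrow> y \<in> Eint d0 d1 \<Longrightarrow> {x..y} \<subseteq> Eint d0 d1"
  unfolding Eint_def by (auto intro: less_le_trans le_less_trans simp flip: ereal_less_eq(3))

text \<open>The representative \<open>w\<close> of \<open>g u\<close> and the negated lower integral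
  are primitives of the same function \<open>- (v + \<phi> u)\<close>, so they differ by a constant,
  and both vanish at the left end. Conversely the negated lower integral serves as \<open>w\<close>,
  with \<open>v + \<phi> u\<close> in the role of \<open>A0 u\<close>.\<close>

lemma A_graph_iff_integral_equation:
  fixes d0 d1 :: ereal and u v g \<phi> :: "real \<Rightarrow> real"
  defines "E \<equiv> Eint d0 d1"
  assumes ne: "E \<noteq> {}"
  shows "A_graph d0 d1 g \<phi> u v \<longleftrightarrow> L1 E u \<and> L1 E v \<and> L1 E (\<lambda>x. \<phi> x * u x) \<and>
    (AE x in lborel. x \<in> E \<longrightarrow> g x * u x = - (LINT z:(E \<inter> {..x})|lborel. v z + \<phi> z * u z))"
    (is "?L \<longleftrightarrow> ?R")
proof
  have E: "open E" "E \<in> sets borel" by (auto simp: E_def)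
  let ?k = "\<lambda>z. v z + \<phi> z * u z"
  let ?K = "\<lambda>x. LINT z:(E \<inter> {..x})|lborel. ?k z"
  have sub: "set_integrable lborel {a..b} h" if "set_integrable lborel E h" "{a..b} \<subseteq> E" for a b :: real and h :: "real \<Rightarrow> real"
    by (rule set_integrable_subset[OF that(1)]) (use that in auto)
  have prim: "primitive_on E (\<lambda>x. - ?K x) (\<lambda>x. - ?k x)" if "set_integrable lborel E ?k"
    by (intro primitive_on_uminus set_integral_lower_primitive E that)
  {
    assume ?L
    then obtain v0 w where L: "L1 E u" "L1 E v" "L1 E (\<lambda>x. \<phi> x * u x)" "L1 E v0"
      "AE x in lborel. x \<in> E \<longrightarrow> v x = v0 x - \<phi> x * u x" "AC_on E w"
      "AE x in lborel. x \<in> E \<longrightarrow> w x = g x * u x"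
      "AE x in lborel. x \<in> E \<longrightarrow> (w has_real_derivative - v0 x) (at x)"
      "\<forall>\<epsilon>>0. \<exists>y\<in>E. \<forall>x\<in>E. x \<le> y \<longrightarrow> \<bar>w x\<bar> < \<epsilon>"
      unfolding A_graph_def A0_graph_def E_def by blast
    have k: "set_integrable lborel E ?k" using L(2,3) unfolding L1_def by (rule set_integral_add(1))
    have "primitive_on E w (\<lambda>x. - v0 x)"
      by (rule primitive_on_AC[OF L(6,8)])
        (use sub[OF L(4)[unfolded L1_def]] in \<open>simp add: set_integrable_def\<close>)
    then have pw: "primitive_on E w (\<lambda>x. - ?k x)"
    proof (rule primitive_on_cong_AE)
      show "AE x in lborel. x \<in> E \<longrightarrow> - v0 x = - ?k x" using L(5) by eventually_elim auto
      show "set_integrable lborel {a..b} (\<lambda>x. - ?k x)" if "{a..b} \<subseteq> E" for a b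
        by (rule set_integrable_uminus[OF sub[OF k that]])
    qed
    have "w x = - ?K x" if x: "x \<in> E" for x
    proof (rule ccontr)
      assume "w x \<noteq> - ?K x"
      \<comment> \<open>Half of the supposed constant difference: near the left end both primitives
        are below \<open>c\<close> in absolute value, so they cannot be \<open>2 * c\<close>
        apart.\<close>
      define c where "c = \<bar>w x + ?K x\<bar> / 2"
      have c: "c > 0" using \<open>w x \<noteq> - ?K x\<close> by (auto simp: c_def)
      obtain y1 where y1: "y1 \<in> E" "\<And>x. x \<in> E \<Longrightarrow> x \<le> y1 \<Longrightarrow> \<bar>w x\<bar> < c" using L(9) c by blast
      obtain y2 where y2: "y2 \<in> E" "\<And>x. x \<in> E \<Longrightarrow> x \<le> y2 \<Longrightarrow> \<bar>?K x\<bar> < c"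
        using set_integral_lower_tendsto_0[OF E(1) ne k c] by blast
      define y where "y = min y1 y2"
      have y: "y \<in> E" "y \<le> y1" "y \<le> y2" using y1 y2 by (auto simp: y_def min_def)
      have "w x + ?K x = w y + ?K y"
        using primitive_on_diff_const[OF pw prim[OF k] _ x y(1)] Eint_convex unfolding E_def by auto
      then have "2 * c = \<bar>w y + ?K y\<bar>" by (simp add: c_def)
      also have "\<dots> \<le> \<bar>w y\<bar> + \<bar>?K y\<bar>" by (rule abs_triangle_ineq)
      also have "\<dots> < c + c" by (intro add_strict_mono y1(2)[OF y(1,2)] y2(2)[OF y(1,3)])
      finally show False by simp
    qed
    with L(1-3,7) show ?R by auto
  }
  {
    assume R: ?R
    then have k: "set_integrable lborel E ?k" unfolding L1_def by (intro set_integral_add(1)) auto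
    note p = prim[OF k]
    have "A0_graph d0 d1 g u ?k"
      unfolding A0_graph_def E_def[symmetric]
    proof (intro conjI exI[of _ "\<lambda>x. - ?K x"])
      show "L1 E u" "L1 E ?k" using R k by (auto simp: L1_def)
      show "AC_on E (\<lambda>x. - ?K x)" by (rule AC_on_primitive[OF p])
      show "AE x in lborel. x \<in> E \<longrightarrow> - ?K x = g x * u x" using R by auto
      show "AE x in lborel. x \<in> E \<longrightarrow> ((\<lambda>x. - ?K x) has_real_derivative - ?k x) (at x)"
        by (rule AE_derivative_primitive[OF E(1) p])
      show "\<forall>\<epsilon>>0. \<exists>y\<in>E. \<forall>x\<in>E. x \<le> y \<longrightarrow> \<bar>- ?K x\<bar> < \<epsilon>"
        using set_integral_lower_tendsto_0[OF E(1) ne k] by simp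
    qed
    then show ?L
      unfolding A_graph_def E_def[symmetric] using R by (intro conjI exI[of _ ?k]) auto
  }
qed

section \<open>Translation with killing on a half-line\<close>

lemma AE_lborel_translate:
  fixes t :: real
  assumes "AE x in lborel. P x" shows "AE x in lborel. P (x - t)"
proof -
  have "negligible ((+) t ` {x. \<not> P x})"
    by (rule negligible_translation[OF AE_lborel_imp_negligible[OF assms]])
  then have "AE x in lborel. x \<notin> (+) t ` {x. \<not> P x}" by (rule negligible_imp_AE_lborel)
  then show ?thesis
  proof eventually_elim
    case (elim x)
    then show ?case by (metis (mono_tags, lifting) add.commute diff_add_cancel image_eqI mem_Collect_eq)
  qed
qed

lemma integrable_translate:
  fixes f :: "real \<Rightarrow> real"
  assumes "integrable lborel f" shows "integrable lborel (\<lambda>x. f (x - t))"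
  using lborel_integrable_real_affine[OF assms, of 1 "- t"] by simp

lemma integral_translate:
  fixes f :: "real \<Rightarrow> real"
  shows "(LINT x|lborel. f (x - t)) = (LINT x|lborel. f x)"
  using lborel_integral_real_affine[of 1 f "- t"] by simp

text \<open>By Tonelli, every point \<open>r\<close> lies in the window \<open>{s - t..s}\<close>
  for a set of \<open>s\<close> of measure exactly \<open>t\<close>. Hence averaging over windows of
  length \<open>t\<close> preserves the total mass.\<close>

lemma nn_integral_indicator_convolution:
  fixes v :: "real \<Rightarrow> ennreal"
  assumes [measurable]: "v \<in> borel_measurable borel" and t: "t \<ge> 0"
  shows "(\<integral>\<^sup>+s. (\<integral>\<^sup>+r. v r * indicator {0..t} (s - r) \<partial>lborel) \<partial>lborel) = ennreal t * (\<integral>\<^sup>+r. v r \<partial>lborel)"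
proof -
  have "(\<integral>\<^sup>+s. (\<integral>\<^sup>+r. v r * indicator {0..t} (s - r) \<partial>lborel) \<partial>lborel)
      = (\<integral>\<^sup>+r. (\<integral>\<^sup>+s. v r * indicator {0..t} (s - r) \<partial>lborel) \<partial>lborel)"
    by (rule lborel_pair.Fubini'[symmetric]) measurable
  also have "\<dots> = (\<integral>\<^sup>+r. v r * ennreal t \<partial>lborel)"
  proof (rule nn_integral_cong)
    fix r :: real
    have "(\<integral>\<^sup>+s. v r * indicator {0..t} (s - r) \<partial>lborel) = (\<integral>\<^sup>+s. v r * indicator {r..r + t} s \<partial>lborel)"
      by (rule nn_integral_cong) (auto simp: indicator_def)
    also have "\<dots> = v r * emeasure lborel {r..r + t}"
      by (simp add: nn_integral_cmult nn_integral_indicator)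
    finally show "(\<integral>\<^sup>+s. v r * indicator {0..t} (s - r) \<partial>lborel) = v r * ennreal t"
      using t by simp
  qed
  also have "\<dots> = (\<integral>\<^sup>+r. v r \<partial>lborel) * ennreal t"
    by (rule nn_integral_multc) simp
  also have "\<dots> = ennreal t * (\<integral>\<^sup>+r. v r \<partial>lborel)" by (rule mult.commute)
  finally show ?thesis .
qed

text \<open>The semigroup in straightened coordinates. Only increments of \<open>q\<close> enter, so
  it may be any primitive of the killing rate; measurability of \<psi> is stated after cutting off
  outside \<open>J\<close>, where its values carry no meaning.\<close>

locale killed_translation =
  fixes J :: "real set" and \<psi> q :: "real \<Rightarrow> real"
  assumes J_open: "open J" and J_ne: "J \<noteq> {}" and J_up: "\<And>s t. s \<in> J \<Longrightarrow> s \<le> t \<Longrightarrow> t \<in> J"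
    and \<psi>_meas: "(\<lambda>s. indicator J s * \<psi> s) \<in> borel_measurable borel"
    and \<psi>_nonneg: "\<And>s. s \<in> J \<Longrightarrow> \<psi> s \<ge> 0"
    and q: "primitive_on J q \<psi>"
begin

text \<open>The value 0 also for \<open>s\<close> outside \<open>J\<close> makes
  \<open>T t f\<close> itself, without an indicator, an integrable function on the whole line, ready
  for translation invariance.\<close>

definition T :: "real \<Rightarrow> (real \<Rightarrow> real) \<Rightarrow> real \<Rightarrow> real" where
  "T t f s = (if s \<in> J \<and> s - t \<in> J then exp (q (s - t) - q s) * f (s - t) else 0)"

lemma J_borel [measurable]: "J \<in> sets borel"
  using J_open by simp

lemma J_convex: "x \<in> J \<Longrightarrow> {x..y} \<subseteq> J"
  using J_up by auto

lemma q_mono: "s \<in> J \<Longrightarrow> s \<le> t \<Longrightarrow> q s \<le> q t"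
proof -
  assume s: "s \<in> J" "s \<le> t"
  have "q t - q s = (LINT z:{s..t}|lborel. \<psi> z)" by (rule primitive_onD(2)[OF q s(2) J_convex[OF s(1)]])
  also have "\<dots> \<ge> 0" unfolding set_lebesgue_integral_def
    using \<psi>_nonneg J_up[OF s(1)] by (intro integral_nonneg_AE AE_I2) (auto simp: indicator_def)
  finally show ?thesis by simp
qed

lemma q_continuous: "continuous_on J q"
  by (rule primitive_on_continuous[OF J_open q])

lemma q_measurable: "(\<lambda>s. indicator J s * q s) \<in> borel_measurable borel"
  using borel_measurable_continuous_on_indicator[OF J_borel q_continuous] by simp

lemma integrable_indicator_J:
  fixes f :: "real \<Rightarrow> real"
  shows "set_integrable lborel J f \<longleftrightarrow> integrable lborel (\<lambda>s. indicator J s * f s)"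
  by (simp add: set_integrable_def)

text \<open>Written with every ingredient cut off to \<open>J\<close>, because only the cut-off
  functions are known to be Borel.\<close>

lemma T_eq: "T t f s = indicator J s * indicator J (s - t) *
   exp (indicator J (s - t) * q (s - t) - indicator J s * q s) * (indicator J (s - t) * f (s - t))"
  by (auto simp: T_def indicator_def)

lemma T_measurable:
  assumes [measurable]: "(\<lambda>s. indicator J s * f s) \<in> borel_measurable borel"
  shows "T t f \<in> borel_measurable borel"
proof -
  note q_measurable[measurable]
  show ?thesis unfolding T_eq[abs_def] by measurable
qed

lemma abs_T_le: "t \<ge> 0 \<Longrightarrow> \<bar>T t f s\<bar> \<le> \<bar>indicator J (s - t) * f (s - t)\<bar>"
  using q_mono[of "s - t" s] by (auto simp: T_def indicator_def abs_mult intro!: mult_left_le_one_le)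

lemma T_integrable:
  assumes f: "set_integrable lborel J f" and t: "t \<ge> 0"
  shows "integrable lborel (T t f)"
proof (rule Bochner_Integration.integrable_bound)
  have f': "integrable lborel (\<lambda>s. indicator J s * f s)" using f by (simp add: integrable_indicator_J)
  show "integrable lborel (\<lambda>s. indicator J (s - t) * f (s - t))"
    by (rule integrable_translate[OF f'])
  show "T t f \<in> borel_measurable lborel"
    using T_measurable borel_measurable_integrable[OF f'] by simp
qed (use abs_T_le[OF t] in auto)

lemma T_L1: "set_integrable lborel J f \<Longrightarrow> t \<ge> 0 \<Longrightarrow> L1 J (T t f)"
proof -
  assume *: "set_integrable lborel J f" "t \<ge> 0"
  have "(\<lambda>s. indicator J s * T t f s) = T t f" by (auto simp: T_def indicator_def)
  then show ?thesis using T_integrable[OF *] by (simp add: L1_def integrable_indicator_J)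
qed

lemma set_integrable_sub: "set_integrable lborel J h \<Longrightarrow> x \<in> J \<Longrightarrow> set_integrable lborel {x..y} h"
  for h :: "real \<Rightarrow> real"
  by (rule set_integrable_subset) (use J_convex in auto)

lemma set_integrable_exp_q:
  fixes h :: "real \<Rightarrow> real"
  assumes "set_integrable lborel J h" "x \<in> J" shows "set_integrable lborel {x..y} (\<lambda>s. exp (q s) * h s)"
proof (rule set_integrable_mult_continuous[OF set_integrable_sub[OF assms]])
  show "continuous_on {x..y} (\<lambda>s. exp (q s))"
    using J_convex[OF assms(2)] by (intro continuous_on_exp continuous_on_subset[OF q_continuous])
qed

text \<open>As \<open>q\<close> is nondecreasing, the weight \<open>exp (q z)\<close> is at most its
  value at the right endpoint. This outer factor cancels against the \<open>exp (- q s)\<close> in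
  the difference quotient, leaving a bound free of \<open>q\<close>.\<close>

lemma abs_primitive_exp_increment_le:
  assumes v: "set_integrable lborel J v"
    and \<Phi>: "primitive_on J \<Phi> (\<lambda>s. exp (q s) * v s)"
    and r: "r \<in> J" "r \<le> s"
  shows "\<bar>\<Phi> s - \<Phi> r\<bar> \<le> exp (q s) * (LINT z|lborel. indicator {r..s} z * \<bar>indicator J z * v z\<bar>)"
proof -
  have "\<bar>\<Phi> s - \<Phi> r\<bar> = \<bar>LINT z:{r..s}|lborel. exp (q z) * v z\<bar>"
    by (subst primitive_onD(2)[OF \<Phi> r(2) J_convex[OF r(1)]]) simp
  also have "\<dots> \<le> (LINT z|lborel. \<bar>indicator {r..s} z * (exp (q z) * v z)\<bar>)"
    unfolding set_lebesgue_integral_def using integral_abs_bound by auto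
  also have "\<dots> \<le> (LINT z|lborel. exp (q s) * (indicator {r..s} z * \<bar>indicator J z * v z\<bar>))"
  proof (rule integral_mono')
    have "set_integrable lborel {r..s} v" by (rule set_integrable_sub[OF v r(1)])
    then have "integrable lborel (\<lambda>z. \<bar>indicator {r..s} z * v z\<bar>)" by (simp add: set_integrable_def integrable_abs)
    also have "(\<lambda>z. \<bar>indicator {r..s} z * v z\<bar>) = (\<lambda>z. indicator {r..s} z * \<bar>indicator J z * v z\<bar>)"
      using J_convex[OF r(1), of s] by (auto simp: indicator_def fun_eq_iff)
    finally show "integrable lborel (\<lambda>z. exp (q s) * (indicator {r..s} z * \<bar>indicator J z * v z\<bar>))" by simp
    fix z
    show "\<bar>indicator {r..s} z * (exp (q z) * v z)\<bar> \<le> exp (q s) * (indicator {r..s} z * \<bar>indicator J z * v z\<bar>)"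
    proof (cases "z \<in> {r..s}")
      case True
      then have "z \<in> J" using J_up[OF r(1)] by auto
      with True q_mono[of z s] show ?thesis by (auto simp: abs_mult intro!: mult_right_mono)
    qed auto
  qed auto
  finally show ?thesis by simp
qed

text \<open>The difference quotient is \<open>1 / t\<close> times the integral of \<open>exp (q r - q s) * v r\<close> over
  \<open>J \<inter> {s - t..s}\<close>. It converges to \<open>v\<close> almost everywhere and, by Tonelli, its norm is at most that
  of \<open>v\<close>, so Scheffe's lemma gives convergence in \<open>L\<^sup>1\<close>.\<close>

lemma integral_equation_imp_generator:
  assumes f: "set_integrable lborel J f" and v: "set_integrable lborel J v"
    and \<psi>f: "set_integrable lborel J (\<lambda>s. \<psi> s * f s)"
    and eq: "AE s in lborel. s \<in> J \<longrightarrow> f s = - (LINT r:(J \<inter> {..s})|lborel. v r + \<psi> r * f r)"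
  shows "generator J T f v"
proof -
  define k where "k s = v s + \<psi> s * f s" for s
  have k: "set_integrable lborel J k" unfolding k_def[abs_def] using v \<psi>f by (rule set_integral_add(1))
  define W where "W s = - (LINT r:(J \<inter> {..s})|lborel. k r)" for s
  have W: "primitive_on J W (\<lambda>s. - k s)"
    unfolding W_def[abs_def] by (intro primitive_on_uminus set_integral_lower_primitive J_borel k)
  have fW: "AE s in lborel. s \<in> J \<longrightarrow> f s = W s" using eq by (simp add: W_def k_def)
  \<comment> \<open>In the derivative of \<open>exp q * W\<close> the contribution \<psi> f of
    \<open>k\<close> cancels the one from differentiating \<open>exp q\<close>, because
    \<open>W = f\<close> a.e.; what remains is \<open>- exp q * v\<close>.\<close>
  define \<Phi> where "\<Phi> s = - (exp (q s) * W s)" for s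
  have "primitive_on J (\<lambda>s. exp (q s) * W s) (\<lambda>s. - (exp (q s) * v s))"
  proof (rule primitive_on_cong_AE[OF primitive_on_mult[OF J_open primitive_on_exp[OF J_open q] W]])
    show "AE s in lborel. s \<in> J \<longrightarrow> exp (q s) * - k s + W s * (exp (q s) * \<psi> s) = - (exp (q s) * v s)"
      using fW by eventually_elim (auto simp: k_def algebra_simps)
    show "set_integrable lborel {a..b} (\<lambda>s. - (exp (q s) * v s))" if "a \<le> b" "{a..b} \<subseteq> J" for a b
      by (rule set_integrable_uminus[OF set_integrable_exp_q[OF v]]) (use that in auto)
  qed
  from primitive_on_uminus[OF this] have \<Phi>: "primitive_on J \<Phi> (\<lambda>s. exp (q s) * v s)"
    by (simp add: \<Phi>_def[abs_def])
  define v' where "v' z = indicator J z * v z" for z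
  have v': "integrable lborel v'" using v by (simp add: integrable_indicator_J v'_def[abs_def])
  have [measurable]: "v' \<in> borel_measurable borel" using borel_measurable_integrable[OF v'] by simp
  define f' where "f' z = indicator J z * f z" for z
  have f': "integrable lborel f'" using f by (simp add: integrable_indicator_J f'_def[abs_def])
  have [measurable]: "f' \<in> borel_measurable borel" using borel_measurable_integrable[OF f'] by simp
  have T_meas [measurable]: "T t f \<in> borel_measurable borel" for t
    by (rule T_measurable) (use borel_measurable_integrable[OF f'] in \<open>simp add: f'_def[abs_def]\<close>)
  have int_ind: "integrable lborel (\<lambda>z. indicator A z * \<bar>v' z\<bar>)" if [measurable]: "A \<in> sets borel" for A
    by (rule Bochner_Integration.integrable_bound[OF v']) (auto simp: indicator_def)
  \<comment> \<open>Needed when \<open>s - t\<close> lies outside \<open>J\<close> and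
    \<open>T t f s\<close> is 0, so that the increment is \<open>W s\<close> itself. Towards the
    left end \<open>W\<close> tends to 0 while \<open>exp q\<close> stays below
    \<open>exp (q s)\<close>, hence \<Phi> tends to 0 there and the increment bound extends to the
    full lower integral.\<close>
  have W_le: "\<bar>W s\<bar> \<le> (LINT z|lborel. indicator {..s} z * \<bar>v' z\<bar>)" if s: "s \<in> J" for s
  proof (rule field_le_epsilon)
    fix e :: real assume e: "e > 0"
    obtain r0 where r0: "r0 \<in> J" "\<And>r. r \<in> J \<Longrightarrow> r \<le> r0 \<Longrightarrow> \<bar>LINT z:(J \<inter> {..r})|lborel. k z\<bar> < e"
      using set_integral_lower_tendsto_0[OF J_open J_ne k e] by blast
    define r where "r = min r0 s"
    have r: "r \<in> J" "r \<le> s" "\<bar>W r\<bar> < e" using r0 s by (auto simp: r_def min_def W_def)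
    have "\<bar>\<Phi> r\<bar> \<le> exp (q s) * e"
      using r q_mono[OF r(1,2)] by (auto simp: \<Phi>_def abs_mult intro!: mult_mono)
    moreover have "\<bar>\<Phi> s - \<Phi> r\<bar> \<le> exp (q s) * (LINT z|lborel. indicator {r..s} z * \<bar>v' z\<bar>)"
      using abs_primitive_exp_increment_le[OF v \<Phi> r(1,2)] by (simp add: v'_def)
    moreover have "(LINT z|lborel. indicator {r..s} z * \<bar>v' z\<bar>) \<le> (LINT z|lborel. indicator {..s} z * \<bar>v' z\<bar>)"
      by (intro integral_mono int_ind) (auto simp: indicator_def)
    ultimately have "\<bar>\<Phi> s\<bar> \<le> exp (q s) * ((LINT z|lborel. indicator {..s} z * \<bar>v' z\<bar>) + e)"
      by (smt (verit) distrib_left exp_gt_zero mult_left_mono)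
    then show "\<bar>W s\<bar> \<le> (LINT z|lborel. indicator {..s} z * \<bar>v' z\<bar>) + e"
      by (simp add: \<Phi>_def abs_mult)
  qed
  \<comment> \<open>\<open>f\<close> agrees with \<open>W\<close> only a.e., and the exceptional set
    moves with the shift. Restricting to a sequence of times keeps the union of these sets
    null.\<close>
  have good: "AE s in lborel. \<forall>n. s - S n \<in> J \<longrightarrow> f (s - S n) = W (s - S n)" for S :: "nat \<Rightarrow> real"
    using AE_lborel_translate[OF fW] by (auto simp: AE_all_countable)
  have bound: "AE s in lborel. \<forall>n. s \<in> J \<longrightarrow>
       \<bar>T (S n) f s - f s\<bar> \<le> (LINT z|lborel. \<bar>v' z\<bar> * indicator {0..S n} (s - z))"
    if S: "\<And>n. S n > 0" for S :: "nat \<Rightarrow> real"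
    using fW good[of S]
  proof eventually_elim
    case (elim s)
    show ?case
    proof (intro allI impI)
      fix n assume s: "s \<in> J"
      have ind: "(\<lambda>z. \<bar>v' z\<bar> * indicator {0..S n} (s - z)) = (\<lambda>z. indicator {s - S n..s} z * \<bar>v' z\<bar>)"
        by (auto simp: indicator_def fun_eq_iff)
      show "\<bar>T (S n) f s - f s\<bar> \<le> (LINT z|lborel. \<bar>v' z\<bar> * indicator {0..S n} (s - z))"
      proof (cases "s - S n \<in> J")
        case True
        have "T (S n) f s - f s = exp (- q s) * (\<Phi> s - \<Phi> (s - S n))"
          using elim s True by (simp add: T_def \<Phi>_def field_simps exp_diff exp_minus)
        then have "\<bar>T (S n) f s - f s\<bar> = exp (- q s) * \<bar>\<Phi> s - \<Phi> (s - S n)\<bar>" by (simp add: abs_mult)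
        also have "\<dots> \<le> exp (- q s) * (exp (q s) * (LINT z|lborel. indicator {s - S n..s} z * \<bar>v' z\<bar>))"
          unfolding v'_def using S[of n] by (intro mult_left_mono abs_primitive_exp_increment_le[OF v \<Phi> True]) auto
        finally show ?thesis unfolding ind by (simp add: mult.assoc[symmetric] exp_minus)
      next
        case False
        \<comment> \<open>\<open>J\<close> has no point below \<open>s - S n\<close>, so the lower
          integral already is the integral over the window.\<close>
        then have "z \<notin> J" if "z < s - S n" for z using J_up[of z "s - S n"] that by auto
        then have "(\<lambda>z. indicator {..s} z * \<bar>v' z\<bar>) = (\<lambda>z. indicator {s - S n..s} z * \<bar>v' z\<bar>)"
          by (auto simp: indicator_def fun_eq_iff v'_def)
        with W_le[OF s] elim s False show ?thesis unfolding ind by (simp add: T_def)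
      qed
    qed
  qed
  have "((\<lambda>t. LINT s:J|lborel. \<bar>(T t f s - f s) / t - v s\<bar>) \<longlongrightarrow> 0) (at_right 0)"
  proof (rule tendsto_at_right_sequentially[of 0 1])
    fix S :: "nat \<Rightarrow> real" assume S: "\<And>n. 0 < S n" "S \<longlonglongrightarrow> 0"
    define F where "F n s = indicator J s * ((T (S n) f s - f' s) / S n)" for n s
    have [measurable]: "F n \<in> borel_measurable borel" for n unfolding F_def[abs_def] by measurable
    have "(\<lambda>n. \<integral>\<^sup>+ s. norm (F n s - v' s) \<partial>lborel) \<longlonglongrightarrow> 0"
    proof (rule Scheffe_lemma2[OF _ v'])
      show "AE s in lborel. (\<lambda>n. F n s) \<longlonglongrightarrow> v' s"
        using fW good[of S] AE_derivative_primitive[OF J_open \<Phi>]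
      proof eventually_elim
        case (elim s)
        show ?case
        proof (cases "s \<in> J")
          case True
          obtain d where d: "d > 0" "ball s d \<subseteq> J" using J_open True open_contains_ball by blast
          have ev: "\<forall>\<^sub>F n in sequentially. s - S n \<in> J"
            using order_tendstoD(2)[OF S(2) d(1)]
          proof eventually_elim
            case (elim n)
            then have "s - S n \<in> ball s d" using S(1)[of n] by (auto simp: dist_real_def)
            then show ?case using d by blast
          qed
          have "((\<lambda>h. (\<Phi> (s + h) - \<Phi> s) / h) \<longlongrightarrow> exp (q s) * v s) (at 0)"
            using elim(3)[rule_format, OF True] unfolding DERIV_def .
          moreover have "filterlim (\<lambda>n. - S n) (at 0) sequentially"
          proof (rule filterlim_atI)
            show "(\<lambda>n. - S n) \<longlonglongrightarrow> 0" using tendsto_minus[OF S(2)] by simp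
            show "\<forall>\<^sub>F n in sequentially. - S n \<noteq> 0"
              by (rule always_eventually) (use S(1) in \<open>auto simp: less_le\<close>)
          qed
          ultimately have "(\<lambda>n. (\<Phi> (s + - S n) - \<Phi> s) / (- S n)) \<longlonglongrightarrow> exp (q s) * v s"
            by (rule filterlim_compose)
          then have "(\<lambda>n. exp (- q s) * ((\<Phi> (s + - S n) - \<Phi> s) / (- S n))) \<longlonglongrightarrow> exp (- q s) * (exp (q s) * v s)"
            by (rule tendsto_mult_left)
          then have "(\<lambda>n. exp (- q s) * ((\<Phi> (s + - S n) - \<Phi> s) / (- S n))) \<longlonglongrightarrow> v s"
            by (simp only: mult.assoc[symmetric] exp_minus left_inverse[OF exp_not_eq_zero] mult_1)
          moreover have "\<forall>\<^sub>F n in sequentially. exp (- q s) * ((\<Phi> (s + - S n) - \<Phi> s) / (- S n)) = F n s"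
            using ev
          proof eventually_elim
            case (elim n)
            then have "f (s - S n) = W (s - S n)" "f s = W s"
              using \<open>\<forall>n. s - S n \<in> J \<longrightarrow> f (s - S n) = W (s - S n)\<close> \<open>s \<in> J \<longrightarrow> f s = W s\<close> True by auto
            then show ?case using S(1)[of n] True elim
              by (simp add: F_def f'_def T_def \<Phi>_def field_simps exp_diff exp_minus)
          qed
          ultimately have "(\<lambda>n. F n s) \<longlonglongrightarrow> v s" by (rule Lim_transform_eventually)
          then show ?thesis using True by (simp add: v'_def)
        qed (simp add: F_def v'_def)
      qed
      fix n
      have tn: "S n > 0" by (rule S)
      have "(\<integral>\<^sup>+ s. ennreal (norm (F n s)) \<partial>lborel) \<le>
         (\<integral>\<^sup>+ s. ennreal (1 / S n) * (\<integral>\<^sup>+ z. ennreal \<bar>v' z\<bar> * indicator {0..S n} (s - z) \<partial>lborel) \<partial>lborel)"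
      proof (rule nn_integral_mono_AE)
        show "AE s in lborel. ennreal (norm (F n s)) \<le> ennreal (1 / S n) * (\<integral>\<^sup>+ z. ennreal \<bar>v' z\<bar> * indicator {0..S n} (s - z) \<partial>lborel)"
          using bound[of S, OF S(1)]
        proof eventually_elim
          case (elim s)
          show ?case
          proof (cases "s \<in> J")
            case True
            have ind: "(\<lambda>z. \<bar>v' z\<bar> * indicator {0..S n} (s - z)) = (\<lambda>z. indicator {s - S n..s} z * \<bar>v' z\<bar>)"
              by (auto simp: indicator_def fun_eq_iff)
            have i: "integrable lborel (\<lambda>z. \<bar>v' z\<bar> * indicator {0..S n} (s - z))"
              unfolding ind by (rule int_ind) simp
            have "(\<integral>\<^sup>+ z. ennreal \<bar>v' z\<bar> * indicator {0..S n} (s - z) \<partial>lborel) = (\<integral>\<^sup>+ z. ennreal (\<bar>v' z\<bar> * indicator {0..S n} (s - z)) \<partial>lborel)"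
              by (rule nn_integral_cong) (auto simp: indicator_def)
            also have "\<dots> = ennreal (LINT z|lborel. \<bar>v' z\<bar> * indicator {0..S n} (s - z))"
              by (rule nn_integral_eq_integral[OF i]) (auto simp: indicator_def)
            finally have "ennreal (1 / S n) * (\<integral>\<^sup>+ z. ennreal \<bar>v' z\<bar> * indicator {0..S n} (s - z) \<partial>lborel)
              = ennreal (1 / S n * (LINT z|lborel. \<bar>v' z\<bar> * indicator {0..S n} (s - z)))"
              using tn by (simp add: ennreal_mult' flip: ennreal_mult)
            moreover have "norm (F n s) \<le> 1 / S n * (LINT z|lborel. \<bar>v' z\<bar> * indicator {0..S n} (s - z))"
              using elim True tn by (auto simp: F_def f'_def divide_right_mono abs_mult)
            ultimately show ?thesis by (simp add: ennreal_leI)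
          qed (simp add: F_def)
        qed
      qed
      also have "\<dots> = ennreal (1 / S n) * (\<integral>\<^sup>+ s. (\<integral>\<^sup>+ z. ennreal \<bar>v' z\<bar> * indicator {0..S n} (s - z) \<partial>lborel) \<partial>lborel)"
        by (rule nn_integral_cmult) measurable
      also have "\<dots> = ennreal (1 / S n) * (ennreal (S n) * (\<integral>\<^sup>+ z. ennreal \<bar>v' z\<bar> \<partial>lborel))"
        using tn by (subst nn_integral_indicator_convolution) auto
      also have "\<dots> = (\<integral>\<^sup>+ z. ennreal \<bar>v' z\<bar> \<partial>lborel)"
        using tn by (simp add: mult.assoc[symmetric] ennreal_mult'[symmetric])
      finally show "(\<integral>\<^sup>+ s. ennreal (norm (F n s)) \<partial>lborel) \<le> (\<integral>\<^sup>+ s. ennreal (norm (v' s)) \<partial>lborel)" by simp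
    qed simp
    then have "(\<lambda>n. enn2real (\<integral>\<^sup>+ s. norm (F n s - v' s) \<partial>lborel)) \<longlonglongrightarrow> 0"
      by (intro tendsto_enn2real) (simp_all add: ennreal_0)
    moreover have "enn2real (\<integral>\<^sup>+ s. norm (F n s - v' s) \<partial>lborel) = (LINT s:J|lborel. \<bar>(T (S n) f s - f s) / S n - v s\<bar>)" for n
    proof -
      have "(LINT s:J|lborel. \<bar>(T (S n) f s - f s) / S n - v s\<bar>) = (LINT s|lborel. norm (F n s - v' s))"
        unfolding set_lebesgue_integral_def
        by (rule Bochner_Integration.integral_cong) (auto simp: F_def v'_def f'_def indicator_def)
      also have "\<dots> = enn2real (\<integral>\<^sup>+ s. norm (F n s - v' s) \<partial>lborel)"
        by (rule integral_eq_nn_integral) auto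
      finally show ?thesis by simp
    qed
    ultimately show "(\<lambda>n. LINT s:J|lborel. \<bar>(T (S n) f s - f s) / S n - v s\<bar>) \<longlonglongrightarrow> 0" by (simp only:)
  qed simp
  moreover have "\<forall>\<^sub>F t in at_right 0. L1 J (T t f)"
    using eventually_at_right_less[of 0] by eventually_elim (simp add: T_L1[OF f])
  ultimately show ?thesis using f v by (simp add: generator_def L1_def)
qed

end

section \<open>Primitives given by interval integrals, and left difference quotients\<close>

lemma primitive_on_interval_integral:
  fixes b :: ereal and h :: "real \<Rightarrow> real"
  assumes "\<And>x y. x \<le> y \<Longrightarrow> {x..y} \<subseteq> E \<Longrightarrow>
      interval_lebesgue_integrable lborel (min b (ereal x)) (max b (ereal y)) h"
    and loc: "\<And>x y. x \<le> y \<Longrightarrow> {x..y} \<subseteq> E \<Longrightarrow> set_integrable lborel {x..y} h"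
  shows "primitive_on E (\<lambda>x. LBINT z=b..ereal x. h z) h"
  unfolding primitive_on_def
proof (intro allI impI, elim conjE, intro conjI)
  fix x y assume xy: "x \<le> y" "{x..y} \<subseteq> E"
  show "set_integrable lborel {x..y} h" using loc xy by blast
  have "(LBINT z=b..ereal x. h z) + (LBINT z=ereal x..ereal y. h z) = (LBINT z=b..ereal y. h z)"
    using assms(1)[OF xy] xy by (intro interval_integral_sum) (simp add: min_def max_def)
  then show "(LBINT z=b..ereal y. h z) - (LBINT z=b..ereal x. h z) = (LINT z:{x..y}|lborel. h z)"
    using xy by (simp add: interval_integral_Icc)
qed

lemma primitive_on_exists:
  fixes h :: "real \<Rightarrow> real"
  assumes loc: "\<And>x y. x \<le> y \<Longrightarrow> {x..y} \<subseteq> E \<Longrightarrow> set_integrable lborel {x..y} h"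
    and cv: "\<And>x y. x \<in> E \<Longrightarrow> y \<in> E \<Longrightarrow> {x..y} \<subseteq> E" and c: "c \<in> E"
  shows "primitive_on E (\<lambda>x. LBINT z=ereal c..ereal x. h z) h"
proof (rule primitive_on_interval_integral[OF _ loc])
  fix x y :: real assume xy: "x \<le> y" "{x..y} \<subseteq> E"
  have "{min c x..max c y} \<subseteq> E" using xy c by (intro cv) (auto simp: min_def max_def)
  then have "set_integrable lborel {min c x..max c y} h" using xy by (intro loc) auto
  then have "set_integrable lborel {min c x<..<max c y} h" by (rule set_integrable_subset) auto
  moreover have "einterval (min (ereal c) (ereal x)) (max (ereal c) (ereal y)) = {min c x<..<max c y}"
    by (auto simp: einterval_def min_def max_def)
  moreover have "min (ereal c) (ereal x) \<le> max (ereal c) (ereal y)" by (simp add: min_le_iff_disj)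
  ultimately show "interval_lebesgue_integrable lborel (min (ereal c) (ereal x)) (max (ereal c) (ereal y)) h"
    by (simp add: interval_lebesgue_integrable_def)
qed

lemma DERIV_imp_left_quotient:
  fixes \<Phi> :: "real \<Rightarrow> real"
  assumes "(\<Phi> has_real_derivative D) (at s)"
  shows "((\<lambda>t. (\<Phi> (s - t) - \<Phi> s) / t) \<longlongrightarrow> - D) (at_right 0)"
proof -
  have "((\<lambda>h. (\<Phi> (s + h) - \<Phi> s) / h) \<longlongrightarrow> D) (at 0)" using assms unfolding DERIV_def .
  moreover have "filterlim (\<lambda>t::real. - t) (at 0) (at_right 0)"
  proof (rule filterlim_atI)
    show "((\<lambda>t::real. - t) \<longlongrightarrow> 0) (at_right 0)" by (auto intro!: tendsto_eq_intros)
    show "\<forall>\<^sub>F t::real in at_right 0. - t \<noteq> 0" using eventually_at_right_less[of 0] by eventually_elim auto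
  qed
  ultimately have "((\<lambda>t. (\<Phi> (s + - t) - \<Phi> s) / - t) \<longlongrightarrow> D) (at_right 0)" by (rule filterlim_compose)
  from tendsto_minus[OF this] show ?thesis by simp
qed

section \<open>From the generator to the integral equation\<close>

context killed_translation
begin

text \<open>Rewrites the quantity in the definition of the generator as an integral over the whole
  line of cut-off functions, the form in which it is compared with other integrals below.\<close>

lemma generator_defect_integral:
  assumes f: "set_integrable lborel J f" and v: "set_integrable lborel J v" and t: "t > 0"
  shows "integrable lborel (\<lambda>s. (T t f s - indicator J s * f s) / t - indicator J s * v s)"
    and "(LINT s:J|lborel. \<bar>(T t f s - f s) / t - v s\<bar>) =
      (LINT s|lborel. \<bar>(T t f s - indicator J s * f s) / t - indicator J s * v s\<bar>)"
proof -
  show "integrable lborel (\<lambda>s. (T t f s - indicator J s * f s) / t - indicator J s * v s)"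
    using f v T_integrable[OF f, of t] t by (auto simp: integrable_indicator_J)
  show "(LINT s:J|lborel. \<bar>(T t f s - f s) / t - v s\<bar>) =
      (LINT s|lborel. \<bar>(T t f s - indicator J s * f s) / t - indicator J s * v s\<bar>)"
    unfolding set_lebesgue_integral_def
    by (rule Bochner_Integration.integral_cong) (auto simp: indicator_def T_def)
qed

text \<open>The mass lost by \<open>\<bar>f\<bar>\<close> up to time \<open>t\<close> is at most the \<open>L\<^sup>1\<close> distance of \<open>f\<close> and
  \<open>T t f\<close>; dividing by \<open>t\<close> and applying Fatou's lemma bounds \<open>\<psi> f\<close> in \<open>L\<^sup>1\<close>.\<close>

lemma generator_imp_integrable_killing:
  assumes gen: "generator J T f v"
  shows "set_integrable lborel J (\<lambda>s. \<psi> s * f s)"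
proof -
  have f: "set_integrable lborel J f" and v: "set_integrable lborel J v"
    and lim: "((\<lambda>t. LINT s:J|lborel. \<bar>(T t f s - f s) / t - v s\<bar>) \<longlongrightarrow> 0) (at_right 0)"
    using gen by (auto simp: generator_def L1_def)
  define v' where "v' z = indicator J z * v z" for z
  have v': "integrable lborel v'" using v by (simp add: integrable_indicator_J v'_def[abs_def])
  define f' where "f' z = indicator J z * f z" for z
  have f': "integrable lborel f'" using f by (simp add: integrable_indicator_J f'_def[abs_def])
  have [measurable]: "f' \<in> borel_measurable borel" using borel_measurable_integrable[OF f'] by simp
  define q' where "q' z = indicator J z * q z" for z
  have [measurable]: "q' \<in> borel_measurable borel" using q_measurable by (simp add: q'_def[abs_def])
  define \<psi>' where "\<psi>' z = indicator J z * \<psi> z" for z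
  have [measurable]: "\<psi>' \<in> borel_measurable borel" using \<psi>_meas by (simp add: \<psi>'_def[abs_def])
  define I where "I t = (LINT s:J|lborel. \<bar>(T t f s - f s) / t - v s\<bar>)" for t
  \<comment> \<open>The fraction of \<open>\<bar>f\<bar>\<close> killed within time
    \<open>t\<close>, per unit of time, recorded at the starting point \<open>s\<close> instead of
    the arrival point \<open>s + t\<close>. Recorded this way it is nonnegative and tends to
    \<open>\<bar>f s\<bar> * \<psi> s\<close> at almost every \<open>s\<close> in
    \<open>J\<close>.\<close>
  define D where "D t s = \<bar>f' s\<bar> * ((1 - exp (q' s - q' (s + t))) / t)" for t s
  have D_nonneg: "0 \<le> D t s" and D_le: "D t s \<le> \<bar>f' s\<bar> / t" if "t > 0" for t s
  proof -
    have "s \<in> J \<Longrightarrow> q' s \<le> q' (s + t)" using q_mono[of s "s + t"] J_up[of s "s + t"] that by (auto simp: q'_def)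
    then have *: "f' s \<noteq> 0 \<Longrightarrow> exp (q' s - q' (s + t)) \<le> 1" by (auto simp: f'_def indicator_def split: if_splits)
    show "0 \<le> D t s" using * that by (cases "f' s = 0") (auto simp: D_def)
    have "(1 - exp (q' s - q' (s + t))) / t \<le> 1 / t" using that by (simp add: divide_right_mono)
    from mult_left_mono[OF this, of "\<bar>f' s\<bar>"] show "D t s \<le> \<bar>f' s\<bar> / t" by (simp add: D_def)
  qed
  have [measurable]: "D t \<in> borel_measurable borel" for t unfolding D_def[abs_def] by measurable
  have D_int: "integrable lborel (D t)" if "t > 0" for t
  proof (rule Bochner_Integration.integrable_bound)
    show "integrable lborel (\<lambda>s. \<bar>f' s\<bar> / t)" using f' by (intro integrable_divide integrable_abs)
    show "AE s in lborel. norm (D t s) \<le> norm (\<bar>f' s\<bar> / t)"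
      using D_nonneg[OF that] D_le[OF that] that by (auto intro!: AE_I2)
  qed simp
  \<comment> \<open>By translation invariance the left side equals the difference of the norms of
    \<open>f\<close> and \<open>T t f\<close> divided by \<open>t\<close>: starting points in
    \<open>J\<close> have arrival points in \<open>J\<close>. The reverse triangle inequality then
    brings in the difference quotient and its limit \<open>v\<close>.\<close>
  have D_bound: "(LINT s|lborel. D t s) \<le> I t + (LINT s|lborel. \<bar>v' s\<bar>)" if t: "t > 0" for t
  proof -
    have Ti: "integrable lborel (T t f)" by (rule T_integrable[OF f]) (use t in simp)
    have Tt: "\<bar>T t f (s - (- t))\<bar> = \<bar>f' s\<bar> * exp (q' s - q' (s + t))" for s
      using J_up[of s "s + t"] t by (auto simp: T_def f'_def q'_def indicator_def abs_mult)
    have "integrable lborel (\<lambda>s. \<bar>T t f (s - (- t))\<bar>)" using Ti by (intro integrable_abs integrable_translate)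
    then have Tt_int: "integrable lborel (\<lambda>s. \<bar>f' s\<bar> * exp (q' s - q' (s + t)))" unfolding Tt .
    have "(LINT s|lborel. D t s) = (LINT s|lborel. (\<bar>f' s\<bar> - \<bar>f' s\<bar> * exp (q' s - q' (s + t))) / t)"
      by (rule Bochner_Integration.integral_cong) (auto simp: D_def field_simps)
    also have "\<dots> = ((LINT s|lborel. \<bar>f' s\<bar>) - (LINT s|lborel. \<bar>f' s\<bar> * exp (q' s - q' (s + t)))) / t"
      using f' Tt_int by simp
    also have "(LINT s|lborel. \<bar>f' s\<bar> * exp (q' s - q' (s + t))) = (LINT s|lborel. \<bar>T t f s\<bar>)"
      unfolding Tt[symmetric] by (rule integral_translate[of "\<lambda>s. \<bar>T t f s\<bar>"])
    also have "((LINT s|lborel. \<bar>f' s\<bar>) - (LINT s|lborel. \<bar>T t f s\<bar>)) / t = (LINT s|lborel. (\<bar>f' s\<bar> - \<bar>T t f s\<bar>) / t)"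
      using f' Ti by simp
    also have "\<dots> \<le> (LINT s|lborel. \<bar>(T t f s - f' s) / t - v' s\<bar> + \<bar>v' s\<bar>)"
    proof (rule integral_mono)
      show "integrable lborel (\<lambda>s. (\<bar>f' s\<bar> - \<bar>T t f s\<bar>) / t)" using f' Ti by simp
      show "integrable lborel (\<lambda>s. \<bar>(T t f s - f' s) / t - v' s\<bar> + \<bar>v' s\<bar>)" using f' v' Ti by simp
      fix s
      have "(\<bar>f' s\<bar> - \<bar>T t f s\<bar>) / t \<le> \<bar>T t f s - f' s\<bar> / t" using t by (intro divide_right_mono) auto
      also have "\<dots> = \<bar>(T t f s - f' s) / t\<bar>" using t by simp
      also have "\<dots> \<le> \<bar>(T t f s - f' s) / t - v' s\<bar> + \<bar>v' s\<bar>" by linarith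
      finally show "(\<bar>f' s\<bar> - \<bar>T t f s\<bar>) / t \<le> \<bar>(T t f s - f' s) / t - v' s\<bar> + \<bar>v' s\<bar>" .
    qed
    also have "\<dots> = (LINT s|lborel. \<bar>(T t f s - f' s) / t - v' s\<bar>) + (LINT s|lborel. \<bar>v' s\<bar>)"
      using f' v' Ti by simp
    also have "(LINT s|lborel. \<bar>(T t f s - f' s) / t - v' s\<bar>) = I t"
      unfolding I_def f'_def v'_def by (rule generator_defect_integral(2)[OF f v t, symmetric])
    finally show ?thesis .
  qed
  define S where "S n = inverse (real (Suc n))" for n
  have S: "S n > 0" "S \<longlonglongrightarrow> 0" for n
    unfolding S_def[abs_def] using LIMSEQ_inverse_real_of_nat by auto
  have S_right: "filterlim S (at_right 0) sequentially"
    by (rule tendsto_imp_filterlim_at_right[OF S(2)]) (rule always_eventually, use S(1) in simp)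
  have "(\<integral>\<^sup>+s. ennreal (\<bar>f' s\<bar> * \<psi>' s) \<partial>lborel) = (\<integral>\<^sup>+s. liminf (\<lambda>n. ennreal (D (S n) s)) \<partial>lborel)"
  proof (rule nn_integral_cong_AE)
    show "AE s in lborel. ennreal (\<bar>f' s\<bar> * \<psi>' s) = liminf (\<lambda>n. ennreal (D (S n) s))"
      using AE_derivative_primitive[OF J_open q]
    proof eventually_elim
      case (elim s)
      have "(\<lambda>n. D (S n) s) \<longlonglongrightarrow> \<bar>f' s\<bar> * \<psi>' s"
      proof (cases "s \<in> J")
        case True
        have "((\<lambda>x. exp (q s - q x)) has_real_derivative - \<psi> s) (at s)"
          using elim True by (auto intro!: derivative_eq_intros)
        then have "((\<lambda>h. (exp (q s - q (s + h)) - exp (q s - q s)) / h) \<longlongrightarrow> - \<psi> s) (at 0)"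
          unfolding DERIV_def .
        moreover have "filterlim S (at 0) sequentially"
          using S_right by (rule filterlim_mono) (simp_all add: at_le)
        ultimately have "(\<lambda>n. (exp (q s - q (s + S n)) - exp (q s - q s)) / S n) \<longlonglongrightarrow> - \<psi> s"
          by (rule filterlim_compose)
        then have "(\<lambda>n. - \<bar>f' s\<bar> * ((exp (q s - q (s + S n)) - exp (q s - q s)) / S n)) \<longlonglongrightarrow> - \<bar>f' s\<bar> * - \<psi> s"
          by (rule tendsto_mult_left)
        moreover have "- \<bar>f' s\<bar> * ((exp (q s - q (s + S n)) - exp (q s - q s)) / S n) = D (S n) s" for n
          using J_up[OF True, of "s + S n"] S(1)[of n] True by (simp add: D_def q'_def field_simps)
        ultimately show ?thesis using True by (simp add: \<psi>'_def)
      qed (simp add: D_def f'_def)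
      then have "(\<lambda>n. ennreal (D (S n) s)) \<longlonglongrightarrow> ennreal (\<bar>f' s\<bar> * \<psi>' s)" by (rule tendsto_ennrealI)
      then show ?case by (simp add: lim_imp_Liminf)
    qed
  qed
  also have "\<dots> \<le> liminf (\<lambda>n. \<integral>\<^sup>+s. ennreal (D (S n) s) \<partial>lborel)"
    by (rule nn_integral_liminf) simp
  \<comment> \<open>The 1 is an arbitrary bound for the defect \<open>I\<close>, which tends to
    0.\<close>
  also have "\<dots> \<le> liminf (\<lambda>n. ennreal (1 + (LINT s|lborel. \<bar>v' s\<bar>)))"
  proof (rule Liminf_mono)
    have "(\<lambda>n. I (S n)) \<longlonglongrightarrow> 0"
      using filterlim_compose[OF lim S_right] by (simp add: I_def)
    then have "\<forall>\<^sub>F n in sequentially. I (S n) < 1" by (rule order_tendstoD) simp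
    then show "\<forall>\<^sub>F n in sequentially. (\<integral>\<^sup>+s. ennreal (D (S n) s) \<partial>lborel) \<le> ennreal (1 + (LINT s|lborel. \<bar>v' s\<bar>))"
    proof eventually_elim
      case (elim n)
      have "(\<integral>\<^sup>+s. ennreal (D (S n) s) \<partial>lborel) = ennreal (LINT s|lborel. D (S n) s)"
        by (rule nn_integral_eq_integral[OF D_int[OF S(1)]]) (use D_nonneg[OF S(1)] in auto)
      also have "\<dots> \<le> ennreal (1 + (LINT s|lborel. \<bar>v' s\<bar>))"
        using D_bound[OF S(1), of n] elim by (intro ennreal_leI) linarith
      finally show ?case .
    qed
  qed
  also have "\<dots> = ennreal (1 + (LINT s|lborel. \<bar>v' s\<bar>))" by (simp add: Liminf_const)
  finally have fin: "(\<integral>\<^sup>+s. ennreal (\<bar>f' s\<bar> * \<psi>' s) \<partial>lborel) \<le> ennreal (1 + (LINT s|lborel. \<bar>v' s\<bar>))" .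
  have "integrable lborel (\<lambda>s. \<psi>' s * f' s)"
  proof (rule integrableI_bounded)
    have "norm (\<psi>' s * f' s) = \<bar>f' s\<bar> * \<psi>' s" for s
      using \<psi>_nonneg[of s] by (auto simp: \<psi>'_def indicator_def abs_mult)
    then have "(\<integral>\<^sup>+s. ennreal (norm (\<psi>' s * f' s)) \<partial>lborel) = (\<integral>\<^sup>+s. ennreal (\<bar>f' s\<bar> * \<psi>' s) \<partial>lborel)" by simp
    also have "\<dots> < \<infinity>" using fin by (simp add: le_less_trans ennreal_less_top)
    finally show "(\<integral>\<^sup>+s. ennreal (norm (\<psi>' s * f' s)) \<partial>lborel) < \<infinity>" .
  qed simp
  also have "(\<lambda>s. \<psi>' s * f' s) = (\<lambda>s. indicator J s * (\<psi> s * f s))"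
    by (auto simp: \<psi>'_def f'_def indicator_def)
  finally show ?thesis by (simp add: integrable_indicator_J)
qed

text \<open>The difference quotient, weighted by \<open>exp q\<close> and integrated over
  \<open>{r..s}\<close>, has its limit computed twice. Convergence in \<open>L1\<close> gives the
  right side, since the weight is at most \<open>exp (q s)\<close>. On the other hand the weight
  turns \<open>T t\<close> into pure translation, so the integral telescopes into left difference
  quotients of \<Phi> at \<open>s\<close> and at \<open>r\<close>, which converge by the two
  differentiability premises.\<close>

lemma generator_imp_increment:
  assumes gen: "generator J T f v"
    and \<Phi>: "primitive_on J \<Phi> (\<lambda>s. exp (q s) * f s)"
    and r: "r \<in> J" "r \<le> s"
    and dr: "(\<Phi> has_real_derivative exp (q r) * f r) (at r)"
    and ds: "(\<Phi> has_real_derivative exp (q s) * f s) (at s)"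
  shows "exp (q r) * f r - exp (q s) * f s = (LINT z:{r..s}|lborel. exp (q z) * v z)"
proof -
  have f: "set_integrable lborel J f" and v: "set_integrable lborel J v"
    and lim: "((\<lambda>t. LINT s:J|lborel. \<bar>(T t f s - f s) / t - v s\<bar>) \<longlongrightarrow> 0) (at_right 0)"
    using gen by (auto simp: generator_def L1_def)
  define I where "I t = (LINT s:J|lborel. \<bar>(T t f s - f s) / t - v s\<bar>)" for t
  define X where "X t = (LINT z:{r..s}|lborel. exp (q z) * ((T t f z - f z) / t))" for t
  have rJ: "{r..s} \<subseteq> J" by (rule J_convex[OF r(1)])
  have TL1: "set_integrable lborel J (T t f)" if "t > 0" for t using T_L1[OF f, of t] that by (simp add: L1_def)
  have quo: "set_integrable lborel J (\<lambda>z. (T t f z - f z) / t)" if "t > 0" for t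
    using set_integral_diff(1)[OF TL1[OF that] f] by (rule set_integrable_divide)
  have "((\<lambda>t. X t - (LINT z:{r..s}|lborel. exp (q z) * v z)) \<longlongrightarrow> 0) (at_right 0)"
  proof (rule Lim_null_comparison)
    show "((\<lambda>t. exp (q s) * I t) \<longlongrightarrow> 0) (at_right 0)"
      using tendsto_mult_right_zero[OF lim] unfolding I_def .
    show "\<forall>\<^sub>F t in at_right 0. norm (X t - (LINT z:{r..s}|lborel. exp (q z) * v z)) \<le> exp (q s) * I t"
      using eventually_at_right_less[of 0]
    proof eventually_elim
      case (elim t)
      have X_eq: "X t - (LINT z:{r..s}|lborel. exp (q z) * v z) =
          (LINT z:{r..s}|lborel. exp (q z) * ((T t f z - f z) / t) - exp (q z) * v z)"
        unfolding X_def
        by (rule set_integral_diff(2)[symmetric]) (rule set_integrable_exp_q[OF _ r(1)], fact quo[OF elim] v)+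
      have "norm (X t - (LINT z:{r..s}|lborel. exp (q z) * v z)) \<le>
          (LINT z|lborel. \<bar>indicator {r..s} z * (exp (q z) * ((T t f z - f z) / t) - exp (q z) * v z)\<bar>)"
        unfolding X_eq unfolding set_lebesgue_integral_def real_norm_def real_scaleR_def
        by (rule integral_abs_bound)
      also have "\<dots> \<le> (LINT z|lborel. exp (q s) * \<bar>(T t f z - indicator J z * f z) / t - indicator J z * v z\<bar>)"
      proof (rule integral_mono')
        have "integrable lborel (\<lambda>z. \<bar>(T t f z - indicator J z * f z) / t - indicator J z * v z\<bar>)"
          using generator_defect_integral(1)[OF f v elim] by (rule integrable_abs)
        then show "integrable lborel (\<lambda>z. exp (q s) * \<bar>(T t f z - indicator J z * f z) / t - indicator J z * v z\<bar>)"
          by (intro integrable_mult_right)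
      next
        fix z
        show "\<bar>indicator {r..s} z * (exp (q z) * ((T t f z - f z) / t) - exp (q z) * v z)\<bar>
          \<le> exp (q s) * \<bar>(T t f z - indicator J z * f z) / t - indicator J z * v z\<bar>"
        proof (cases "z \<in> {r..s}")
          case True
          then have z: "z \<in> J" "q z \<le> q s" using rJ q_mono[of z s] by auto
          have "\<bar>exp (q z) * ((T t f z - f z) / t) - exp (q z) * v z\<bar> = exp (q z) * \<bar>(T t f z - f z) / t - v z\<bar>"
            by (simp only: right_diff_distrib[symmetric] abs_mult abs_exp_cancel)
          also have "\<dots> \<le> exp (q s) * \<bar>(T t f z - f z) / t - v z\<bar>" using z by (intro mult_right_mono) auto
          finally show ?thesis using True z by simp
        qed simp
      qed simp
      also have "\<dots> = exp (q s) * I t"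
        unfolding I_def generator_defect_integral(2)[OF f v elim] by simp
      finally show ?case .
    qed
  qed
  then have A: "(X \<longlongrightarrow> (LINT z:{r..s}|lborel. exp (q z) * v z)) (at_right 0)" by (rule LIM_zero_cancel)
  have "((\<lambda>t. (\<Phi> (s - t) - \<Phi> s) / t - (\<Phi> (r - t) - \<Phi> r) / t) \<longlongrightarrow> - (exp (q s) * f s) - - (exp (q r) * f r)) (at_right 0)"
    by (intro tendsto_diff DERIV_imp_left_quotient dr ds)
  moreover have "\<forall>\<^sub>F t in at_right 0. (\<Phi> (s - t) - \<Phi> s) / t - (\<Phi> (r - t) - \<Phi> r) / t = X t"
  proof -
    \<comment> \<open>For \<open>t < d\<close> the shifted interval stays inside \<open>J\<close>,
      so the cut-off in \<open>T\<close> never acts on \<open>{r..s}\<close>.\<close>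
    obtain d where d: "d > 0" "ball r d \<subseteq> J" using J_open r(1) open_contains_ball by blast
    have "\<forall>\<^sub>F t in at_right 0. t < d" using eventually_at_right_real[OF d(1)] by eventually_elim auto
    then show ?thesis
      using eventually_at_right_less[of 0]
    proof eventually_elim
      case (elim t)
      then have "r - t \<in> ball r d" by (auto simp: dist_real_def)
      then have rt: "r - t \<in> J" using d by blast
      have F1: "set_integrable lborel {r..s} (\<lambda>z. exp (q z) * f z)"
        by (rule set_integrable_exp_q[OF f r(1)])
      have F2: "set_integrable lborel {r - t..s - t} (\<lambda>z. exp (q z) * f z)"
        by (rule set_integrable_exp_q[OF f rt])
      have ind: "(\<lambda>z. indicator {r..s} z *\<^sub>R (exp (q (z - t)) * f (z - t))) =
          (\<lambda>z. indicator {r - t..s - t} (z - t) *\<^sub>R (exp (q (z - t)) * f (z - t)))"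
        by (auto simp: indicator_def fun_eq_iff)
      have F3: "set_integrable lborel {r..s} (\<lambda>z. exp (q (z - t)) * f (z - t))"
        using integrable_translate[OF F2[unfolded set_integrable_def], of t]
        unfolding set_integrable_def ind .
      have F3': "(LINT z:{r..s}|lborel. exp (q (z - t)) * f (z - t)) = (LINT z:{r - t..s - t}|lborel. exp (q z) * f z)"
        unfolding set_lebesgue_integral_def ind
        by (rule integral_translate[of "\<lambda>z. indicator {r - t..s - t} z *\<^sub>R (exp (q z) * f z)"])
      have "X t = (LINT z:{r..s}|lborel. (exp (q (z - t)) * f (z - t) - exp (q z) * f z) / t)"
        unfolding X_def set_lebesgue_integral_def
      proof (rule Bochner_Integration.integral_cong[OF refl])
        fix z
        have "exp (q z) * T t f z = exp (q (z - t)) * f (z - t)" if "z \<in> {r..s}"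
          using that rJ J_up[OF rt, of "z - t"] by (auto simp: T_def exp_diff)
        then show "indicator {r..s} z *\<^sub>R (exp (q z) * ((T t f z - f z) / t)) =
          indicator {r..s} z *\<^sub>R ((exp (q (z - t)) * f (z - t) - exp (q z) * f z) / t)"
          by (auto simp: indicator_def right_diff_distrib)
      qed
      also have "\<dots> = ((LINT z:{r..s}|lborel. exp (q (z - t)) * f (z - t)) - (LINT z:{r..s}|lborel. exp (q z) * f z)) / t"
        using set_integral_diff(2)[OF F3 F1] by simp
      also have "\<dots> = ((\<Phi> (s - t) - \<Phi> (r - t)) - (\<Phi> s - \<Phi> r)) / t"
        unfolding F3' using primitive_onD(2)[OF \<Phi> _ J_convex[OF rt], of "s - t"] primitive_onD(2)[OF \<Phi> r(2) rJ] r by simp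
      finally show ?case by (simp add: diff_divide_distrib)
    qed
  qed
  ultimately have "(X \<longlongrightarrow> - (exp (q s) * f s) - - (exp (q r) * f r)) (at_right 0)"
    by (rule Lim_transform_eventually)
  from tendsto_unique[OF _ A this] show ?thesis by simp
qed

text \<open>At almost all points \<open>exp q * f + V\<close> takes one constant value
  \<open>C\<close>, where \<open>V\<close> is a primitive of \<open>exp q * v\<close>. Multiplying
  \<open>C - V\<close> by \<open>exp (- q)\<close> brings \<psi> back through the product rule and
  shows that \<open>f\<close> has a primitive of \<open>- (v + \<psi> f)\<close> as representative.
  The additive constant \<open>L\<close> is still free.\<close>

lemma generator_imp_affine_integral_equation:
  assumes gen: "generator J T f v"
  shows "\<exists>L. AE s in lborel. s \<in> J \<longrightarrow> f s = L - (LINT r:(J \<inter> {..s})|lborel. v r + \<psi> r * f r)"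
proof -
  have f: "set_integrable lborel J f" and v: "set_integrable lborel J v"
    using gen by (auto simp: generator_def L1_def)
  define k where "k s = v s + \<psi> s * f s" for s
  have k: "set_integrable lborel J k"
    unfolding k_def[abs_def] using v generator_imp_integrable_killing[OF gen] by (rule set_integral_add(1))
  obtain c where c: "c \<in> J" using J_ne by blast
  have loc: "set_integrable lborel {x..y} (\<lambda>s. exp (q s) * h s)" if "set_integrable lborel J h" "x \<le> y" "{x..y} \<subseteq> J" for x y h
    using that by (intro set_integrable_exp_q) auto
  define \<Phi> where "\<Phi> x = (LBINT z=ereal c..ereal x. exp (q z) * f z)" for x
  have \<Phi>: "primitive_on J \<Phi> (\<lambda>s. exp (q s) * f s)"
    unfolding \<Phi>_def[abs_def] by (rule primitive_on_exists[OF loc[OF f] J_convex c])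
  define V where "V x = (LBINT z=ereal c..ereal x. exp (q z) * v z)" for x
  have V: "primitive_on J V (\<lambda>s. exp (q s) * v s)"
    unfolding V_def[abs_def] by (rule primitive_on_exists[OF loc[OF v] J_convex c])
  define good where "good s \<longleftrightarrow> (\<Phi> has_real_derivative exp (q s) * f s) (at s)" for s
  have AE_good: "AE s in lborel. s \<in> J \<longrightarrow> good s"
    unfolding good_def by (rule AE_derivative_primitive[OF J_open \<Phi>])
  \<comment> \<open>A reference point for the constant exists because a nonempty open set is not
    negligible.\<close>
  have "\<exists>r\<in>J. good r"
  proof (rule ccontr)
    assume "\<not> (\<exists>r\<in>J. good r)"
    then have "J \<subseteq> {s. \<not> (s \<in> J \<longrightarrow> good s)}" by auto
    then have "negligible J" using AE_lborel_imp_negligible[OF AE_good] negligible_subset by blast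
    then show False using open_not_negligible[OF J_open J_ne] by blast
  qed
  then obtain r where r: "r \<in> J" "good r" by blast
  define C where "C = exp (q r) * f r + V r"
  have inc: "exp (q x) * f x + V x = exp (q y) * f y + V y" if "x \<in> J" "x \<le> y" "good x" "good y" for x y
    using generator_imp_increment[OF gen \<Phi> that(1,2)] primitive_onD(2)[OF V that(2) J_convex[OF that(1)]] that(3,4)
    by (simp add: good_def)
  have FC: "exp (q s) * f s = C - V s" if "s \<in> J" "good s" for s
  proof (cases "r \<le> s")
    case True then show ?thesis using inc[OF r(1) True r(2) that(2)] by (simp add: C_def)
  next
    case False then show ?thesis using inc[OF that(1) _ that(2) r(2)] by (simp add: C_def)
  qed
  define w where "w s = exp (- q s) * (C + - V s)" for s
  have fw: "AE s in lborel. s \<in> J \<longrightarrow> f s = w s"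
    using AE_good
  proof eventually_elim
    case (elim s)
    show ?case
    proof
      assume "s \<in> J"
      then have "exp (q s) * f s = C + - V s" using FC elim by simp
      then have "w s = exp (- q s) * (exp (q s) * f s)" by (simp only: w_def)
      then show "f s = w s" by (simp add: mult.assoc[symmetric] exp_minus)
    qed
  qed
  have "primitive_on J w (\<lambda>s. - k s)"
    unfolding w_def[abs_def]
  proof (rule primitive_on_cong_AE[OF primitive_on_mult[OF J_open primitive_on_exp[OF J_open primitive_on_uminus[OF q]]
          primitive_on_add_const[OF primitive_on_uminus[OF V]]]])
    show "AE s in lborel. s \<in> J \<longrightarrow> exp (- q s) * - (exp (q s) * v s) + (C + - V s) * (exp (- q s) * - \<psi> s) = - k s"
      using fw
    proof eventually_elim
      case (elim s)
      have "exp (- q s) * - (exp (q s) * v s) + (C + - V s) * (exp (- q s) * - \<psi> s) =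
          - (exp (- q s) * (exp (q s) * v s)) - \<psi> s * w s"
        by (simp add: w_def algebra_simps)
      also have "exp (- q s) * (exp (q s) * v s) = v s" by (simp add: mult.assoc[symmetric] exp_minus)
      finally show ?case using elim by (auto simp: k_def)
    qed
    show "set_integrable lborel {a..b} (\<lambda>s. - k s)" if "a \<le> b" "{a..b} \<subseteq> J" for a b
      using that by (intro set_integrable_uminus set_integrable_sub[OF k]) auto
  qed
  moreover have "primitive_on J (\<lambda>s. - (LINT r:(J \<inter> {..s})|lborel. k r)) (\<lambda>s. - k s)"
    by (intro primitive_on_uminus set_integral_lower_primitive J_borel k)
  ultimately have "w s - - (LINT r:(J \<inter> {..s})|lborel. k r) = w c - - (LINT r:(J \<inter> {..c})|lborel. k r)" if "s \<in> J" for s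
    using that c J_convex by (intro primitive_on_diff_const)
  then have "AE s in lborel. s \<in> J \<longrightarrow> f s = (w c + (LINT r:(J \<inter> {..c})|lborel. k r)) - (LINT r:(J \<inter> {..s})|lborel. k r)"
    using fw by (auto simp: algebra_simps)
  then show ?thesis unfolding k_def by blast
qed

text \<open>\<open>L\<close> is the limit at the left end of \<open>J\<close> of the continuous
  representative of \<open>f\<close>. If it were nonzero, \<open>\<bar>f\<bar>\<close> would stay
  above a positive bound near that end: too much mass on an infinite half-line, and at a finite end
  a difference quotient whose mass near the end does not become small with \<open>t\<close>.\<close>

lemma generator_imp_integral_equation:
  assumes gen: "generator J T f v"
  shows "AE s in lborel. s \<in> J \<longrightarrow> f s = - (LINT r:(J \<inter> {..s})|lborel. v r + \<psi> r * f r)"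
proof -
  have f: "set_integrable lborel J f" and v: "set_integrable lborel J v"
    and lim: "((\<lambda>t. LINT s:J|lborel. \<bar>(T t f s - f s) / t - v s\<bar>) \<longlongrightarrow> 0) (at_right 0)"
    using gen by (auto simp: generator_def L1_def)
  define k where "k s = v s + \<psi> s * f s" for s
  have k: "set_integrable lborel J k"
    unfolding k_def[abs_def] using v generator_imp_integrable_killing[OF gen] by (rule set_integral_add(1))
  obtain L where L: "AE s in lborel. s \<in> J \<longrightarrow> f s = L - (LINT r:(J \<inter> {..s})|lborel. k r)"
    using generator_imp_affine_integral_equation[OF gen] unfolding k_def by blast
  define f' where "f' z = indicator J z * f z" for z
  have f': "integrable lborel f'" using f by (simp add: integrable_indicator_J f'_def[abs_def])
  have [measurable]: "f' \<in> borel_measurable borel" using borel_measurable_integrable[OF f'] by simp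
  define v' where "v' z = indicator J z * v z" for z
  have v': "integrable lborel v'" using v by (simp add: integrable_indicator_J v'_def[abs_def])
  have "L = 0"
  proof (rule ccontr)
    assume "L \<noteq> 0"
    \<comment> \<open>Half of \<open>\<bar>L\<bar>\<close>: where the lower integral is below
      \<open>l\<close>, the function \<open>f\<close> keeps at least the other half.\<close>
    define l where "l = \<bar>L\<bar> / 2"
    have l: "l > 0" using \<open>L \<noteq> 0\<close> by (simp add: l_def)
    obtain y where y: "y \<in> J" "\<And>s. s \<in> J \<Longrightarrow> s \<le> y \<Longrightarrow> \<bar>LINT r:(J \<inter> {..s})|lborel. k r\<bar> < l"
      using set_integral_lower_tendsto_0[OF J_open J_ne k l] by blast
    have big: "AE s in lborel. s \<in> J \<and> s \<le> y \<longrightarrow> l \<le> \<bar>f' s\<bar>"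
      using L
    proof eventually_elim
      case (elim s)
      show ?case
      proof
        assume s: "s \<in> J \<and> s \<le> y"
        then have "\<bar>LINT r:(J \<inter> {..s})|lborel. k r\<bar> < l" using y by blast
        moreover have "f' s = L - (LINT r:(J \<inter> {..s})|lborel. k r)" using s elim by (simp add: f'_def)
        ultimately show "l \<le> \<bar>f' s\<bar>" unfolding l_def by linarith
      qed
    qed
    have low: "(b - a) * l \<le> (LINT s|lborel. indicator {a<..b} s * \<bar>f' s\<bar>)"
      if "a \<le> b" "b \<le> y" "{a<..b} \<subseteq> J" for a b
    proof -
      have "(b - a) * l = (LINT s|lborel. indicator {a<..b} s * l)" using that by simp
      also have "\<dots> \<le> (LINT s|lborel. indicator {a<..b} s * \<bar>f' s\<bar>)"
      proof (rule integral_mono_AE)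
        show "integrable lborel (\<lambda>s. indicator {a<..b} s * l)"
          using that by (intro integrable_mult_left integrable_real_indicator) auto
        show "integrable lborel (\<lambda>s. indicator {a<..b} s * \<bar>f' s\<bar>)"
          by (rule Bochner_Integration.integrable_bound[OF f']) (auto simp: indicator_def)
        show "AE s in lborel. indicator {a<..b} s * l \<le> indicator {a<..b} s * \<bar>f' s\<bar>"
          using big by eventually_elim (use that in \<open>auto simp: indicator_def\<close>)
      qed
      finally show ?thesis .
    qed
    show False
    proof (cases "bdd_below J")
      case False
      have "J = UNIV"
      proof -
        have "x \<in> J" for x
        proof -
          obtain z where "z \<in> J" "z < x" using False by (metis bdd_below.I not_le)
          then show ?thesis using J_up by auto
        qed
        then show ?thesis by blast
      qed
      define M where "M = (LINT s|lborel. \<bar>f' s\<bar>)"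
      have M0: "M \<ge> 0" by (simp add: M_def)
      \<comment> \<open>An interval of this length carries mass at least \<open>M + 1\<close>, more
        than the norm \<open>M\<close> of \<open>f\<close>.\<close>
      define a where "a = (M + 1) / l"
      have a: "a \<ge> 0" using M0 l by (simp add: a_def)
      have "M + 1 = (y - (y - a)) * l" using l by (simp add: a_def)
      also have "\<dots> \<le> (LINT s|lborel. indicator {y - a<..y} s * \<bar>f' s\<bar>)"
        using a \<open>J = UNIV\<close> by (intro low) auto
      also have "\<dots> \<le> M"
        unfolding M_def using f' by (intro integral_mono') (auto simp: indicator_def)
      finally show False by simp
    next
      case True
      define m where "m = Inf J"
      have m_less: "m < s" if sJ: "s \<in> J" for s
      proof -
        obtain d where d: "d > 0" "ball s d \<subseteq> J" using J_open sJ open_contains_ball by blast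
        have "s - d / 2 \<in> ball s d" using d by (auto simp: dist_real_def)
        then have "m \<le> s - d / 2" unfolding m_def using True d by (intro cInf_lower) auto
        then show ?thesis using d by simp
      qed
      have m_gt: "s \<in> J" if ms: "m < s" for s
      proof -
        obtain x where "x \<in> J" "x < s" using ms cInf_less_iff[OF J_ne True] unfolding m_def by blast
        then show ?thesis using J_up by auto
      qed
      have abs_v: "set_integrable lborel J (\<lambda>s. \<bar>v s\<bar>)" using v by (rule set_integrable_abs)
      \<comment> \<open>On \<open>{m<..m + t}\<close> the quotient equals \<open>- f / t\<close> and
        has mass at least \<open>l\<close>. It differs from \<open>v\<close> by a defect below
        \<open>l / 2\<close>, and \<open>v\<close> itself has mass below \<open>l / 2\<close> so
        close to \<open>m\<close>; together these give \<open>l < l\<close>.\<close>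
      obtain x where x: "x \<in> J" "\<And>s. s \<in> J \<Longrightarrow> s \<le> x \<Longrightarrow> \<bar>LINT r:(J \<inter> {..s})|lborel. \<bar>v r\<bar>\<bar> < l / 2"
        using set_integral_lower_tendsto_0[OF J_open J_ne abs_v half_gt_zero[OF l]] by blast
      have "\<forall>\<^sub>F t in at_right 0. (LINT s:J|lborel. \<bar>(T t f s - f s) / t - v s\<bar>) < l / 2"
        using order_tendstoD(2)[OF lim half_gt_zero[OF l]] .
      moreover have "\<forall>\<^sub>F t in at_right 0. t < min (y - m) (x - m)"
      proof -
        have "0 < min (y - m) (x - m)" using m_less[OF x(1)] m_less[OF y(1)] by simp
        from eventually_at_right_real[OF this] show ?thesis by eventually_elim auto
      qed
      moreover have "\<forall>\<^sub>F t::real in at_right 0. 0 < t" by (rule eventually_at_right_less)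
      ultimately have "\<forall>\<^sub>F t::real in at_right 0. False"
      proof eventually_elim
        case (elim t)
        have sub: "{m<..m + t} \<subseteq> J" using m_gt by auto
        have mt: "m + t \<in> J" "m + t \<le> x" "m + t \<le> y" using elim m_gt by auto
        have di: "integrable lborel (\<lambda>s. \<bar>(T t f s - f' s) / t - v' s\<bar>)"
          using generator_defect_integral(1)[OF f v elim(3)] unfolding f'_def v'_def by (rule integrable_abs)
        have vi: "integrable lborel (\<lambda>s. indicator (J \<inter> {..m + t}) s * \<bar>v s\<bar>)"
          using set_integrable_subset[OF abs_v, of "J \<inter> {..m + t}"] by (simp add: set_integrable_def)
        have "l = ((m + t) - m) * l / t" using elim by simp
        also have "\<dots> \<le> (LINT s|lborel. indicator {m<..m + t} s * \<bar>f' s\<bar>) / t"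
          using elim mt sub by (intro divide_right_mono low) auto
        also have "\<dots> = (LINT s|lborel. indicator {m<..m + t} s * \<bar>f' s\<bar> / t)" by simp
        also have "\<dots> \<le> (LINT s|lborel. \<bar>(T t f s - f' s) / t - v' s\<bar> + indicator (J \<inter> {..m + t}) s * \<bar>v s\<bar>)"
        proof (rule integral_mono')
          show "integrable lborel (\<lambda>s. \<bar>(T t f s - f' s) / t - v' s\<bar> + indicator (J \<inter> {..m + t}) s * \<bar>v s\<bar>)"
            using di vi by (rule Bochner_Integration.integrable_add)
          fix s
          show "indicator {m<..m + t} s * \<bar>f' s\<bar> / t \<le> \<bar>(T t f s - f' s) / t - v' s\<bar> + indicator (J \<inter> {..m + t}) s * \<bar>v s\<bar>"
          proof (cases "s \<in> {m<..m + t}")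
            case True
            then have s: "s \<in> J" "s - t \<notin> J" using sub m_less[of "s - t"] by auto
            have "\<bar>f' s / t\<bar> \<le> \<bar>- f' s / t - v' s\<bar> + \<bar>v' s\<bar>" by linarith
            then show ?thesis using s True elim by (simp add: T_def v'_def)
          qed simp
        qed (auto simp: indicator_def)
        also have "\<dots> = (LINT s|lborel. \<bar>(T t f s - f' s) / t - v' s\<bar>) + (LINT s|lborel. indicator (J \<inter> {..m + t}) s * \<bar>v s\<bar>)"
          by (rule Bochner_Integration.integral_add[OF di vi])
        also have "(LINT s|lborel. \<bar>(T t f s - f' s) / t - v' s\<bar>) < l / 2"
          using elim(1) unfolding generator_defect_integral(2)[OF f v elim(3)] by (simp add: f'_def v'_def)
        also have "(LINT s|lborel. indicator (J \<inter> {..m + t}) s * \<bar>v s\<bar>) < l / 2"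
          using x(2)[OF mt(1,2)] by (simp add: set_lebesgue_integral_def)
        finally show ?case by simp
      qed
      then show False by simp
    qed
  qed
  with L show ?thesis by (simp add: k_def)
qed

theorem generator_iff_integral_equation:
  "generator J T f v \<longleftrightarrow> L1 J f \<and> L1 J v \<and> L1 J (\<lambda>s. \<psi> s * f s) \<and>
    (AE s in lborel. s \<in> J \<longrightarrow> f s = - (LINT r:(J \<inter> {..s})|lborel. v r + \<psi> r * f r))"
  (is "?L \<longleftrightarrow> ?R")
proof
  assume gen: ?L
  then have "L1 J f" "L1 J v" by (auto simp: generator_def)
  moreover have "L1 J (\<lambda>s. \<psi> s * f s)" using generator_imp_integrable_killing[OF gen] by (simp add: L1_def)
  ultimately show ?R using generator_imp_integral_equation[OF gen] by (intro conjI)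
next
  assume ?R
  then show ?L unfolding L1_def by (intro integral_equation_imp_generator) (elim conjE, assumption)+
qed

end

section \<open>Straightening the flow\<close>

text \<open>Both choices of base point give the same increments. If the base point is
  \<open>d0\<close>, its defining condition supplies the integrability up to \<open>d0\<close> that
  splitting the integral requires.\<close>

lemma primitive_on_prim:
  assumes c: "c \<in> Eint d0 d1"
    and loc: "\<And>x y. x \<le> y \<Longrightarrow> {x..y} \<subseteq> Eint d0 d1 \<Longrightarrow> set_integrable lborel {x..y} h"
  shows "primitive_on (Eint d0 d1) (prim d0 d1 c h) h"
proof (cases "\<forall>x\<in>Eint d0 d1. set_integrable lborel {z. d0 < ereal z \<and> z \<le> x} h")
  case True
  have "primitive_on (Eint d0 d1) (\<lambda>x. LBINT z=d0..ereal x. h z) h"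
  proof (rule primitive_on_interval_integral[OF _ loc])
    fix x y :: real assume xy: "x \<le> y" "{x..y} \<subseteq> Eint d0 d1"
    then have "x \<in> Eint d0 d1" "y \<in> Eint d0 d1" by auto
    then have d: "d0 < ereal x" "d0 < ereal y" and
      i: "set_integrable lborel {z. d0 < ereal z \<and> z \<le> y} h" using True by (auto simp: Eint_def)
    have "set_integrable lborel (einterval d0 (ereal y)) h"
      by (rule set_integrable_subset[OF i]) (auto simp: einterval_def)
    then show "interval_lebesgue_integrable lborel (min d0 (ereal x)) (max d0 (ereal y)) h"
      using d[THEN less_imp_le] by (simp add: interval_lebesgue_integrable_def min_def max_def)
  qed
  then show ?thesis using True by (simp add: prim_def[abs_def] base_pt_def)
next
  case False
  have "primitive_on (Eint d0 d1) (\<lambda>x. LBINT z=ereal c..ereal x. h z) h"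
    by (rule primitive_on_exists[OF loc Eint_convex c])
  moreover have "base_pt d0 d1 c h = ereal c" unfolding base_pt_def by (rule if_not_P[OF False])
  ultimately show ?thesis by (simp add: prim_def[abs_def])
qed

text \<open>For a continuous integrand the derivative exists at every point, not just a.e.;
  \<open>G\<close> needs this in order to serve as a change of variables with a differentiable
  inverse.\<close>

lemma primitive_on_derivative:
  assumes E: "open E" and w: "primitive_on E w h" and h: "continuous_on E h" and x: "x \<in> E"
  shows "(w has_real_derivative h x) (at x)"
proof -
  obtain e where e: "e > 0" "cball x e \<subseteq> E" using E x open_contains_cball by blast
  then have sub: "{x - e..x + e} \<subseteq> E" by (simp add: cball_eq_atLeastAtMost)
  have "((\<lambda>y. integral {x - e..y} h) has_real_derivative h x) (at x within {x - e..x + e})"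
    by (rule integral_has_real_derivative) (use continuous_on_subset[OF h sub] e in auto)
  then have "((\<lambda>y. integral {x - e..y} h) has_real_derivative h x) (at x)"
    using e by (subst (asm) at_within_Icc_at) auto
  then have "((\<lambda>y. w (x - e) + integral {x - e..y} h) has_real_derivative h x) (at x)"
    by (auto intro!: derivative_eq_intros)
  then show ?thesis
  proof (rule has_field_derivative_transform_within_open[where S="{x - e<..<x + e}"])
    fix y assume "y \<in> {x - e<..<x + e}"
    then have "x - e \<le> y" "{x - e..y} \<subseteq> E" using sub by auto
    from primitive_onD[OF w this] show "w (x - e) + integral {x - e..y} h = w y"
      by (simp add: set_borel_integral_eq_integral(2))
  qed (use e in auto)
qed

text \<open>Change of variables speaks of absolute integrability over the completed measure. For
  Borel integrands the completion makes no difference.\<close>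

lemma set_integrable_lebesgue_iff_lborel:
  fixes u :: "real \<Rightarrow> real"
  assumes "(\<lambda>x. indicator S x * u x) \<in> borel_measurable borel"
  shows "u absolutely_integrable_on S \<longleftrightarrow> set_integrable lborel S u"
  using integrable_completion[of "\<lambda>x. indicator S x * u x" lborel] assms
  by (simp add: set_integrable_def)

locale growth_flow =
  fixes d0 d1 :: ereal and g \<phi> :: "real \<Rightarrow> real" and c :: real
  assumes g_cont: "continuous_on (Eint d0 d1) g"
    and g_pos: "\<And>x. x \<in> Eint d0 d1 \<Longrightarrow> g x > 0"
    and \<phi>_meas: "(\<lambda>x. indicator (Eint d0 d1) x * \<phi> x) \<in> borel_measurable borel"
    and \<phi>_nonneg: "\<And>x. x \<in> Eint d0 d1 \<Longrightarrow> \<phi> x \<ge> 0"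
    and \<phi>_loc: "\<And>a b. {a..b} \<subseteq> Eint d0 d1 \<Longrightarrow> set_integrable lborel {a..b} \<phi>"
    and c: "c \<in> Eint d0 d1"
    and G_unbounded: "\<forall>M. \<exists>y\<in>Eint d0 d1. \<forall>x\<in>Eint d0 d1. y \<le> x \<longrightarrow> M \<le> Gfun d0 d1 c g x"
begin

definition E where "E = Eint d0 d1"
definition G where "G = Gfun d0 d1 c g"
definition Q where "Q = Qfun d0 d1 c g \<phi>"
definition J where "J = G ` E"
definition H where "H = the_inv_into E G"
text \<open>Rates are transported by plain composition, whereas densities also pick up the factor
  \<open>g\<close>, as in \<open>tr\<close>.\<close>

definition \<psi> where "\<psi> s = \<phi> (H s)"
definition q where "q s = Q (H s)"

text \<open>Since \<open>ds = dx / g x\<close> under \<open>s = G x\<close>, this is an isometry of \<open>L\<^sup>1(E)\<close> onto \<open>L\<^sup>1(J)\<close>.\<close>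
definition tr where "tr u s = g (H s) * u (H s)"

lemma E_open: "open E" by (simp add: E_def)
lemma E_borel [measurable]: "E \<in> sets borel" using E_open by simp
lemma E_convex: "x \<in> E \<Longrightarrow> y \<in> E \<Longrightarrow> {x..y} \<subseteq> E" by (simp add: E_def Eint_convex)
lemma g_pos': "x \<in> E \<Longrightarrow> g x > 0" using g_pos by (simp add: E_def)

lemma inverse_g_cont: "continuous_on E (\<lambda>z. 1 / g z)"
  using g_cont g_pos by (intro continuous_on_divide continuous_on_const) (auto simp: E_def dest: g_pos)

lemma G_primitive: "primitive_on E G (\<lambda>z. 1 / g z)"
  unfolding G_def Gfun_def E_def
proof (rule primitive_on_prim[OF c])
  fix x y assume "{x..y} \<subseteq> Eint d0 d1"
  then show "set_integrable lborel {x..y} (\<lambda>z. 1 / g z)"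
    using continuous_on_subset[OF inverse_g_cont] by (intro borel_integrable_atLeastAtMost') (simp add: E_def)
qed

lemma Q_primitive: "primitive_on E Q (\<lambda>z. \<phi> z / g z)"
  unfolding Q_def Qfun_def E_def
proof (rule primitive_on_prim[OF c])
  fix x y assume xy: "{x..y} \<subseteq> Eint d0 d1"
  then have "continuous_on {x..y} (\<lambda>z. 1 / g z)"
    using continuous_on_subset[OF inverse_g_cont] by (simp add: E_def)
  from set_integrable_mult_continuous[OF \<phi>_loc[OF xy] this]
  show "set_integrable lborel {x..y} (\<lambda>z. \<phi> z / g z)" by simp
qed

lemma G_deriv: "x \<in> E \<Longrightarrow> (G has_real_derivative 1 / g x) (at x)"
  by (rule primitive_on_derivative[OF E_open G_primitive inverse_g_cont])

lemma G_cont: "continuous_on E G"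
  by (rule primitive_on_continuous[OF E_open G_primitive])

lemma G_strict_mono: "x \<in> E \<Longrightarrow> y \<in> E \<Longrightarrow> x < y \<Longrightarrow> G x < G y"
proof -
  assume *: "x \<in> E" "y \<in> E" "x < y"
  show "G x < G y"
  proof (rule DERIV_pos_imp_increasing[OF *(3)])
    fix z assume "x \<le> z" "z \<le> y"
    then have "z \<in> E" using E_convex[OF *(1,2)] by auto
    then show "\<exists>d. (G has_real_derivative d) (at z) \<and> 0 < d" using G_deriv[of z] g_pos'[of z] by auto
  qed
qed

lemma G_le_iff: "x \<in> E \<Longrightarrow> y \<in> E \<Longrightarrow> G x \<le> G y \<longleftrightarrow> x \<le> y"
  using G_strict_mono[of x y] G_strict_mono[of y x] by (cases x y rule: linorder_cases) auto

lemma G_inj: "inj_on G E"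
  using G_le_iff by (intro inj_onI) (metis order_antisym order_refl)

lemma H_G: "x \<in> E \<Longrightarrow> H (G x) = x"
  unfolding H_def by (rule the_inv_into_f_f[OF G_inj])

lemma G_H: "s \<in> J \<Longrightarrow> G (H s) = s" and H_E: "s \<in> J \<Longrightarrow> H s \<in> E"
  by (auto simp: J_def H_G)

lemma G_J: "x \<in> E \<Longrightarrow> G x \<in> J" by (simp add: J_def)

lemma G_IVT: "x \<in> E \<Longrightarrow> y \<in> E \<Longrightarrow> x \<le> y \<Longrightarrow> G x \<le> s \<Longrightarrow> s \<le> G y \<Longrightarrow> s \<in> J"
proof -
  assume *: "x \<in> E" "y \<in> E" "x \<le> y" "G x \<le> s" "s \<le> G y"
  have "continuous_on {x..y} G" using G_cont E_convex[OF *(1,2)] by (rule continuous_on_subset)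
  from IVT'[OF *(4,5,3) this] obtain z where "x \<le> z" "z \<le> y" "G z = s" by blast
  then show "s \<in> J" using E_convex[OF *(1,2)] by (auto simp: J_def)
qed

lemma J_open: "open J"
  unfolding open_contains_ball
proof
  fix s assume "s \<in> J"
  then obtain x where x: "x \<in> E" "s = G x" by (auto simp: J_def)
  obtain e where e: "e > 0" "cball x e \<subseteq> E" using E_open x(1) open_contains_cball by blast
  then have sub: "{x - e..x + e} \<subseteq> E" by (simp add: cball_eq_atLeastAtMost)
  then have pq: "x - e \<in> E" "x + e \<in> E" using e by auto
  define d where "d = min (s - G (x - e)) (G (x + e) - s)"
  have "d > 0" using G_strict_mono[OF pq(1) x(1)] G_strict_mono[OF x(1) pq(2)] e x by (simp add: d_def)
  moreover have "ball s d \<subseteq> J"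
  proof
    fix z assume "z \<in> ball s d"
    then have "G (x - e) \<le> z" "z \<le> G (x + e)" by (auto simp: d_def dist_real_def)
    then show "z \<in> J" using G_IVT[OF pq] e by simp
  qed
  ultimately show "\<exists>e>0. ball s e \<subseteq> J" by blast
qed

lemma J_borel [measurable]: "J \<in> sets borel" using J_open by simp

lemma J_up: "s \<in> J \<Longrightarrow> s \<le> t \<Longrightarrow> t \<in> J"
proof -
  assume "s \<in> J" and st: "s \<le> t"
  then obtain x where x: "x \<in> E" "s = G x" by (auto simp: J_def)
  obtain y where y: "y \<in> E" "\<forall>x\<in>E. y \<le> x \<longrightarrow> t \<le> G x"
    using G_unbounded[THEN spec, of t] unfolding E_def G_def by (elim bexE)
  define z where "z = max x y"
  have z: "z \<in> E" "x \<le> z" "y \<le> z" using x y by (auto simp: z_def max_def)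
  show "t \<in> J" using G_IVT[OF x(1) z(1,2)] st x y(2)[rule_format, OF z(1,3)] by simp
qed

lemma J_ne: "J \<noteq> {}" using c by (auto simp: J_def E_def)

lemma H_deriv: "s \<in> J \<Longrightarrow> (H has_real_derivative g (H s)) (at s)"
proof -
  assume s: "s \<in> J"
  have pos: "g (H s) > 0" by (rule g_pos'[OF H_E[OF s]])
  have "(H has_derivative (*) (g (H s))) (at (G (H s)))"
  proof (rule has_derivative_inverse_strong[OF E_open H_E[OF s] G_cont])
    show "(G has_derivative (*) (1 / g (H s))) (at (H s))"
      using G_deriv[OF H_E[OF s]] by (simp add: has_field_derivative_def)
    show "(*) (1 / g (H s)) \<circ> (*) (g (H s)) = id" using pos by (auto simp: fun_eq_iff)
  qed (rule H_G)
  then show ?thesis using G_H[OF s] by (simp add: has_field_derivative_def)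
qed

lemma H_cont: "continuous_on J H"
  using H_deriv by (intro continuous_at_imp_continuous_on ballI) (auto intro: DERIV_isCont)

lemma H_le_iff: "r \<in> J \<Longrightarrow> s \<in> J \<Longrightarrow> H r \<le> H s \<longleftrightarrow> r \<le> s"
  using G_le_iff[of "H r" "H s"] by (simp add: H_E G_H)

section \<open>Measurability and integrals under the substitution\<close>

lemma tr_G: "x \<in> E \<Longrightarrow> tr u (G x) = g x * u x"
  by (simp add: tr_def H_G)

lemma measurable_G: "(\<lambda>x. indicator E x * G x) \<in> borel_measurable borel"
  using borel_measurable_continuous_on_indicator[OF E_borel G_cont] by simp

lemma measurable_H: "(\<lambda>s. indicator J s * H s) \<in> borel_measurable borel"
  using borel_measurable_continuous_on_indicator[OF J_borel H_cont] by simp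

lemma measurable_g: "(\<lambda>x. indicator E x * g x) \<in> borel_measurable borel"
  using borel_measurable_continuous_on_indicator[OF E_borel, of g] g_cont by (simp add: E_def)

text \<open>\<open>G\<close>, \<open>H\<close> and \<open>g\<close> are continuous only on
  \<open>E\<close> or \<open>J\<close>, so the compositions are formed from their cut-off versions,
  which are Borel on the line. The way back from \<open>tr u\<close> to \<open>u\<close> divides by
  \<open>g\<close>, which is positive on \<open>E\<close>.\<close>

lemma measurable_tr_iff:
  "(\<lambda>s. indicator J s * tr u s) \<in> borel_measurable borel \<longleftrightarrow> (\<lambda>x. indicator E x * u x) \<in> borel_measurable borel"
proof
  note measurable_G[measurable] measurable_H[measurable] measurable_g[measurable]
  assume [measurable]: "(\<lambda>s. indicator J s * tr u s) \<in> borel_measurable borel"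
  let ?tr = "\<lambda>s. indicator J s * tr u s"
  have "(\<lambda>x. indicator E x * (?tr (indicator E x * G x) / (indicator E x * g x))) \<in> borel_measurable borel"
    by measurable
  also have "(\<lambda>x. indicator E x * (?tr (indicator E x * G x) / (indicator E x * g x))) = (\<lambda>x. indicator E x * u x)"
    using g_pos' by (auto simp: indicator_def fun_eq_iff tr_G G_J less_imp_neq[symmetric])
  finally show "(\<lambda>x. indicator E x * u x) \<in> borel_measurable borel" .
next
  note measurable_H[measurable] measurable_g[measurable]
  assume [measurable]: "(\<lambda>x. indicator E x * u x) \<in> borel_measurable borel"
  let ?u = "\<lambda>x. indicator E x * u x" and ?g = "\<lambda>x. indicator E x * g x"
  have "(\<lambda>s. indicator J s * (?g (indicator J s * H s) * ?u (indicator J s * H s))) \<in> borel_measurable borel"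
    by measurable
  also have "(\<lambda>s. indicator J s * (?g (indicator J s * H s) * ?u (indicator J s * H s))) = (\<lambda>s. indicator J s * tr u s)"
    by (auto simp: indicator_def fun_eq_iff tr_def H_E)
  finally show "(\<lambda>s. indicator J s * tr u s) \<in> borel_measurable borel" .
qed

text \<open>Change of variables: the Jacobian \<open>1 / g x\<close> of \<open>G\<close> cancels the
  factor \<open>g\<close> in \<open>tr\<close>, so that \<open>1 / g x * tr u (G x)\<close> is
  \<open>u x\<close> again.\<close>

lemma tr_integral:
  assumes u: "(\<lambda>x. indicator E x * u x) \<in> borel_measurable borel"
    and S: "S \<in> sets borel" "S \<subseteq> E" "G ` S \<in> sets borel"
  shows "set_integrable lborel S u \<longleftrightarrow> set_integrable lborel (G ` S) (tr u)"
    and "set_integrable lborel S u \<Longrightarrow> (LINT x:S|lborel. u x) = (LINT s:(G ` S)|lborel. tr u s)"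
proof -
  note tu = measurable_tr_iff[THEN iffD2, OF u]
  have "(\<lambda>x. indicator S x * (indicator E x * u x)) \<in> borel_measurable borel"
    using u S by measurable
  also have "(\<lambda>x. indicator S x * (indicator E x * u x)) = (\<lambda>x. indicator S x * u x)"
    using S by (auto simp: indicator_def fun_eq_iff)
  finally have mS: "(\<lambda>x. indicator S x * u x) \<in> borel_measurable borel" .
  have "(\<lambda>s. indicator (G ` S) s * (indicator J s * tr u s)) \<in> borel_measurable borel"
    using tu S by measurable
  also have "(\<lambda>s. indicator (G ` S) s * (indicator J s * tr u s)) = (\<lambda>s. indicator (G ` S) s * tr u s)"
    using S by (auto simp: indicator_def J_def fun_eq_iff)
  finally have mGS: "(\<lambda>s. indicator (G ` S) s * tr u s) \<in> borel_measurable borel" .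
  have eq: "\<bar>1 / g x\<bar> * tr u (G x) = u x" if "x \<in> S" for x
    using that S g_pos'[of x] by (auto simp: tr_G)
  have cov: "(\<lambda>x. \<bar>1 / g x\<bar> * tr u (G x)) absolutely_integrable_on S \<and>
           integral S (\<lambda>x. \<bar>1 / g x\<bar> * tr u (G x)) = b
     \<longleftrightarrow> tr u absolutely_integrable_on (G ` S) \<and> integral (G ` S) (tr u) = b" for b
    by (rule has_absolute_integral_change_of_variables_1')
      (use S G_deriv in \<open>auto intro: has_field_derivative_at_within inj_on_subset[OF G_inj]\<close>)
  have "(\<lambda>x. \<bar>1 / g x\<bar> * tr u (G x)) absolutely_integrable_on S \<longleftrightarrow> u absolutely_integrable_on S"
    unfolding set_integrable_def using eq by (intro Bochner_Integration.integrable_cong) (auto simp: indicator_def)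
  moreover have "integral S (\<lambda>x. \<bar>1 / g x\<bar> * tr u (G x)) = integral S u"
    using eq by (intro integral_cong)
  ultimately have cov': "u absolutely_integrable_on S \<and> integral S u = b
     \<longleftrightarrow> tr u absolutely_integrable_on (G ` S) \<and> integral (G ` S) (tr u) = b" for b
    using cov[of b] by simp
  \<comment> \<open>The free value \<open>b\<close> is taken as the integral on the side whose
    integrability is assumed, once for each direction.\<close>
  show iff: "set_integrable lborel S u \<longleftrightarrow> set_integrable lborel (G ` S) (tr u)"
    using cov'[of "integral S u"] cov'[of "integral (G ` S) (tr u)"]
    by (auto simp: set_integrable_lebesgue_iff_lborel[OF mS] set_integrable_lebesgue_iff_lborel[OF mGS])
  show "(LINT x:S|lborel. u x) = (LINT s:(G ` S)|lborel. tr u s)" if i: "set_integrable lborel S u"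
    using cov'[of "integral S u"] i iff
    by (simp add: set_integrable_lebesgue_iff_lborel[OF mS] set_borel_integral_eq_integral(2))
qed

text \<open>Either side contains the measurability that the substitution rule asks for, so no
  premise on \<open>u\<close> remains.\<close>

lemma L1_tr: "L1 J (tr u) \<longleftrightarrow> L1 E u"
proof -
  have "(\<lambda>s. indicator J s * tr u s) \<in> borel_measurable borel" if "L1 J (tr u)"
    using that unfolding L1_def set_integrable_def by (auto dest: borel_measurable_integrable)
  moreover have "(\<lambda>x. indicator E x * u x) \<in> borel_measurable borel" if "L1 E u"
    using that unfolding L1_def set_integrable_def by (auto dest: borel_measurable_integrable)
  moreover have "L1 J (tr u) \<longleftrightarrow> L1 E u" if m: "(\<lambda>x. indicator E x * u x) \<in> borel_measurable borel"
    using tr_integral(1)[OF m E_borel order_refl] J_borel by (simp only: L1_def J_def)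
  ultimately show ?thesis unfolding measurable_tr_iff by blast
qed

lemma L1_measurable: "L1 E u \<Longrightarrow> (\<lambda>x. indicator E x * u x) \<in> borel_measurable borel"
  unfolding L1_def set_integrable_def by (auto dest: borel_measurable_integrable)

lemma G_image_Icc: "r \<in> J \<Longrightarrow> r \<le> s \<Longrightarrow> G ` {H r..H s} = {r..s}"
proof -
  assume rs: "r \<in> J" "r \<le> s"
  then have s: "s \<in> J" by (rule J_up)
  show ?thesis
  proof (intro set_eqI iffI)
    fix z assume "z \<in> G ` {H r..H s}"
    then obtain x where x: "z = G x" "H r \<le> x" "x \<le> H s" by auto
    then have "x \<in> E" using E_convex[OF H_E[OF rs(1)] H_E[OF s]] by auto
    then show "z \<in> {r..s}"
      using G_le_iff[OF H_E[OF rs(1)], of x] G_le_iff[OF _ H_E[OF s], of x] x G_H[OF rs(1)] G_H[OF s] by auto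
  next
    fix z assume z: "z \<in> {r..s}"
    then have "z \<in> J" using J_up[OF rs(1)] by auto
    then have "z = G (H z)" "H z \<in> {H r..H s}" using H_le_iff rs s z by (auto simp: G_H)
    then show "z \<in> G ` {H r..H s}" by blast
  qed
qed

lemma measurable_\<phi>_g: "(\<lambda>x. indicator E x * (\<phi> x / g x)) \<in> borel_measurable borel"
proof -
  note measurable_g[measurable] \<phi>_meas[folded E_def, measurable]
  have "(\<lambda>x. (indicator E x * \<phi> x) / (indicator E x * g x)) \<in> borel_measurable borel" by measurable
  also have "(\<lambda>x. (indicator E x * \<phi> x) / (indicator E x * g x)) = (\<lambda>x. indicator E x * (\<phi> x / g x))"
    by (auto simp: indicator_def)
  finally show ?thesis .
qed

lemma tr_\<phi>_g: "s \<in> J \<Longrightarrow> tr (\<lambda>x. \<phi> x / g x) s = \<psi> s"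
  using g_pos'[OF H_E, of s] by (simp add: tr_def \<psi>_def)

text \<open>The substantial point is that \<open>q\<close> is a primitive of \<psi>: substituting
  \<open>s = G x\<close> in the integral that gives the increments of \<open>Q\<close> absorbs the
  denominator \<open>g\<close>, because \<open>tr\<close> sends \<phi> / g to \<psi>.\<close>

sublocale KT: killed_translation J \<psi> q
proof
  show "open J" "J \<noteq> {}" "\<And>s t. s \<in> J \<Longrightarrow> s \<le> t \<Longrightarrow> t \<in> J" by (fact J_open J_ne J_up)+
  show "0 \<le> \<psi> s" if "s \<in> J" for s using \<phi>_nonneg[of "H s"] H_E[OF that] by (simp add: \<psi>_def E_def)
  have "(\<lambda>s. indicator J s * tr (\<lambda>x. \<phi> x / g x) s) = (\<lambda>s. indicator J s * \<psi> s)"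
    by (auto simp: indicator_def tr_\<phi>_g)
  then show "(\<lambda>s. indicator J s * \<psi> s) \<in> borel_measurable borel"
    using measurable_tr_iff[THEN iffD2, OF measurable_\<phi>_g] by simp
  show "primitive_on J q \<psi>"
    unfolding primitive_on_def
  proof (intro allI impI, elim conjE)
    fix r s assume rs: "r \<le> s" "{r..s} \<subseteq> J"
    then have r: "r \<in> J" and s: "s \<in> J" by auto
    note GI = G_image_Icc[OF r rs(1)]
    have sub: "{H r..H s} \<subseteq> E" by (rule E_convex[OF H_E[OF r] H_E[OF s]])
    have le: "H r \<le> H s" using H_le_iff[OF r s] rs by simp
    note p = primitive_onD[OF Q_primitive le sub]
    have b: "{H r..H s} \<in> sets borel" "G ` {H r..H s} \<in> sets borel" by (auto simp: GI)
    have "set_integrable lborel {r..s} (tr (\<lambda>x. \<phi> x / g x))"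
      using tr_integral(1)[OF measurable_\<phi>_g b(1) sub b(2)] p(1) by (simp add: GI)
    moreover have "set_integrable lborel {r..s} (tr (\<lambda>x. \<phi> x / g x)) = set_integrable lborel {r..s} \<psi>"
      using rs tr_\<phi>_g by (intro set_integrable_cong) auto
    moreover have "q s - q r = (LINT z:{r..s}|lborel. tr (\<lambda>x. \<phi> x / g x) z)"
      using tr_integral(2)[OF measurable_\<phi>_g b(1) sub b(2) p(1)] p(2) by (simp add: GI q_def)
    moreover have "(LINT z:{r..s}|lborel. tr (\<lambda>x. \<phi> x / g x) z) = (LINT z:{r..s}|lborel. \<psi> z)"
      using rs tr_\<phi>_g by (intro set_lebesgue_integral_cong) auto
    ultimately show "set_integrable lborel {r..s} \<psi> \<and> q s - q r = (LINT z:{r..s}|lborel. \<psi> z)" by simp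
  qed
qed

text \<open>The values \<open>d0\<close> and \<open>d1\<close> that extend the inverse of
  \<open>G\<close> lie outside \<open>E\<close>, so the cut-off in the definition of the semigroups
  amounts to \<open>G x - t \<in> J\<close>.\<close>

lemma flow_eq:
  assumes x: "x \<in> E"
  shows "flow d0 d1 c g (- t) x \<in> ereal ` E \<longleftrightarrow> G x - t \<in> J"
    and "G x - t \<in> J \<Longrightarrow> flow d0 d1 c g (- t) x = ereal (H (G x - t))"
proof -
  have Ginv: "Ginv d0 d1 G s = (if s \<in> J then ereal (H s)
      else if (\<forall>y\<in>E. s < G y) then d0 else d1)" for s
    unfolding Ginv_def J_def H_def the_inv_into_def E_def[symmetric] by simp
  have fl: "flow d0 d1 c g (- t) x = Ginv d0 d1 G (G x - t)" by (simp add: flow_def G_def)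
  have "d0 \<notin> ereal ` E" "d1 \<notin> ereal ` E" by (auto simp: E_def Eint_def)
  then show "flow d0 d1 c g (- t) x \<in> ereal ` E \<longleftrightarrow> G x - t \<in> J"
    unfolding fl Ginv using H_E[of "G x - t"] by auto
  show "G x - t \<in> J \<Longrightarrow> flow d0 d1 c g (- t) x = ereal (H (G x - t))"
    unfolding fl Ginv by simp
qed

text \<open>The weight \<open>g (H s)\<close> in \<open>tr\<close> cancels the denominator
  \<open>g x\<close> in \<open>P0\<close>, and the numerator \<open>g y\<close> becomes the weight
  of \<open>tr u\<close> at \<open>s - t\<close>.\<close>

lemma tr_Ssg:
  assumes s: "s \<in> J"
  shows "tr (Ssg d0 d1 c g \<phi> t u) s = KT.T t (tr u) s"
proof -
  have x: "H s \<in> E" "G (H s) = s" "g (H s) > 0" using H_E G_H g_pos' s by auto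
  show ?thesis
  proof (cases "s - t \<in> J")
    case True
    then have "flow d0 d1 c g (- t) (H s) = ereal (H (s - t))" "flow d0 d1 c g (- t) (H s) \<in> ereal ` E"
      using flow_eq[OF x(1), of t] x by auto
    then show ?thesis using x s True
      by (simp add: tr_def Ssg_def P0_def KT.T_def q_def Q_def E_def[symmetric] Let_def)
  next
    case False
    then have "flow d0 d1 c g (- t) (H s) \<notin> ereal ` E"
      using flow_eq(1)[OF x(1), of t] x by auto
    then show ?thesis using False by (simp add: tr_def Ssg_def KT.T_def E_def[symmetric])
  qed
qed

text \<open>\<open>tr\<close> is linear, commutes with absolute values since \<open>g > 0\<close>,
  and preserves integrals, so the \<open>L1\<close> distances on both sides coincide for every
  \<open>t > 0\<close>.\<close>

lemma generator_tr:
  "generator E (Ssg d0 d1 c g \<phi>) u v \<longleftrightarrow> generator J KT.T (tr u) (tr v)"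
proof (cases "L1 E u \<and> L1 E v")
  case False then show ?thesis by (auto simp: generator_def L1_tr)
next
  case True
  then have u: "L1 E u" and v: "L1 E v" and tu: "L1 J (tr u)" by (auto simp: L1_tr)
  let ?S = "\<lambda>t. Ssg d0 d1 c g \<phi> t u"
  have S_L1: "L1 E (?S t)" if "t \<ge> 0" for t
  proof -
    have "L1 J (tr (?S t)) \<longleftrightarrow> L1 J (KT.T t (tr u))"
      unfolding L1_def using tr_Ssg by (intro set_integrable_cong) auto
    moreover have "L1 J (KT.T t (tr u))" using KT.T_L1[of "tr u" t] tu that by (simp only: L1_def)
    ultimately show ?thesis by (simp only: L1_tr)
  qed
  have ev1: "\<forall>\<^sub>F t in at_right 0. L1 E (?S t)"
    using eventually_at_right_less[of 0] by eventually_elim (simp add: S_L1)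
  have ev2: "\<forall>\<^sub>F t in at_right 0. L1 J (KT.T t (tr u))"
    using eventually_at_right_less[of 0] by eventually_elim (use KT.T_L1[of "tr u"] tu in \<open>simp only: L1_def less_imp_le\<close>)
  have "\<forall>\<^sub>F t in at_right 0. (LINT x:E|lborel. \<bar>(?S t x - u x) / t - v x\<bar>) =
      (LINT s:J|lborel. \<bar>(KT.T t (tr u) s - tr u s) / t - tr v s\<bar>)"
    using eventually_at_right_less[of 0]
  proof eventually_elim
    case (elim t)
    let ?w = "\<lambda>x. \<bar>(?S t x - u x) / t - v x\<bar>"
    have "set_integrable lborel E (\<lambda>x. (?S t x - u x) / t)"
      by (rule set_integrable_divide, rule set_integral_diff(1)) (use S_L1[of t] u elim in \<open>auto simp: L1_def\<close>)
    then have i: "set_integrable lborel E ?w"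
      by (rule set_integrable_abs[OF set_integral_diff(1)]) (use v in \<open>simp add: L1_def\<close>)
    have "(LINT x:E|lborel. ?w x) = (LINT s:J|lborel. tr ?w s)"
      using tr_integral(2)[OF L1_measurable _ _ _ i] i J_borel by (simp add: L1_def J_def)
    also have "\<dots> = (LINT s:J|lborel. \<bar>(KT.T t (tr u) s - tr u s) / t - tr v s\<bar>)"
    proof (rule set_lebesgue_integral_cong)
      show "\<forall>s. s \<in> J \<longrightarrow> tr ?w s = \<bar>(KT.T t (tr u) s - tr u s) / t - tr v s\<bar>"
      proof (intro allI impI)
        fix s assume s: "s \<in> J"
        have "tr ?w s = \<bar>g (H s) * ((?S t (H s) - u (H s)) / t - v (H s))\<bar>"
          using g_pos'[OF H_E[OF s]] by (simp add: tr_def abs_mult)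
        also have "g (H s) * ((?S t (H s) - u (H s)) / t - v (H s)) = (tr (?S t) s - tr u s) / t - tr v s"
          by (simp add: tr_def algebra_simps diff_divide_distrib)
        finally show "tr ?w s = \<bar>(KT.T t (tr u) s - tr u s) / t - tr v s\<bar>" by (simp add: tr_Ssg[OF s])
      qed
    qed simp
    finally show ?case .
  qed
  from tendsto_cong[OF this] show ?thesis
    using True ev1 ev2 by (simp add: generator_def L1_tr)
qed

text \<open>Differentiable maps of the line send negligible sets to negligible sets; this is applied
  to \<open>G\<close> in one direction and to its inverse \<open>H\<close> in the other.
  \<open>P\<close> may be an arbitrary predicate.\<close>

lemma AE_G_iff: "(AE x in lborel. x \<in> E \<longrightarrow> P (G x)) \<longleftrightarrow> (AE s in lborel. s \<in> J \<longrightarrow> P s)"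
proof
  assume "AE x in lborel. x \<in> E \<longrightarrow> P (G x)"
  from AE_lborel_imp_negligible[OF this] have "negligible {x \<in> E. \<not> P (G x)}" by (simp add: Collect_conj_eq)
  then have "negligible (G ` {x \<in> E. \<not> P (G x)})"
  proof (rule negligible_differentiable_image_negligible[OF order_refl])
    show "G differentiable_on {x \<in> E. \<not> P (G x)}"
      unfolding differentiable_on_def real_differentiable_def
      using G_deriv by (auto intro: has_field_derivative_at_within)
  qed
  then have "AE s in lborel. s \<notin> G ` {x \<in> E. \<not> P (G x)}" by (rule negligible_imp_AE_lborel)
  then show "AE s in lborel. s \<in> J \<longrightarrow> P s" by eventually_elim (auto simp: J_def)
next
  assume "AE s in lborel. s \<in> J \<longrightarrow> P s"
  from AE_lborel_imp_negligible[OF this] have "negligible {s \<in> J. \<not> P s}" by (simp add: Collect_conj_eq)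
  then have "negligible (H ` {s \<in> J. \<not> P s})"
  proof (rule negligible_differentiable_image_negligible[OF order_refl])
    show "H differentiable_on {s \<in> J. \<not> P s}"
      unfolding differentiable_on_def real_differentiable_def
      using H_deriv by (auto intro: has_field_derivative_at_within)
  qed
  then have "AE x in lborel. x \<notin> H ` {s \<in> J. \<not> P s}" by (rule negligible_imp_AE_lborel)
  then show "AE x in lborel. x \<in> E \<longrightarrow> P (G x)"
  proof eventually_elim
    case (elim x)
    show ?case
    proof (intro impI, rule ccontr)
      assume "x \<in> E" "\<not> P (G x)"
      then have "H (G x) \<in> H ` {s \<in> J. \<not> P s}" by (intro imageI) (simp add: G_J)
      with elim \<open>x \<in> E\<close> show False by (simp add: H_G)
    qed
  qed
qed

lemma G_image_lower: "x \<in> E \<Longrightarrow> G ` (E \<inter> {..x}) = J \<inter> {..G x}"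
  using G_le_iff by (auto simp: J_def)

text \<open>At \<open>s = G x\<close> the two integral equations agree term by term:
  \<open>tr u s\<close> is \<open>g x * u x\<close>, and since \<open>G\<close> is increasing it
  carries \<open>E \<inter> {..x}\<close> onto \<open>J \<inter> {..s}\<close>.\<close>

theorem generator_iff_A_graph: "generator E (Ssg d0 d1 c g \<phi>) u v \<longleftrightarrow> A_graph d0 d1 g \<phi> u v"
proof -
  have ne: "Eint d0 d1 \<noteq> {}" using c by auto
  have tr_\<phi>u: "tr (\<lambda>x. \<phi> x * u x) = (\<lambda>s. \<psi> s * tr u s)" by (auto simp: tr_def \<psi>_def)
  have tr_k: "tr (\<lambda>x. v x + \<phi> x * u x) = (\<lambda>s. tr v s + \<psi> s * tr u s)" by (auto simp: tr_def \<psi>_def algebra_simps)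
  have L: "L1 J (\<lambda>s. \<psi> s * tr u s) \<longleftrightarrow> L1 E (\<lambda>x. \<phi> x * u x)" unfolding tr_\<phi>u[symmetric] by (rule L1_tr)
  have "(AE s in lborel. s \<in> J \<longrightarrow> tr u s = - (LINT r:(J \<inter> {..s})|lborel. tr v r + \<psi> r * tr u r)) \<longleftrightarrow>
      (AE x in lborel. x \<in> E \<longrightarrow> g x * u x = - (LINT z:(E \<inter> {..x})|lborel. v z + \<phi> z * u z))"
    if uv: "L1 E v" "L1 E (\<lambda>x. \<phi> x * u x)"
  proof -
    have k: "L1 E (\<lambda>x. v x + \<phi> x * u x)" using uv unfolding L1_def by (rule set_integral_add(1))
    have "(LINT z:(E \<inter> {..x})|lborel. v z + \<phi> z * u z) = (LINT r:(J \<inter> {..G x})|lborel. tr v r + \<psi> r * tr u r)"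
      if x: "x \<in> E" for x
    proof -
      have "set_integrable lborel (E \<inter> {..x}) (\<lambda>x. v x + \<phi> x * u x)"
        using k unfolding L1_def by (rule set_integrable_subset) auto
      from tr_integral(2)[OF L1_measurable[OF k] _ _ _ this] show ?thesis
        by (simp add: G_image_lower[OF x] tr_k)
    qed
    then show ?thesis
      unfolding AE_G_iff[symmetric] by (intro AE_cong) (auto simp: tr_G)
  qed
  then show ?thesis
    unfolding generator_tr KT.generator_iff_integral_equation A_graph_iff_integral_equation[OF ne]
      L1_tr L E_def[symmetric] by blast
qed

end

section \<open>The case without killing\<close>

lemma Ssg_zero: "Ssg d0 d1 c g (\<lambda>_. 0) = P0 d0 d1 c g"
proof (intro ext)
  fix t u x
  have "Qfun d0 d1 c g (\<lambda>_. 0) y = 0" for y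
    by (simp add: Qfun_def prim_def)
  then show "Ssg d0 d1 c g (\<lambda>_. 0) t u x = P0 d0 d1 c g t u x"
    by (simp add: Ssg_def P0_def)
qed

text \<open>\<open>A_graph\<close> leaves \<open>v\<close> free up to a null set, and
  \<open>A0_graph\<close> absorbs this because it prescribes the derivative only a.e.\<close>

lemma A_graph_zero: "A_graph d0 d1 g (\<lambda>_. 0) u v \<longleftrightarrow> A0_graph d0 d1 g u v"
proof
  assume "A_graph d0 d1 g (\<lambda>_. 0) u v"
  then obtain v0 w where *: "L1 (Eint d0 d1) v" "L1 (Eint d0 d1) u" "AC_on (Eint d0 d1) w"
    "AE x in lborel. x \<in> Eint d0 d1 \<longrightarrow> w x = g x * u x"
    "AE x in lborel. x \<in> Eint d0 d1 \<longrightarrow> (w has_real_derivative - v0 x) (at x)"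
    "\<forall>\<epsilon>>0. \<exists>y\<in>Eint d0 d1. \<forall>x\<in>Eint d0 d1. x \<le> y \<longrightarrow> \<bar>w x\<bar> < \<epsilon>"
    "AE x in lborel. x \<in> Eint d0 d1 \<longrightarrow> v x = v0 x - 0 * u x"
    unfolding A_graph_def A0_graph_def by blast
  have "AE x in lborel. x \<in> Eint d0 d1 \<longrightarrow> (w has_real_derivative - v x) (at x)"
    using *(5,7) by eventually_elim auto
  then show "A0_graph d0 d1 g u v" unfolding A0_graph_def using * by blast
next
  assume "A0_graph d0 d1 g u v"
  then show "A_graph d0 d1 g (\<lambda>_. 0) u v"
    unfolding A_graph_def by (intro conjI exI[of _ v]) (auto simp: A0_graph_def L1_def set_integrable_def)
qed

theorem theorem4p2:
  fixes d0 d1 :: ereal and g \<phi> :: "real \<Rightarrow> real" and c :: real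
  assumes "d0 < d1"
    and "continuous_on (Eint d0 d1) g"
    and "\<And>x. x \<in> Eint d0 d1 \<Longrightarrow> g x > 0"
    and "(\<lambda>x. indicator (Eint d0 d1) x * \<phi> x) \<in> borel_measurable borel"
    and "\<And>x. x \<in> Eint d0 d1 \<Longrightarrow> \<phi> x \<ge> 0"
    and "\<And>a b. {a..b} \<subseteq> Eint d0 d1 \<Longrightarrow> set_integrable lborel {a..b} \<phi>"
    and "c \<in> Eint d0 d1"
    and "\<forall>M. \<exists>y\<in>Eint d0 d1. \<forall>x\<in>Eint d0 d1. y \<le> x \<longrightarrow> M \<le> Gfun d0 d1 c g x"
  shows "(\<forall>u v. generator (Eint d0 d1) (P0 d0 d1 c g) u v \<longleftrightarrow> A0_graph d0 d1 g u v)
       \<and> (\<forall>u v. generator (Eint d0 d1) (Ssg d0 d1 c g \<phi>) u v \<longleftrightarrow> A_graph d0 d1 g \<phi> u v)"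
proof -
  interpret S: growth_flow d0 d1 g \<phi> c by unfold_locales (use assms in auto)
  interpret P: growth_flow d0 d1 g "\<lambda>_. 0" c by unfold_locales (use assms in \<open>auto simp: set_integrable_def\<close>)
  show ?thesis
    using S.generator_iff_A_graph P.generator_iff_A_graph
    by (simp add: S.E_def P.E_def Ssg_zero A_graph_zero)
qed

end
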